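(* Let $r\ge2$, $\lambda\in\mathbb{D}\setminus\{0\}$, $z,\beta,\tilde\beta\in\partial\mathbb{D}$, $p\ge 0$, and assume that $\omega$ satisfies $\kappa=\inf_{q\in\mathbb{Z},\,q\ge1}q^2\|q\omega\|>0$. For $\underline{x}\in\mathbb{T}^r$ consider the CMV operator $\mathcal{E}_{\underline{x}}$ with Verblunsky coefficients $$\alpha_{\underline{x};n}=\lambda\exp\left(2\pi i (T_\omega^n\underline{x})_r\right),\qquad n\in\mathbb{Z}.$$ There exist constants $\sigma\in(0,1)$, $\tau\in(0,1)$ and $\gamma>0$ such that for all sufficiently large $N$ $$\left|\left\{\underline{x}\in\mathbb{T}^r:\ [-N,N]\text{ is not }(\gamma,N^\tau,p)\text{-suitable for }\mathcal{E}_{\underline{x};\beta,\tilde\beta}-z\right\}\right|\le e^{-N^\sigma},$$ where $|\cdot|$ denotes Lebesgue measure on $\mathbb{T}^r$.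
   Context: $\mathbb{D}=\{|z|<1\}$, $\partial\mathbb{D}=\{|z|=1\}$, $\mathbb{T}=\mathbb{R}/\mathbb{Z}$, $\|x\|=\mathrm{dist}(x,\mathbb{Z})$; intervals $[a,b]$ are intervals in $\mathbb{Z}$. The skew-shift $T_\omega:\mathbb{T}^r\to\mathbb{T}^r$ is $(T_\omega\underline{x})_1=x_1+\omega$, $(T_\omega\underline{x})_\ell=x_\ell+x_{\ell-1}$ for $2\le\ell\le r$. CMV operators: for coefficients $\alpha_n$ with $|\alpha_n|\le1$ put $\rho_n=\sqrt{1-|\alpha_n|^2}$ and $\Theta_n=\begin{pmatrix}\overline{\alpha_n}&\rho_n\\ \rho_n&-\alpha_n\end{pmatrix}$, acting on $\ell^2(\{n,n+1\})$; $\mathcal{L}=\bigoplus_{n\text{ even}}\Theta_n$, $\mathcal{M}=\bigoplus_{n\text{ odd}}\Theta_n$, $\mathcal{E}=\mathcal{L}\mathcal{M}$ on $\ell^2(\mathbb{Z})$. For $a<b$ and $\beta,\tilde\beta\in\partial\mathbb{D}$, $\mathcal{L}^{[a,b]}_{\beta,\tilde\beta}$ is obtained by setting $\alpha_{a-1}=\beta$, $\alpha_b=\tilde\beta$ in $\mathcal{L}$ and restricting to $\ell^2([a,b])$; $\mathcal{M}^{[a,b]}_{\beta,\tilde\beta}$ is defined in the same way from $\mathcal{M}$; and $\mathcal{E}^{[a,b]}_{\beta,\tilde\beta}=\mathcal{L}^{[a,b]}_{\beta,\tilde\beta}\mathcal{M}^{[a,b]}_{\beta,\tilde\beta}$ (all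 unitary). A subscript $\underline{x}$ indicates that the coefficients are $\alpha_{\underline{x};n}$. The Green's function is $$G^{[a,b]}_{\beta,\tilde\beta}(z;k,\ell)=\left\langle\delta_k,\left(z(\mathcal{L}^{[a,b]}_{\beta,\tilde\beta})^*-\mathcal{M}^{[a,b]}_{\beta,\tilde\beta}\right)^{-1}\delta_\ell\right\rangle .$$ Suitability: for $\gamma,\Gamma>0$ and $p\ge0$, the interval $[-N,N]$ is $(\gamma,\Gamma,p)$-suitable for $\mathcal{E}_{\beta,\tilde\beta}-z$ if (i) $\mathcal{E}^{[-N,N]}_{\beta,\tilde\beta}-z$ is invertible with $\|(\mathcal{E}^{[-N,N]}_{\beta,\tilde\beta}-z)^{-1}\|\le 2^{-p}e^{\Gamma}$; and (ii) for all $k,\ell\in[-N,N]$ with $|k-\ell|\ge N/2$, $|G^{[-N,N]}_{\beta,\tilde\beta}(z;k,\ell)|\le 2^{-(p+1)}e^{-\gamma|k-\ell|}$. *)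

theory Defs
  imports "HOL-Analysis.Analysis" "Jordan_Normal_Form.Schur_Decomposition"
begin

unbundle no vec_syntax

section \<open>The skew-shift on the torus\<close>

text \<open>
  Points of $(\mathbb{R}/\mathbb{Z})^r$ are represented by their representatives in $[0,1)^r$, as
  extensional functions on the index set \<open>{1..r}\<close>.  The measure is completed so that it is
  Lebesgue (not just Borel) measure.
\<close>

definition torus_measure :: "nat \<Rightarrow> (nat \<Rightarrow> real) measure" where
  "torus_measure r = completion (\<Pi>\<^sub>M l\<in>{1..r}. restrict_space lborel {0..<1})"

definition torus :: "nat \<Rightarrow> (nat \<Rightarrow> real) set" where
  "torus r = ({1..r} \<rightarrow>\<^sub>E {0..<1})"

lemma space_torus_measure: "space (torus_measure r) = torus r"
  by (simp add: torus_measure_def torus_def space_PiM space_restrict_space)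

definition skew_shift :: "real \<Rightarrow> nat \<Rightarrow> (nat \<Rightarrow> real) \<Rightarrow> (nat \<Rightarrow> real)" where
  "skew_shift \<omega> r x =
     (\<lambda>l\<in>{1..r}. if l = 1 then frac (x 1 + \<omega>) else frac (x l + x (l - 1)))"

text \<open>Integer iterates of the skew-shift, which is a bijection of the torus.\<close>

definition skew_iter :: "real \<Rightarrow> nat \<Rightarrow> int \<Rightarrow> (nat \<Rightarrow> real) \<Rightarrow> (nat \<Rightarrow> real)" where
  "skew_iter \<omega> r n =
     (if 0 \<le> n then skew_shift \<omega> r ^^ nat n
      else inv_into (torus r) (skew_shift \<omega> r) ^^ nat (- n))"

lemma bij_betw_skew_shift: "bij_betw (skew_shift \<omega> r) (torus r) (torus r)"
proof -
  have cancel: "a = b" if eq: "frac (a + c) = frac (b + c)" "a \<in> {0..<1}" "b \<in> {0..<1}"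
    for a b c :: real
  proof -
    have "frac (frac (a + c) - c) = a"
      using eq(2) by (auto simp: frac_unique_iff frac_def floor_eq_iff)
    moreover have "frac (frac (b + c) - c) = b"
      using eq(3) by (auto simp: frac_unique_iff frac_def floor_eq_iff)
    ultimately show "a = b" using eq(1) by metis
  qed
  have shift: "frac (a - c + c) = a \<and> frac (frac (a - c) + c) = a"
    if "a \<in> {0..<1}" for a c :: real
    using that by (auto simp: frac_unique_iff frac_def floor_eq_iff)
  have mem: "y l \<in> {0..<1}" if "y \<in> torus r" "l \<in> {1..r}" for y l
    using that by (auto simp: torus_def PiE_def Pi_def)
  have into: "skew_shift \<omega> r x \<in> torus r" for x
    by (auto simp: skew_shift_def torus_def frac_lt_1)
  have inj: "inj_on (skew_shift \<omega> r) (torus r)"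
  proof (rule inj_onI)
    fix x y assume x: "x \<in> torus r" and y: "y \<in> torus r"
      and eq: "skew_shift \<omega> r x = skew_shift \<omega> r y"
    have "l \<in> {1..r} \<Longrightarrow> x l = y l" for l
    proof (induction l)
      case (Suc l)
      note m = mem[OF x Suc.prems] mem[OF y Suc.prems]
      have *: "skew_shift \<omega> r x (Suc l) = skew_shift \<omega> r y (Suc l)" using eq by simp
      show ?case
      proof (cases "l = 0")
        case True
        with * Suc.prems show ?thesis using cancel[OF _ m, of \<omega>] by (simp add: skew_shift_def)
      next
        case False
        with Suc have "x l = y l" by simp
        with False * Suc.prems show ?thesis
          using cancel[OF _ m, of "x l"] by (simp add: skew_shift_def)
      qed
    qed simp
    with x y show "x = y" unfolding torus_def by (rule PiE_ext)
  qed
  have "y \<in> skew_shift \<omega> r ` torus r" if y: "y \<in> torus r" for y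
  proof -
    define g where "g = rec_nat \<omega> (\<lambda>l v. frac (y (Suc l) - v))"
    have g0: "g 0 = \<omega>" and gS: "\<And>l. g (Suc l) = frac (y (Suc l) - g l)"
      by (simp_all add: g_def)
    define x where "x = restrict g {1..r}"
    have "g l \<in> {0..<1}" if "l \<in> {1..r}" for l
      using that gS[of "l - 1"] by (simp add: frac_lt_1)
    then have xt: "x \<in> torus r" by (auto simp: x_def torus_def)
    have val: "skew_shift \<omega> r x l = y l" if l: "l \<in> {1..r}" for l
    proof -
      obtain m where m: "l = Suc m" using l by (cases l) auto
      have "frac (g l + g m) = y l" using shift[OF mem[OF y l], of "g m"] gS[of m] m by simp
      with l m g0 show ?thesis by (cases "m = 0") (auto simp: skew_shift_def x_def)
    qed
    have "skew_shift \<omega> r x = y"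
      using into[of x] y val unfolding torus_def by (rule PiE_ext)
    with xt show ?thesis by blast
  qed
  then show ?thesis using inj into by (auto simp: bij_betw_def)
qed

section \<open>CMV matrices\<close>

text \<open>
  Operators on $\ell^2(\mathbb{Z})$ are given by their matrix entries
  $A_{ij} = \langle\delta_i, A\delta_j\rangle$.
\<close>

definition cmv_rho :: "(int \<Rightarrow> complex) \<Rightarrow> int \<Rightarrow> real" where
  "cmv_rho \<alpha> n = sqrt (1 - (cmod (\<alpha> n))\<^sup>2)"

definition cmv_Theta :: "(int \<Rightarrow> complex) \<Rightarrow> int \<Rightarrow> int \<Rightarrow> int \<Rightarrow> complex" where
  "cmv_Theta \<alpha> n i j =
     (if i = n \<and> j = n then cnj (\<alpha> n)
      else if i = n \<and> j = n + 1 \<or> i = n + 1 \<and> j = n then of_real (cmv_rho \<alpha> n)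
      else if i = n + 1 \<and> j = n + 1 then - \<alpha> n
      else 0)"

text \<open>
  In the direct sums, row \<open>i\<close> belongs to the unique block \<open>{n, n + 1}\<close> containing \<open>i\<close> with
  \<open>n\<close> of the given parity: \<open>n = i\<close> or \<open>n = i - 1\<close>.
\<close>

definition cmv_L :: "(int \<Rightarrow> complex) \<Rightarrow> int \<Rightarrow> int \<Rightarrow> complex" where
  "cmv_L \<alpha> i j = cmv_Theta \<alpha> (if even i then i else i - 1) i j"

definition cmv_M :: "(int \<Rightarrow> complex) \<Rightarrow> int \<Rightarrow> int \<Rightarrow> complex" where
  "cmv_M \<alpha> i j = cmv_Theta \<alpha> (if odd i then i else i - 1) i j"

text \<open>
  Restriction to $\ell^2([a,b])$: the site \<open>k \<in> {a..b}\<close> has matrix index \<open>nat (k - a)\<close>.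
\<close>

definition restrict_op :: "(int \<Rightarrow> int \<Rightarrow> complex) \<Rightarrow> int \<Rightarrow> int \<Rightarrow> complex mat" where
  "restrict_op A a b =
     Matrix.mat (nat (b - a + 1)) (nat (b - a + 1)) (\<lambda>(i, j). A (a + int i) (a + int j))"

definition cmv_L_box ::
  "(int \<Rightarrow> complex) \<Rightarrow> complex \<Rightarrow> complex \<Rightarrow> int \<Rightarrow> int \<Rightarrow> complex mat" where
  "cmv_L_box \<alpha> \<beta> \<beta>' a b = restrict_op (cmv_L (\<alpha>(a - 1 := \<beta>, b := \<beta>'))) a b"

definition cmv_M_box ::
  "(int \<Rightarrow> complex) \<Rightarrow> complex \<Rightarrow> complex \<Rightarrow> int \<Rightarrow> int \<Rightarrow> complex mat" where
  "cmv_M_box \<alpha> \<beta> \<beta>' a b = restrict_op (cmv_M (\<alpha>(a - 1 := \<beta>, b := \<beta>'))) a b"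

definition cmv_E_box ::
  "(int \<Rightarrow> complex) \<Rightarrow> complex \<Rightarrow> complex \<Rightarrow> int \<Rightarrow> int \<Rightarrow> complex mat" where
  "cmv_E_box \<alpha> \<beta> \<beta>' a b = cmv_L_box \<alpha> \<beta> \<beta>' a b * cmv_M_box \<alpha> \<beta> \<beta>' a b"

section \<open>Green's function and suitability\<close>

text \<open>
  The inverse of an invertible matrix.  In \<open>suitable\<close> below it is only used when it exists:
  there \<open>E - z\<close> is required to be invertible, and \<open>z L\<^sup>* - M = - L\<^sup>* (E - z)\<close> with \<open>L\<close> unitary.
\<close>

definition mat_inv :: "complex mat \<Rightarrow> complex mat" where
  "mat_inv A = the (mat_inverse A)"

definition l2_norm_vec :: "complex vec \<Rightarrow> real" where
  "l2_norm_vec v = L2_set (\<lambda>i. cmod (vec_index v i)) {..<dim_vec v}"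

definition l2_op_norm :: "complex mat \<Rightarrow> real" where
  "l2_op_norm A =
     (SUP v\<in>{v \<in> carrier_vec (dim_col A). l2_norm_vec v \<le> 1}. l2_norm_vec (A *\<^sub>v v))"

definition green ::
  "(int \<Rightarrow> complex) \<Rightarrow> complex \<Rightarrow> complex \<Rightarrow> int \<Rightarrow> int \<Rightarrow> complex \<Rightarrow> int \<Rightarrow> int \<Rightarrow> complex" where
  "green \<alpha> \<beta> \<beta>' a b z k l =
     mat_inv (z \<cdot>\<^sub>m mat_adjoint (cmv_L_box \<alpha> \<beta> \<beta>' a b) - cmv_M_box \<alpha> \<beta> \<beta>' a b)
       $$ (nat (k - a), nat (l - a))"

definition cmv_E_box_minus ::
  "(int \<Rightarrow> complex) \<Rightarrow> complex \<Rightarrow> complex \<Rightarrow> int \<Rightarrow> int \<Rightarrow> complex \<Rightarrow> complex mat" where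
  "cmv_E_box_minus \<alpha> \<beta> \<beta>' a b z =
     cmv_E_box \<alpha> \<beta> \<beta>' a b - z \<cdot>\<^sub>m 1\<^sub>m (nat (b - a + 1))"

definition suitable ::
  "real \<Rightarrow> real \<Rightarrow> real \<Rightarrow> (int \<Rightarrow> complex) \<Rightarrow> complex \<Rightarrow> complex \<Rightarrow> complex \<Rightarrow> nat \<Rightarrow> bool" where
  "suitable \<gamma> \<Gamma> p \<alpha> \<beta> \<beta>' z N \<longleftrightarrow>
     invertible_mat (cmv_E_box_minus \<alpha> \<beta> \<beta>' (- int N) (int N) z) \<and>
     l2_op_norm (mat_inv (cmv_E_box_minus \<alpha> \<beta> \<beta>' (- int N) (int N) z))
       \<le> 2 powr (- p) * exp \<Gamma> \<and>
     (\<forall>k\<in>{- int N..int N}. \<forall>l\<in>{- int N..int N}.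
        real_of_int \<bar>k - l\<bar> \<ge> real N / 2 \<longrightarrow>
        cmod (green \<alpha> \<beta> \<beta>' (- int N) (int N) z k l)
          \<le> 2 powr (- (p + 1)) * exp (- \<gamma> * real_of_int \<bar>k - l\<bar>))"

definition skew_alpha ::
  "complex \<Rightarrow> real \<Rightarrow> nat \<Rightarrow> (nat \<Rightarrow> real) \<Rightarrow> int \<Rightarrow> complex" where
  "skew_alpha lam \<omega> r x n = lam * exp (2 * of_real pi * \<i> * of_real (skew_iter \<omega> r n x r))"

end

theory Submission
  imports Defs "HOL-Complex_Analysis.Complex_Analysis" "HOL-Probability.Probability"
    "HOL-Real_Asymp.Real_Asymp"
begin

text \<open>
  Write $e(t) = e^{2\pi i t}$ (\<open>ee\<close> below) and $\rho = \sqrt{1 - |\lambda|^2}$.  Everything is read off from the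
  Szego transfer matrices: along a box the equation $z L^* u = M u$ is solved by products of the
  matrices with rows $(z, -\overline{\alpha_n})$ and $(-\alpha_n z, 1)$.  Let \<open>q0\<close> and \<open>q1\<close> be the
  entries in the second row of such a product.  Since $z L^* - M$ is tridiagonal, its inverse is an
  explicit quotient (\<open>resolvent_bounds\<close>): the numerator is at most a constant times the \<open>q0\<close>'s of the
  two outer sub-boxes times $\rho^{|k-l|}$, the denominator is a boundary form \<open>D\<close> in the entries of
  the whole product.  Both parts of suitability follow once all these unnormalised quantities are
  subexponential: $|q0| \le e^{N^{\tau'}}$ for all $x$ and all sub-boxes, and
  $|D| \ge e^{-N^{\tau'}}$ for most $x$.  The exponential decay of Green's function is the factor
  $\rho^{|k-l|}$.

  Why \<open>q0\<close> is subexponential.  As a function of $z$ it is a polynomial $\prod_i (1 - u_i z)$ without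
  zeros in the open disc, so $|u_i| \le 1$.  Its logarithmic derivative is a sum over the sites $n$ of
  the logarithmic derivatives of $1 - \alpha_n z b_n(z)$, where $b_n$ are Schur functions; hence the
  power sum $\sum_i u_i^j$ is, up to sign, the sum over $n$ of a bounded Taylor coefficient that depends on
  $\alpha_{n-j}, \dots, \alpha_n$ only, that is, on $T^{n-j} x$.  This coefficient is a trigonometric
  polynomial in $x$ of degree polynomial in $j$.  Replacing $\alpha_n$ by $w W^n \alpha_n$ multiplies
  the coefficient by $W^j$, so each of its frequencies has last entry $0$ and last but one entry
  exactly $j \ne 0$.  Summing over $n$ therefore yields Weyl sums whose leading coefficient is
  a multiple of $j \omega$, and the Diophantine condition gives $|\sum_i u_i^j| \le K j^A N^{1-c}$ for all $j \ge 1$,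
  uniformly in $x$ (\<open>log_increment_sum_bound\<close>).  Such a bound spreads the $u_i$ evenly at scale
  $N^{-c'}$: it yields the upper bound for \<open>q0\<close> on the whole unit circle, and the
  lower bound at all $z$ with $|1 - u_i z| \ge e^{-N^s}$ for all $i$ (\<open>szego_uniform_bounds\<close>).

  Why the exceptional set is small.  Moving $x_{r-1}$ by $t$ replaces $z$ by $z e(t)$ in \<open>q0\<close>, so for
  fixed other coordinates the exceptional $t$ lie in $2N$ arcs of length about $e^{-N^s}$.  Moving $x_r$ by
  $t$ multiplies all $\alpha_n$ by $w = e(t)$; it leaves \<open>q0\<close> fixed and turns $w D$ into a quadratic
  polynomial in $w$ with leading coefficient of modulus $|q1|$.  As $|q0|^2 - |q1|^2 = \rho^{4N}$ is negligible,
  $|D|$ is small compared with $|q0|$ only for $t$ in two more short arcs.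
\<close>

section \<open>Weyl sums\<close>

definition ee :: "real \<Rightarrow> complex" where "ee t = cis (2 * pi * t)"

lemma ee_add: "ee (s + t) = ee s * ee t"
  by (simp add: ee_def cis_mult distrib_left)

lemma ee_diff: "ee (s - t) = ee s * cnj (ee t)"
  by (simp add: ee_def cis_mult cis_cnj right_diff_distrib)

lemma cmod_ee [simp]: "cmod (ee t) = 1"
  by (simp add: ee_def)

lemma ee_0 [simp]: "ee 0 = 1"
  by (simp add: ee_def)

lemma cnj_ee: "cnj (ee t) = ee (- t)"
  by (simp add: ee_def cis_cnj)

lemma ee_Ints: "t \<in> \<int> \<Longrightarrow> ee t = 1"
  by (auto simp: ee_def elim!: Ints_cases intro: cis_multiple_2pi)

lemma ee_cong: "s - t \<in> \<int> \<Longrightarrow> ee s = ee t"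
  using ee_add[of "s - t" t] by (simp add: ee_Ints)

lemma ee_of_nat_mult: "ee (of_nat n * t) = ee t ^ n"
  by (simp add: ee_def Complex.DeMoivre mult_ac)

text \<open>
  Jordan's inequality: the sine is concave on $[0, \pi/2]$ and so lies above its chord.
\<close>

lemma sin_ge_chord:
  assumes "0 \<le> x" "x \<le> pi / 2"
  shows "2 / pi * x \<le> sin x"
proof -
  have "concave_on {0..pi/2} (sin :: real \<Rightarrow> real)"
    unfolding concave_on_def
  proof (rule f''_ge0_imp_convex)
    show "((\<lambda>x. - sin x) has_real_derivative - cos x) (at x)" for x :: real
      by (auto intro!: derivative_eq_intros)
    show "((\<lambda>x. - cos x) has_real_derivative sin x) (at x)" for x :: real
      by (auto intro!: derivative_eq_intros)
    show "sin x \<ge> 0" if "x \<in> {0..pi/2}" for x :: real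
      using that by (intro sin_ge_zero) auto
  qed auto
  then have "convex_on {0..pi/2} (\<lambda>x. - sin x :: real)"
    by (simp add: concave_on_def)
  from convex_onD[OF this, of "2 / pi * x" 0 "pi / 2"] assms
  show ?thesis by (simp add: field_simps)
qed

text \<open>
  Converts the Diophantine condition on $\|q\omega\|$ into a lower bound for the denominator
  of a geometric sum.
\<close>

lemma one_minus_ee_ge: "4 * infdist t \<int> \<le> cmod (1 - ee t)"
proof -
  define s where "s = t - of_int (round t)"
  have s: "\<bar>s\<bar> \<le> 1/2"
    using of_int_round_abs_le[of t] by (simp add: s_def abs_minus_commute)
  have "infdist t \<int> \<le> dist t (of_int (round t))"
    by (rule infdist_le) auto
  then have d: "infdist t \<int> \<le> \<bar>s\<bar>" by (simp add: s_def dist_real_def)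
  have "ee t = ee s" by (rule ee_cong) (simp add: s_def)
  moreover have "cmod (1 - ee s) = 2 * \<bar>sin (pi * s)\<bar>"
  proof -
    have "(cmod (1 - ee s))\<^sup>2 = (1 - cos (2 * (pi * s)))\<^sup>2 + (sin (2 * (pi * s)))\<^sup>2"
      by (simp add: cmod_power2 ee_def mult.assoc)
    also have "\<dots> = 2 - 2 * cos (2 * (pi * s))"
      using sin_cos_squared_add[of "2 * (pi * s)"] by (simp add: power2_eq_square algebra_simps)
    also have "\<dots> = (2 * \<bar>sin (pi * s)\<bar>)\<^sup>2"
      by (subst cos_double_sin) (simp add: power_mult_distrib)
    finally show ?thesis by (metis abs_ge_zero norm_ge_zero power2_eq_iff_nonneg zero_le_mult_iff zero_le_numeral)
  qed
  moreover have "2 * \<bar>s\<bar> \<le> \<bar>sin (pi * s)\<bar>"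
  proof -
    have "2 / pi * (pi * \<bar>s\<bar>) \<le> sin (pi * \<bar>s\<bar>)"
      using s by (intro sin_ge_chord) (auto simp: field_simps)
    then have "2 * \<bar>s\<bar> \<le> sin (pi * \<bar>s\<bar>)" by simp
    also have "\<dots> \<le> \<bar>sin (pi * s)\<bar>" by (cases "s \<ge> 0") auto
    finally show ?thesis .
  qed
  ultimately show ?thesis using d by simp
qed

text \<open>
  The sequences $e(P(n))$ with a real polynomial $P$ of degree at most \<open>d + 1\<close> whose $(d+1)$-st
  difference is \<open>q * \<omega>\<close>, up to a unimodular factor.  The definition by differencing is the form in which they
  occur in the inequality of van der Corput, and no polynomial has to be exhibited.
\<close>

primrec weyl_seq :: "real \<Rightarrow> nat \<Rightarrow> int \<Rightarrow> (nat \<Rightarrow> complex) \<Rightarrow> bool" where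
  "weyl_seq \<omega> 0 q u \<longleftrightarrow> (\<exists>c. cmod c = 1 \<and> (\<forall>n. u n = c * ee (of_int q * \<omega>) ^ n))"
| "weyl_seq \<omega> (Suc d) q u \<longleftrightarrow>
     (\<forall>n. cmod (u n) = 1) \<and> (\<forall>h. weyl_seq \<omega> d (q * int h) (\<lambda>n. u (n + h) * cnj (u n)))"

lemma weyl_seq_norm: "weyl_seq \<omega> d q u \<Longrightarrow> cmod (u n) = 1"
  by (cases d) (auto simp: norm_mult norm_power)

lemma weyl_seq_shift: "weyl_seq \<omega> d q u \<Longrightarrow> weyl_seq \<omega> d q (\<lambda>n. u (n + k))"
proof (induction d arbitrary: q u)
  case 0
  then obtain c where "cmod c = 1" "\<And>n. u n = c * ee (of_int q * \<omega>) ^ n" by auto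
  then show ?case
    by (auto intro!: exI[of _ "c * ee (of_int q * \<omega>) ^ k"]
        simp: norm_mult norm_power power_add)
next
  case (Suc d)
  have "weyl_seq \<omega> d (q * int h) (\<lambda>n. u (n + h) * cnj (u n))" for h
    using Suc.prems by simp
  from Suc.IH[OF this] have "weyl_seq \<omega> d (q * int h) (\<lambda>n. u (n + k + h) * cnj (u (n + k)))" for h .
  then show ?case using Suc.prems by (simp add: add_ac)
qed

text \<open>
  The sum is replaced by its average over the \<open>H\<close> shifts, at a cost of \<open>2 * H\<close>.
  Cauchy-Schwarz and expanding the square leave \<open>H\<close> diagonal terms and correlations
  at lags below \<open>H\<close>.
\<close>

lemma van_der_corput:
  fixes f :: "nat \<Rightarrow> complex"
  assumes f: "\<And>n. cmod (f n) \<le> 1" and H: "H \<ge> 1"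
    and T: "\<And>k m. 1 \<le> k \<Longrightarrow> k < H \<Longrightarrow> cmod (\<Sum>n<M. f (n + m + k) * cnj (f (n + m))) \<le> T"
    and T0: "T \<ge> 0"
  shows "cmod (\<Sum>n<M. f n) \<le> 2 * real H + sqrt ((real M)\<^sup>2 / real H + real M * T)"
proof -
  define S where "S = (\<Sum>n<M. f n)"
  define g where "g m = (\<Sum>h<H. f (m + h))" for m
  have shift1: "cmod (S - (\<Sum>m<M. f (m + h))) \<le> 2 * real h" for h
  proof (induction h)
    case 0
    then show ?case by (simp add: S_def)
  next
    case (Suc h)
    have "(\<Sum>m<M. f (m + h)) - (\<Sum>m<M. f (m + Suc h)) = f h - f (M + h)"
      by (induction M) (auto simp: algebra_simps)
    then have "cmod ((\<Sum>m<M. f (m + h)) - (\<Sum>m<M. f (m + Suc h))) \<le> 2"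
      using norm_triangle_ineq4[of "f h" "f (M + h)"] f[of h] f[of "M + h"] by simp
    with Suc show ?case
      using norm_triangle_ineq[of "S - (\<Sum>m<M. f (m + h))"
          "(\<Sum>m<M. f (m + h)) - (\<Sum>m<M. f (m + Suc h))"] by (simp del: add_Suc_right)
  qed
  have "cmod (of_nat H * S - (\<Sum>m<M. g m)) = cmod (\<Sum>h<H. S - (\<Sum>m<M. f (m + h)))"
    unfolding g_def by (subst sum.swap) (simp add: sum_subtractf)
  also have "\<dots> \<le> (\<Sum>h<H. 2 * real H)"
    by (rule sum_norm_le) (rule order_trans[OF shift1], simp)
  finally have a: "cmod (of_nat H * S - (\<Sum>m<M. g m)) \<le> 2 * real H * real H" by simp
  have "(cmod (\<Sum>m<M. g m))\<^sup>2 \<le> (\<Sum>m<M. cmod (g m))\<^sup>2"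
    by (intro power_mono norm_sum) auto
  also have "\<dots> \<le> real M * (\<Sum>m<M. (cmod (g m))\<^sup>2)"
    using Cauchy_Schwarz_ineq_sum[of "\<lambda>_. 1" "\<lambda>m. cmod (g m)" "{..<M}"] by simp
  also have "(\<Sum>m<M. (cmod (g m))\<^sup>2) \<le> real H * real M + real H * real H * T"
  proof -
    have "complex_of_real (\<Sum>m<M. (cmod (g m))\<^sup>2) = (\<Sum>m<M. g m * cnj (g m))"
      by (simp only: complex_norm_square of_real_sum)
    also have "\<dots> = (\<Sum>m<M. \<Sum>h<H. \<Sum>h'<H. f (m + h) * cnj (f (m + h')))"
      by (simp add: g_def sum_product)
    also have "\<dots> = (\<Sum>h<H. \<Sum>h'<H. \<Sum>m<M. f (m + h) * cnj (f (m + h')))"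
      by (rule trans[OF sum.swap]) (intro sum.cong refl sum.swap)
    finally have eq: "complex_of_real (\<Sum>m<M. (cmod (g m))\<^sup>2)
      = (\<Sum>h<H. \<Sum>h'<H. \<Sum>m<M. f (m + h) * cnj (f (m + h')))" .
    have bd: "cmod (\<Sum>m<M. f (m + h) * cnj (f (m + h'))) \<le> (if h = h' then real M else 0) + T"
      if "h < H" "h' < H" for h h'
    proof (cases "h = h'")
      case True
      have "cmod (\<Sum>m<M. f (m + h) * cnj (f (m + h'))) \<le> (\<Sum>m<M. 1)"
        by (rule sum_norm_le) (use f in \<open>auto simp: norm_mult intro!: mult_le_one\<close>)
      then show ?thesis using True T0 by simp
    next
      case False
      show ?thesis
      proof (cases "h > h'")
        case True
        then show ?thesis using T[of "h - h'" h'] that by (simp add: add_ac)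
      next
        case False
        then have *: "h' > h" using \<open>h \<noteq> h'\<close> by simp
        have "cmod (\<Sum>m<M. f (m + h) * cnj (f (m + h')))
          = cmod (cnj (\<Sum>m<M. f (m + h) * cnj (f (m + h'))))" by (simp only: complex_mod_cnj)
        also have "cnj (\<Sum>m<M. f (m + h) * cnj (f (m + h'))) = (\<Sum>m<M. f (m + h') * cnj (f (m + h)))"
          by (simp add: mult.commute)
        finally show ?thesis using T[of "h' - h" h] that * by (simp add: add_ac)
      qed
    qed
    have "(\<Sum>m<M. (cmod (g m))\<^sup>2) = cmod (complex_of_real (\<Sum>m<M. (cmod (g m))\<^sup>2))"
      by (simp only: norm_of_real) (simp add: sum_nonneg)
    also have "\<dots> \<le> (\<Sum>h<H. \<Sum>h'<H. (if h = h' then real M else 0) + T)"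
      unfolding eq by (intro sum_norm_le bd) auto
    also have "\<dots> = real H * real M + real H * real H * T"
      by (simp add: sum.distrib algebra_simps)
    finally show ?thesis .
  qed
  finally have b: "(cmod (\<Sum>m<M. g m))\<^sup>2 \<le> real M * (real H * real M + real H * real H * T)"
    by (simp add: mult_left_mono)
  have "real H * cmod S = cmod (of_nat H * S)" by (simp add: norm_mult)
  also have "\<dots> \<le> 2 * real H * real H + cmod (\<Sum>m<M. g m)"
    using norm_triangle_sub[of "of_nat H * S" "\<Sum>m<M. g m"] a by linarith
  also have "cmod (\<Sum>m<M. g m) \<le> sqrt (real M * (real H * real M + real H * real H * T))"
    using b by (rule real_le_rsqrt)
  also have "real M * (real H * real M + real H * real H * T)
     = (real H)\<^sup>2 * ((real M)\<^sup>2 / real H + real M * T)"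
    using H by (simp add: field_simps power2_eq_square)
  also have "sqrt \<dots> = real H * sqrt ((real M)\<^sup>2 / real H + real M * T)"
    by (simp add: real_sqrt_mult)
  finally have "real H * cmod S \<le> real H * (2 * real H + sqrt ((real M)\<^sup>2 / real H + real M * T))"
    by (simp add: algebra_simps)
  then show ?thesis using H by (simp add: S_def)
qed

lemma weyl_sum_bound_linear:
  assumes kap: "\<kappa> > 0" and dioph: "\<And>q::int. q \<ge> 1 \<Longrightarrow> \<kappa> \<le> (real_of_int q)\<^sup>2 * infdist (real_of_int q * \<omega>) \<int>"
    and q: "q \<noteq> 0" and u: "weyl_seq \<omega> 0 q u"
  shows "cmod (\<Sum>n<M. u n) \<le> (real_of_int \<bar>q\<bar>)\<^sup>2 / (2 * \<kappa>)"
proof -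
  obtain c where c: "cmod c = 1" "\<And>n. u n = c * ee (of_int q * \<omega>) ^ n" using u by auto
  define w where "w = ee (of_int q * \<omega>)"
  have "cmod (1 - w) = cmod (1 - ee (of_int \<bar>q\<bar> * \<omega>))"
  proof (cases "q \<ge> 0")
    case False
    then have "ee (of_int \<bar>q\<bar> * \<omega>) = cnj w" by (simp add: w_def cnj_ee)
    then show ?thesis
      by (metis complex_cnj_diff complex_cnj_one complex_mod_cnj)
  qed (simp add: w_def)
  then have "4 * infdist (of_int \<bar>q\<bar> * \<omega>) \<int> \<le> cmod (1 - w)"
    using one_minus_ee_ge by simp
  moreover have "\<kappa> \<le> (real_of_int \<bar>q\<bar>)\<^sup>2 * infdist (real_of_int \<bar>q\<bar> * \<omega>) \<int>"
    using q by (intro dioph) auto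
  ultimately have "4 * \<kappa> \<le> (real_of_int \<bar>q\<bar>)\<^sup>2 * cmod (1 - w)"
    using mult_left_mono[of "4 * infdist (of_int \<bar>q\<bar> * \<omega>) \<int>" "cmod (1 - w)" "(real_of_int \<bar>q\<bar>)\<^sup>2"]
    by (simp add: algebra_simps)
  then have lb: "4 * \<kappa> / (real_of_int \<bar>q\<bar>)\<^sup>2 \<le> cmod (1 - w)"
    using q by (simp add: field_simps)
  then have w1: "w \<noteq> 1" using kap q by (auto simp: divide_le_0_iff)
  have "(\<Sum>n<M. u n) = c * ((1 - w ^ M) / (1 - w))"
    using w1 by (simp add: c w_def[symmetric] sum_distrib_left[symmetric] sum_gp_strict)
  also have "cmod \<dots> \<le> 2 / cmod (1 - w)"
    using norm_triangle_ineq4[of 1 "w ^ M"]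
    by (simp add: norm_mult norm_divide c w_def norm_power divide_right_mono)
  also have "\<dots> \<le> 2 / (4 * \<kappa> / (real_of_int \<bar>q\<bar>)\<^sup>2)"
    using kap q w1 by (intro divide_left_mono lb mult_pos_pos divide_pos_pos) auto
  finally show ?thesis by (simp add: field_simps)
qed

text \<open>
  By induction on the degree: the correlations in van der Corput's inequality belong to
  \<open>weyl_seq \<omega> d (q * k)\<close> with \<open>k < H\<close>.  The dependence on \<open>q\<close> must stay polynomial for the
  induction to close, and \<open>H\<close> is a power of \<open>N\<close> so small that it does not destroy the saving.
\<close>

lemma weyl_sum_bound:
  fixes \<omega> \<kappa> :: real
  assumes kap: "\<kappa> > 0" and dioph: "\<And>q::int. q \<ge> 1 \<Longrightarrow> \<kappa> \<le> (real_of_int q)\<^sup>2 * infdist (real_of_int q * \<omega>) \<int>"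
  shows "\<exists>C\<ge>0. \<exists>A::nat. \<exists>c. 0 < c \<and> c \<le> 1/2 \<and>
    (\<forall>q u M N. q \<noteq> 0 \<longrightarrow> weyl_seq \<omega> d q u \<longrightarrow> M \<le> N \<longrightarrow> 1 \<le> N \<longrightarrow>
       cmod (\<Sum>n<M. u n) \<le> C * (real_of_int \<bar>q\<bar>) ^ A * real N powr (1 - c))"
proof (induction d)
  case 0
  have "cmod (\<Sum>n<M. u n) \<le> 1 / (2 * \<kappa>) * (real_of_int \<bar>q\<bar>) ^ 2 * real N powr (1 - 1/2)"
    if "q \<noteq> 0" "weyl_seq \<omega> 0 q u" "1 \<le> N" for q u M N
  proof -
    have "cmod (\<Sum>n<M. u n) \<le> (real_of_int \<bar>q\<bar>)\<^sup>2 / (2 * \<kappa>) * 1"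
      using weyl_sum_bound_linear[OF kap dioph that(1,2), of M] by simp
    also have "\<dots> \<le> (real_of_int \<bar>q\<bar>)\<^sup>2 / (2 * \<kappa>) * real N powr (1 - 1/2)"
      using that kap by (intro mult_left_mono ge_one_powr_ge_zero) auto
    finally show ?thesis by simp
  qed
  then show ?case using kap
    by - (rule exI[of _ "1 / (2 * \<kappa>)"], rule conjI, simp, rule exI[of _ "2::nat"], rule exI[of _ "1/2::real"], force)
next
  case (Suc d)
  then obtain C A c where C: "C \<ge> 0" "0 < c" "c \<le> 1/2"
    and IH: "\<And>q u M N. q \<noteq> 0 \<Longrightarrow> weyl_seq \<omega> d q u \<Longrightarrow> M \<le> N \<Longrightarrow> 1 \<le> N \<Longrightarrow>
       cmod (\<Sum>n<M. u n) \<le> C * (real_of_int \<bar>q\<bar>) ^ A * real N powr (1 - c)"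
    by blast
  \<comment> \<open>With $H \approx N^s$ the loss $H^A$ in the bound for the correlations is at most $N^{c/2}$.\<close>
  define s where "s = c / (2 * (real A + 1))"
  have s0: "0 < s" and sA: "s * real A \<le> c / 2" and s4: "s \<le> c / 2"
    using C by (auto simp: s_def field_simps)
  define C' where "C' = 5 + sqrt (C * 2 ^ A)"
  have "cmod (\<Sum>n<M. u n) \<le> C' * (real_of_int \<bar>q\<bar>) ^ A * real N powr (1 - s / 2)"
    if q: "q \<noteq> 0" and u: "weyl_seq \<omega> (Suc d) q u" and M: "M \<le> N" "1 \<le> N" for q u M N
  proof -
    define H where "H = nat \<lceil>real N powr s\<rceil>"
    have Ns1: "1 \<le> real N powr s" using M s0 by (intro ge_one_powr_ge_zero) auto
    have H1: "real N powr s \<le> real H" and H2: "real H \<le> 2 * real N powr s" and H0: "H \<ge> 1"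
      using Ns1 unfolding H_def by linarith+
    define Q where "Q = real_of_int \<bar>q\<bar>"
    have Q1: "Q \<ge> 1" using q by (simp add: Q_def)
    define T where "T = C * (Q * real H) ^ A * real N powr (1 - c)"
    have T0: "T \<ge> 0" using C Q1 by (auto simp: T_def)
    have vdc: "cmod (\<Sum>n<M. u n) \<le> 2 * real H + sqrt ((real M)\<^sup>2 / real H + real M * T)"
    proof (rule van_der_corput[OF _ H0 _ T0])
      show "cmod (u n) \<le> 1" for n using weyl_seq_norm[OF u] by simp
      fix k m :: nat assume k: "1 \<le> k" "k < H"
      have "weyl_seq \<omega> d (q * int k) (\<lambda>n. u (n + k) * cnj (u n))" using u by simp
      from weyl_seq_shift[OF this, of m]
      have "cmod (\<Sum>n<M. u (n + m + k) * cnj (u (n + m)))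
        \<le> C * (real_of_int \<bar>q * int k\<bar>) ^ A * real N powr (1 - c)"
        using k q M by (intro IH) auto
      also have "\<dots> \<le> T" unfolding T_def using C k
        by (intro mult_right_mono mult_left_mono power_mono) (auto simp: Q_def abs_mult intro!: mult_left_mono)
      finally show "cmod (\<Sum>n<M. u (n + m + k) * cnj (u (n + m))) \<le> T" .
    qed
    have NN: "real N powr x * real N powr y = real N powr (x + y)" for x y
      by (simp add: powr_add)
    have "(real M)\<^sup>2 / real H \<le> (real N)\<^sup>2 / real N powr s"
      using M H1 Ns1 by (intro frac_le) auto
    also have "\<dots> = (real N powr (1 - s / 2))\<^sup>2"
      using M by (simp add: powr_diff field_simps powr_half_sqrt power2_eq_square flip: powr_add)
    finally have t1: "sqrt ((real M)\<^sup>2 / real H) \<le> real N powr (1 - s / 2)"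
      by (intro real_le_lsqrt) auto
    have "real M * T \<le> real N * (C * (Q * (2 * real N powr s)) ^ A * real N powr (1 - c))"
      unfolding T_def using M C Q1 H2 by (intro mult_mono power_mono) auto
    also have "\<dots> = C * 2 ^ A * Q ^ A * (real N powr 1 * real N powr (s * real A) * real N powr (1 - c))"
      using M by (simp add: power_mult_distrib powr_powr flip: powr_realpow)
    also have "\<dots> \<le> C * 2 ^ A * (Q ^ A)\<^sup>2 * (real N powr (1 - s / 2))\<^sup>2"
    proof (intro mult_mono)
      show "Q ^ A \<le> (Q ^ A)\<^sup>2" using Q1 by (simp add: power2_eq_square)
      have "real N powr 1 * real N powr (s * real A) * real N powr (1 - c) = real N powr (2 + s * real A - c)"
        by (simp only: NN) (simp add: algebra_simps)
      also have "\<dots> \<le> real N powr (2 - s)" using M sA s4 by (intro powr_mono) auto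
      also have "\<dots> = (real N powr (1 - s / 2))\<^sup>2" using M by (simp add: power2_eq_square flip: powr_add)
      finally show "real N powr 1 * real N powr (s * real A) * real N powr (1 - c) \<le> (real N powr (1 - s / 2))\<^sup>2" .
    qed (use C Q1 in auto)
    finally have "sqrt (real M * T) \<le> sqrt (C * 2 ^ A * (Q ^ A)\<^sup>2 * (real N powr (1 - s / 2))\<^sup>2)"
      by simp
    also have "\<dots> = sqrt (C * 2 ^ A) * Q ^ A * real N powr (1 - s / 2)"
      using Q1 by (simp add: real_sqrt_mult)
    finally have t2: "sqrt (real M * T) \<le> sqrt (C * 2 ^ A) * Q ^ A * real N powr (1 - s / 2)" .
    have "2 * real H \<le> 4 * real N powr s" using H2 by simp
    also have "\<dots> \<le> 4 * real N powr (1 - s / 2)" using M s4 C by (intro mult_left_mono powr_mono) auto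
    finally have t3: "2 * real H \<le> 4 * real N powr (1 - s / 2)" .
    have "sqrt ((real M)\<^sup>2 / real H + real M * T) \<le> sqrt ((real M)\<^sup>2 / real H) + sqrt (real M * T)"
      using T0 by (intro sqrt_add_le_add_sqrt) auto
    with vdc t1 t2 t3 have "cmod (\<Sum>n<M. u n) \<le> (5 + sqrt (C * 2 ^ A) * Q ^ A) * real N powr (1 - s / 2)"
      by (simp add: algebra_simps)
    also have "\<dots> \<le> (C' * Q ^ A) * real N powr (1 - s / 2)"
      using Q1 one_le_power[OF Q1, of A] unfolding C'_def by (intro mult_right_mono) (auto simp: algebra_simps)
    finally show ?thesis by (simp add: Q_def)
  qed
  then show ?case using C s0 s4
    by - (rule exI[of _ C'], rule conjI, simp add: C'_def, rule exI[of _ A], rule exI[of _ "s/2"], force)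
qed

section \<open>Orbits of the lifted skew-shift\<close>

text \<open>
  An orbit of the skew-shift without reduction modulo one; the constant \<open>\<omega>\<close> plays the role of a
  coordinate with index zero.
\<close>

definition skew_orbit :: "real \<Rightarrow> (int \<Rightarrow> nat \<Rightarrow> real) \<Rightarrow> bool" where
  "skew_orbit \<omega> Y \<longleftrightarrow>
     (\<forall>n. Y n 0 = \<omega>) \<and> (\<forall>n l. Y (n + 1) (Suc l) = Y n (Suc l) + Y n l)"

lemma skew_orbit_binomial:
  assumes "skew_orbit \<omega> Y"
  shows "Y (n + int i) l = (\<Sum>s\<le>l. real (i choose s) * Y n (l - s))"
proof (induction i arbitrary: l)
  case 0
  have "(\<Sum>s\<le>l. real (0 choose s) * Y n (l - s)) = (\<Sum>s\<in>{0}. real (0 choose s) * Y n (l - s))"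
    by (rule sum.mono_neutral_right) (auto simp: binomial_eq_0)
  then show ?case by simp
next
  case (Suc i)
  show ?case
  proof (cases l)
    case 0
    then show ?thesis using assms by (simp add: skew_orbit_def)
  next
    case l: (Suc l')
    have "Y (n + int (Suc i)) l = Y (n + int i) (Suc l') + Y (n + int i) l'"
      using assms l by (simp add: skew_orbit_def add.assoc[symmetric] add.commute[of 1])
    also have "Y (n + int i) (Suc l') = Y n (Suc l') + (\<Sum>s\<le>l'. real (i choose Suc s) * Y n (l' - s))"
      by (subst Suc.IH, subst sum.atMost_Suc_shift) simp
    also have "Y (n + int i) l' = (\<Sum>s\<le>l'. real (i choose s) * Y n (l' - s))"
      by (rule Suc.IH)
    also have "Y n (Suc l') + (\<Sum>s\<le>l'. real (i choose Suc s) * Y n (l' - s))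
        + (\<Sum>s\<le>l'. real (i choose s) * Y n (l' - s))
      = (\<Sum>s\<le>Suc l'. real (Suc i choose s) * Y n (Suc l' - s))"
      by (subst sum.atMost_Suc_shift) (simp add: sum.distrib distrib_right)
    finally show ?thesis by (simp only: l)
  qed
qed

text \<open>
  A character of the torus sampled along an orbit is a Weyl sequence: differencing lowers the top
  coordinate by one and multiplies its frequency by the lag, by the binomial formula for the orbit.
\<close>

lemma skew_orbit_character_weyl:
  assumes Y: "skew_orbit \<omega> Y"
  shows "cmod c = 1 \<Longrightarrow>
    weyl_seq \<omega> d (k (Suc d)) (\<lambda>n. c * ee (\<Sum>l=1..Suc d. of_int (k l) * Y (m + int n) l))"
proof (induction d arbitrary: k c)
  case 0
  have "Y (m + int n) (Suc 0) = Y m (Suc 0) + real n * \<omega>" for n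
    using skew_orbit_binomial[OF Y, of m n 1] Y by (simp add: skew_orbit_def)
  then have "c * ee (of_int (k (Suc 0)) * Y (m + int n) (Suc 0))
    = (c * ee (of_int (k (Suc 0)) * Y m (Suc 0))) * ee (of_int (k (Suc 0)) * \<omega>) ^ n" for n
    by (simp add: distrib_left ee_add mult.left_commute[of _ "real n"] flip: ee_of_nat_mult)
  then show ?case using 0
    by (auto intro!: exI[of _ "c * ee (of_int (k (Suc 0)) * Y m (Suc 0))"] simp: norm_mult)
next
  case (Suc d)
  define u where "u n = c * ee (\<Sum>l=1..Suc (Suc d). of_int (k l) * Y (m + int n) l)" for n
  have w: "weyl_seq \<omega> d (k (Suc (Suc d)) * int h) (\<lambda>n. u (n + h) * cnj (u n))" for h
  proof -
    define k' where "k' i = (\<Sum>l\<in>{i<..Suc (Suc d)}. k l * int (h choose (l - i)))" for i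
    have prod: "u (n + h) * cnj (u n) = ee (of_int (k' 0) * \<omega>) * ee (\<Sum>i=1..Suc d. of_int (k' i) * Y (m + int n) i)" for n
    proof -
      define y where "y = Y (m + int n)"
      have diff: "Y (m + int (n + h)) l - y l = (\<Sum>i<l. real (h choose (l - i)) * y i)" for l
      proof -
        have "Y (m + int (n + h)) l = (\<Sum>s\<le>l. real (h choose s) * y (l - s))"
          using skew_orbit_binomial[OF Y, of "m + int n" h l] by (simp add: y_def add.assoc)
        also have "\<dots> = (\<Sum>i\<le>l. real (h choose (l - i)) * y i)"
          by (rule sum.reindex_bij_witness[of _ "\<lambda>i. l - i" "\<lambda>i. l - i"]) auto
        also have "\<dots> = y l + (\<Sum>i<l. real (h choose (l - i)) * y i)"
          by (simp add: lessThan_Suc_atMost[symmetric])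
        finally show ?thesis by simp
      qed
      have "u (n + h) * cnj (u n) = (c * cnj c) * ee ((\<Sum>l=1..Suc (Suc d). of_int (k l) * Y (m + int (n + h)) l)
          - (\<Sum>l=1..Suc (Suc d). of_int (k l) * y l))"
        unfolding u_def y_def ee_diff complex_cnj_mult by (rule mult.assoc[THEN trans]) (simp only: mult_ac)
      also have "c * cnj c = 1" using Suc.prems complex_norm_square[of c] by simp
      also have "(\<Sum>l=1..Suc (Suc d). of_int (k l) * Y (m + int (n + h)) l)
          - (\<Sum>l=1..Suc (Suc d). of_int (k l) * y l)
        = (\<Sum>l=1..Suc (Suc d). \<Sum>i<l. of_int (k l) * (real (h choose (l - i)) * y i))"
        by (simp only: sum_subtractf[symmetric] right_diff_distrib[symmetric] diff sum_distrib_left)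
      also have "\<dots> = (\<Sum>l=1..Suc (Suc d). \<Sum>i\<in>{i\<in>{0..Suc d}. i < l}. of_int (k l) * (real (h choose (l - i)) * y i))"
        by (intro sum.cong refl) auto
      also have "\<dots> = (\<Sum>i\<in>{0..Suc d}. \<Sum>l\<in>{l\<in>{1..Suc (Suc d)}. i < l}. of_int (k l) * (real (h choose (l - i)) * y i))"
        by (rule sum.swap_restrict) auto
      also have "\<dots> = (\<Sum>i\<in>{0..Suc d}. of_int (k' i) * y i)"
        unfolding k'_def of_int_sum sum_distrib_right
        by (intro sum.cong refl) auto
      also have "\<dots> = of_int (k' 0) * \<omega> + (\<Sum>i=1..Suc d. of_int (k' i) * y i)"
        using Y by (subst sum.atLeast_Suc_atMost) (auto simp: y_def skew_orbit_def)
      finally show ?thesis unfolding ee_add y_def by (simp only: mult_1_left)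
    qed
    have top: "k' (Suc d) = k (Suc (Suc d)) * int h"
    proof -
      have "{Suc d<..Suc (Suc d)} = {Suc (Suc d)}" by auto
      then show ?thesis by (simp add: k'_def)
    qed
    show ?thesis
      unfolding prod top[symmetric] by (rule Suc.IH) simp
  qed
  have n1: "cmod (u n) = 1" for n using Suc.prems unfolding u_def norm_mult cmod_ee by simp
  have "weyl_seq \<omega> (Suc d) (k (Suc (Suc d))) u"
    unfolding weyl_seq.simps by (intro conjI allI w n1)
  then show ?case unfolding u_def[abs_def] .
qed

section \<open>Trigonometric polynomials along an orbit of the skew-shift\<close>

definition character :: "nat \<Rightarrow> (nat \<Rightarrow> int) \<Rightarrow> (nat \<Rightarrow> real) \<Rightarrow> complex" where
  "character r k y = ee (\<Sum>l=1..r. of_int (k l) * y l)"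

text \<open>
  Frequencies whose entries at \<open>r\<close> and \<open>r - 1\<close> are prescribed (they record how a function scales
  under $\alpha_n \mapsto w W^n \alpha_n$) and whose other entries are bounded by \<open>D\<close>.
\<close>

definition freqs :: "nat \<Rightarrow> nat \<Rightarrow> int \<Rightarrow> int \<Rightarrow> (nat \<Rightarrow> int) set" where
  "freqs r D s t = {k. (\<forall>l. l \<notin> {1..r} \<longrightarrow> k l = 0) \<and> k r = s \<and> k (r - 1) = t \<and>
     (\<forall>l\<in>{1..<r - 1}. \<bar>k l\<bar> \<le> int D)}"

definition trig_poly :: "nat \<Rightarrow> nat \<Rightarrow> int \<Rightarrow> int \<Rightarrow> ((nat \<Rightarrow> real) \<Rightarrow> complex) \<Rightarrow> bool" where
  "trig_poly r D s t F \<longleftrightarrow> (\<exists>a. \<forall>y. F y = (\<Sum>k\<in>freqs r D s t. a k * character r k y))"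

lemma freqs_finite_card:
  assumes "r \<ge> 2"
  shows "finite (freqs r D s t)" "card (freqs r D s t) \<le> (2 * D + 1) ^ r"
proof -
  define S where "S = ({1..<r-1} \<rightarrow>\<^sub>E {- int D..int D})"
  have S: "finite S" "card S = (2 * D + 1) ^ (r - 2)"
  proof -
    have "nat (2 * int D + 1) = 2 * D + 1" by simp
    then show "finite S" "card S = (2 * D + 1) ^ (r - 2)"
      by (auto simp: S_def card_PiE finite_PiE numeral_2_eq_2)
  qed
  have inj: "inj_on (\<lambda>k. restrict k {1..<r-1}) (freqs r D s t)"
  proof (rule inj_onI, rule ext)
    fix k k' l
    assume k: "k \<in> freqs r D s t" "k' \<in> freqs r D s t"
      and eq: "restrict k {1..<r-1} = restrict k' {1..<r-1}"
    consider "l \<notin> {1..r}" | "l = r" | "l = r - 1" | "l \<in> {1..<r-1}" by force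
    then show "k l = k' l"
    proof cases
      case 4
      then show ?thesis using fun_cong[OF eq, of l] by simp
    qed (use k in \<open>auto simp: freqs_def\<close>)
  qed
  have sub: "(\<lambda>k. restrict k {1..<r-1}) ` freqs r D s t \<subseteq> S"
  proof safe
    fix k assume "k \<in> freqs r D s t"
    then have "\<bar>k l\<bar> \<le> int D" if "l \<in> {1..<r-1}" for l
      using that by (auto simp: freqs_def)
    then have "k l \<in> {- int D..int D}" if "l \<in> {1..<r-1}" for l
      using that by (force simp: abs_le_iff)
    then show "restrict k {1..<r-1} \<in> S" by (auto simp: S_def)
  qed
  show "finite (freqs r D s t)"
    using finite_subset[OF sub S(1)] inj finite_image_iff by blast
  have "card (freqs r D s t) \<le> card S"
    using card_inj_on_le[OF inj sub S(1)] .
  also have "\<dots> \<le> (2 * D + 1) ^ r" unfolding S by (rule power_increasing) auto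
  finally show "card (freqs r D s t) \<le> (2 * D + 1) ^ r" .
qed

lemma character_add: "character r (\<lambda>l. k l + k' l) y = character r k y * character r k' y"
  by (simp add: character_def sum.distrib distrib_right ee_add)

lemma character_uminus: "character r (\<lambda>l. - k l) y = cnj (character r k y)"
  by (simp add: character_def cnj_ee sum_negf)

lemma trig_poly_character:
  assumes "r \<ge> 2" "k \<in> freqs r D s t"
  shows "trig_poly r D s t (\<lambda>y. c * character r k y)"
  unfolding trig_poly_def
proof (intro exI allI)
  fix y
  show "c * character r k y = (\<Sum>k'\<in>freqs r D s t. (if k' = k then c else 0) * character r k' y)"
    using freqs_finite_card(1)[OF assms(1)] assms(2)
    by (simp add: if_distrib[of "\<lambda>x. x * _"] cong: if_cong)
qed

lemma trig_poly_0: "trig_poly r D s t (\<lambda>y. 0)"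
  by (auto simp: trig_poly_def intro!: exI[of _ "\<lambda>_. 0"])

lemma trig_poly_add:
  assumes "trig_poly r D s t F" "trig_poly r D s t G"
  shows "trig_poly r D s t (\<lambda>y. F y + G y)"
proof -
  obtain a b where "\<And>y. F y = (\<Sum>k\<in>freqs r D s t. a k * character r k y)"
    "\<And>y. G y = (\<Sum>k\<in>freqs r D s t. b k * character r k y)" using assms by (auto simp: trig_poly_def)
  then show ?thesis unfolding trig_poly_def
    by (intro exI[of _ "\<lambda>k. a k + b k"]) (simp add: sum.distrib distrib_right)
qed

lemma trig_poly_sum: "(\<And>i. i \<in> I \<Longrightarrow> trig_poly r D s t (F i)) \<Longrightarrow> trig_poly r D s t (\<lambda>y. \<Sum>i\<in>I. F i y)"
  by (induction I rule: infinite_finite_induct) (auto intro: trig_poly_add trig_poly_0)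

lemma trig_poly_cmult:
  assumes "trig_poly r D s t F"
  shows "trig_poly r D s t (\<lambda>y. c * F y)"
proof -
  obtain a where "\<And>y. F y = (\<Sum>k\<in>freqs r D s t. a k * character r k y)"
    using assms by (auto simp: trig_poly_def)
  then show ?thesis unfolding trig_poly_def
    by (intro exI[of _ "\<lambda>k. c * a k"]) (simp add: sum_distrib_left mult.assoc)
qed

lemma freqs_mono: "D \<le> D' \<Longrightarrow> freqs r D s t \<subseteq> freqs r D' s t"
  by (force simp: freqs_def)

lemma trig_poly_mono:
  assumes "r \<ge> 2" "trig_poly r D s t F" "D \<le> D'"
  shows "trig_poly r D' s t F"
proof -
  obtain a where a: "\<And>y. F y = (\<Sum>k\<in>freqs r D s t. a k * character r k y)"
    using assms by (auto simp: trig_poly_def)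
  have "trig_poly r D' s t (\<lambda>y. \<Sum>k\<in>freqs r D s t. a k * character r k y)"
    by (intro trig_poly_sum trig_poly_character assms) (use freqs_mono[OF assms(3)] in auto)
  then show ?thesis by (simp add: a[symmetric])
qed

lemma trig_poly_mult:
  assumes r: "r \<ge> 2" and FG: "trig_poly r D s t F" "trig_poly r D' s' t' G"
  shows "trig_poly r (D + D') (s + s') (t + t') (\<lambda>y. F y * G y)"
proof -
  obtain a b where ab: "\<And>y. F y = (\<Sum>k\<in>freqs r D s t. a k * character r k y)"
    "\<And>y. G y = (\<Sum>k\<in>freqs r D' s' t'. b k * character r k y)" using FG by (auto simp: trig_poly_def)
  have "F y * G y = (\<Sum>k\<in>freqs r D s t. \<Sum>k'\<in>freqs r D' s' t'. (a k * b k') * character r (\<lambda>l. k l + k' l) y)" for y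
    unfolding ab sum_product character_add by (simp add: mult_ac)
  moreover have "trig_poly r (D + D') (s + s') (t + t')
    (\<lambda>y. \<Sum>k\<in>freqs r D s t. \<Sum>k'\<in>freqs r D' s' t'. (a k * b k') * character r (\<lambda>l. k l + k' l) y)"
    by (intro trig_poly_sum trig_poly_character r)
      (force simp: freqs_def intro: order_trans[OF abs_triangle_ineq add_mono])
  ultimately show ?thesis by simp
qed

lemma trig_poly_cnj:
  assumes r: "r \<ge> 2" and F: "trig_poly r D s t F"
  shows "trig_poly r D (- s) (- t) (\<lambda>y. cnj (F y))"
proof -
  obtain a where a: "\<And>y. F y = (\<Sum>k\<in>freqs r D s t. a k * character r k y)" using F by (auto simp: trig_poly_def)
  have "cnj (F y) = (\<Sum>k\<in>freqs r D s t. cnj (a k) * character r (\<lambda>l. - k l) y)" for y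
    by (simp add: a character_uminus)
  moreover have "trig_poly r D (- s) (- t) (\<lambda>y. \<Sum>k\<in>freqs r D s t. cnj (a k) * character r (\<lambda>l. - k l) y)"
    by (intro trig_poly_sum trig_poly_character r) (force simp: freqs_def)
  ultimately show ?thesis by simp
qed

text \<open>
  The lowest nonzero digit would be divisible by the base.
\<close>

lemma balanced_digits_unique:
  fixes \<delta> :: "nat \<Rightarrow> int" and Q :: int
  assumes Q: "Q > 0" and d: "\<And>l. l \<in> {a..<b} \<Longrightarrow> \<bar>\<delta> l\<bar> < Q" and eq: "(\<Sum>l\<in>{a..<b}. \<delta> l * Q ^ l) = 0"
  shows "l \<in> {a..<b} \<Longrightarrow> \<delta> l = 0"
proof (induction l rule: less_induct)
  case (less l)
  have "(\<Sum>l\<in>{a..<b}. \<delta> l * Q ^ l) = (\<Sum>i\<in>{l..<b}. \<delta> i * Q ^ i)"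
    using less by (intro sum.mono_neutral_right) auto
  also have "\<dots> = \<delta> l * Q ^ l + (\<Sum>i\<in>{Suc l..<b}. \<delta> i * Q ^ i)"
    using less.prems by (subst sum.atLeast_Suc_lessThan) auto
  also have "(\<Sum>i\<in>{Suc l..<b}. \<delta> i * Q ^ i) = Q ^ Suc l * (\<Sum>i\<in>{Suc l..<b}. \<delta> i * Q ^ (i - Suc l))"
    unfolding sum_distrib_left
  proof (intro sum.cong refl)
    fix i assume "i \<in> {Suc l..<b}"
    then have "Q ^ i = Q ^ (Suc l + (i - Suc l))" by simp
    then show "\<delta> i * Q ^ i = Q ^ Suc l * (\<delta> i * Q ^ (i - Suc l))"
      by (simp only: power_add mult_ac)
  qed
  finally have "Q ^ l * (\<delta> l + Q * (\<Sum>i\<in>{Suc l..<b}. \<delta> i * Q ^ (i - Suc l))) = 0"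
    using eq by (simp add: algebra_simps)
  then have "\<delta> l = Q * (- (\<Sum>i\<in>{Suc l..<b}. \<delta> i * Q ^ (i - Suc l)))" using Q by auto
  then have "Q dvd \<delta> l" by (rule dvdI)
  then show ?case using d[OF less.prems] dvd_imp_le_int[of "\<delta> l" Q] by linarith
qed

lemma root_of_unity_sum:
  assumes "d \<noteq> 0" "\<bar>d\<bar> < int M"
  shows "(\<Sum>t<M. ee (of_int d * (real t / real M))) = 0"
proof -
  define w where "w = ee (of_int d / real M)"
  have M: "M > 0" using assms by linarith
  have "ee (of_int d * (real t / real M)) = w ^ t" for t
    by (simp add: w_def ee_of_nat_mult[symmetric] field_simps)
  moreover have "w ^ M = 1"
    using M by (simp add: w_def ee_of_nat_mult[symmetric] ee_Ints)
  moreover have "w \<noteq> 1"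
  proof
    assume "w = 1"
    then have "cos (2 * pi * (of_int d / real M)) = 1" by (simp add: w_def ee_def complex_eq_iff)
    then obtain n :: int where "2 * pi * (of_int d / real M) = of_int n * 2 * pi"
      using cos_one_2pi_int by blast
    then have "real_of_int d = of_int n * real M" using M by (simp add: field_simps)
    then have "d = n * int M" by (metis of_int_eq_iff of_int_mult of_int_of_nat_eq)
    then show False using assms dvd_imp_le_int[of d "int M"] by simp
  qed
  ultimately show ?thesis by (simp add: sum_gp_strict)
qed

text \<open>
  Kronecker substitution: putting $y_l = Q^l v$ with $Q = 2D + 1$ turns the frequencies into distinct
  integers, so that a Fourier coefficient is the mean of a function of the single variable \<open>v\<close> over
  sufficiently many equidistant points.  A pointwise bound thus bounds every coefficient, and the
  number of frequencies is only polynomial in \<open>D\<close>.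
\<close>

lemma trig_poly_coeff_bound:
  assumes r: "r \<ge> 2" and F: "\<And>y. F y = (\<Sum>k\<in>freqs r D s t. a k * character r k y)"
    and B: "\<And>y. cmod (F y) \<le> B" and k0: "k0 \<in> freqs r D s t"
  shows "cmod (a k0) \<le> B"
proof -
  define Q :: int where "Q = 2 * int D + 1"
  define K where "K k = (\<Sum>l\<in>{1..<r-1}. k l * Q ^ l)" for k :: "nat \<Rightarrow> int"
  define y where "y v l = (if l \<in> {1..<r-1} then of_int (Q ^ l) * v else 0)" for v :: real and l
  note fin = freqs_finite_card(1)[OF r, of D s t]
  have ch: "character r k (y v) = ee (of_int (K k) * v)" for k v
  proof -
    have "(\<Sum>l=1..r. of_int (k l) * y v l) = (\<Sum>l\<in>{1..<r-1}. of_int (k l) * (of_int (Q ^ l) * v))"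
      by (rule sum.mono_neutral_cong_right) (auto simp: y_def)
    also have "\<dots> = of_int (K k) * v"
      by (simp add: K_def sum_distrib_right mult.assoc)
    finally show ?thesis by (simp add: character_def)
  qed
  have inj: "k = k0" if k: "k \<in> freqs r D s t" and eq: "K k = K k0" for k
  proof
    fix l
    have z: "k l - k0 l = 0" if "l \<in> {1..<r-1}"
    proof (rule balanced_digits_unique[where \<delta> = "\<lambda>l. k l - k0 l", OF _ _ _ that])
      show "Q > 0" by (simp add: Q_def)
      show "\<bar>k i - k0 i\<bar> < Q" if "i \<in> {1..<r-1}" for i
        using k k0 that by (force simp: freqs_def Q_def abs_le_iff abs_less_iff)
      show "(\<Sum>l\<in>{1..<r-1}. (k l - k0 l) * Q ^ l) = 0"
        using eq by (simp add: K_def left_diff_distrib sum_subtractf)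
    qed
    consider "l \<notin> {1..r}" | "l = r" | "l = r - 1" | "l \<in> {1..<r-1}" by force
    then show "k l = k0 l" by cases (use k k0 z in \<open>auto simp: freqs_def\<close>)
  qed
  \<comment> \<open>Larger than all frequency differences, so that sampling at \<open>M\<close> points separates the frequencies.\<close>
  define M where "M = Suc (\<Sum>k\<in>freqs r D s t. nat \<bar>K k - K k0\<bar>)"
  have Mb: "\<bar>K k - K k0\<bar> < int M" if "k \<in> freqs r D s t" for k
  proof -
    have "nat \<bar>K k - K k0\<bar> \<le> (\<Sum>k\<in>freqs r D s t. nat \<bar>K k - K k0\<bar>)"
      using that fin by (intro member_le_sum) auto
    then have "nat \<bar>K k - K k0\<bar> < M" by (simp only: M_def less_Suc_eq_le)
    then show ?thesis by linarith
  qed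
  have M0: "M > 0" by (simp add: M_def)
  have "(\<Sum>v<M. F (y (real v / real M)) * cnj (ee (of_int (K k0) * (real v / real M))))
    = (\<Sum>v<M. \<Sum>k\<in>freqs r D s t. a k * ee (of_int (K k - K k0) * (real v / real M)))"
    by (simp only: F ch sum_distrib_right mult.assoc ee_diff[symmetric] left_diff_distrib of_int_diff)
  also have "\<dots> = (\<Sum>k\<in>freqs r D s t. a k * (\<Sum>v<M. ee (of_int (K k - K k0) * (real v / real M))))"
    by (subst sum.swap) (simp only: sum_distrib_left)
  also have "\<dots> = (\<Sum>k\<in>freqs r D s t. if k = k0 then a k * of_nat M else 0)"
  proof (rule sum.cong[OF refl])
    fix k assume k: "k \<in> freqs r D s t"
    show "a k * (\<Sum>v<M. ee (of_int (K k - K k0) * (real v / real M))) = (if k = k0 then a k * of_nat M else 0)"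
      using root_of_unity_sum[OF _ Mb[OF k]] inj[OF k] by auto
  qed
  also have "\<dots> = a k0 * of_nat M" using fin k0 by simp
  finally have "real M * cmod (a k0) = cmod (\<Sum>v<M. F (y (real v / real M)) * cnj (ee (of_int (K k0) * (real v / real M))))"
    by (simp add: norm_mult)
  also have "\<dots> \<le> (\<Sum>v<M. B)"
    by (rule sum_norm_le) (simp add: norm_mult B)
  finally show ?thesis using M0 by simp
qed

lemma trig_poly_orbit_sum:
  assumes r: "r \<ge> 2" and Y: "skew_orbit \<omega> Y" and F: "trig_poly r D 0 q F"
    and B: "\<And>y. cmod (F y) \<le> B"
    and W: "\<And>u. weyl_seq \<omega> (r - 2) q u \<Longrightarrow> cmod (\<Sum>n<M. u n) \<le> W"
  shows "cmod (\<Sum>n<M. F (Y (m + int n))) \<le> (2 * real D + 1) ^ r * B * W"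
proof -
  obtain a where a: "\<And>y. F y = (\<Sum>k\<in>freqs r D 0 q. a k * character r k y)"
    using F by (auto simp: trig_poly_def)
  have B0: "B \<ge> 0" using B[of "\<lambda>_. 0"] norm_ge_zero order_trans by blast
  have W0: "W \<ge> 0"
  proof -
    have "weyl_seq \<omega> (r - 2) q (\<lambda>n. 1 * ee (\<Sum>l=1..Suc (r-2). of_int (if l = Suc (r - 2) then q else 0) * Y (0 + int n) l))"
      using skew_orbit_character_weyl[OF Y, of 1 "r - 2" "\<lambda>l. if l = Suc (r - 2) then q else 0" 0] by simp
    from W[OF this] show ?thesis using norm_ge_zero order_trans by blast
  qed
  have bd: "cmod (\<Sum>n<M. character r k (Y (m + int n))) \<le> W" if k: "k \<in> freqs r D 0 q" for k
  proof -
    have "character r k y = 1 * ee (\<Sum>l=1..Suc (r - 2). of_int (k l) * y l)" for y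
    proof -
      have "{1..r} = insert r {1..Suc (r - 2)}" using r by auto
      then have "(\<Sum>l=1..r. of_int (k l) * y l) = of_int (k r) * y r + (\<Sum>l=1..Suc (r - 2). of_int (k l) * y l)"
        using r by simp
      then show ?thesis using k by (simp add: character_def freqs_def)
    qed
    moreover have "k (Suc (r - 2)) = q" using k r by (simp add: freqs_def numeral_2_eq_2 Suc_diff_Suc)
    ultimately show ?thesis
      using skew_orbit_character_weyl[OF Y, of 1 "r - 2" k m] by (intro W) simp
  qed
  have "(\<Sum>n<M. F (Y (m + int n))) = (\<Sum>k\<in>freqs r D 0 q. a k * (\<Sum>n<M. character r k (Y (m + int n))))"
    unfolding a by (subst sum.swap) (simp add: sum_distrib_left)
  also have "cmod \<dots> \<le> (\<Sum>k\<in>freqs r D 0 q. B * W)"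
    using trig_poly_coeff_bound[OF r a B] bd B0
    by (intro sum_norm_le) (auto simp: norm_mult intro!: mult_mono)
  also have "\<dots> = real (card (freqs r D 0 q)) * (B * W)" by simp
  also have "\<dots> \<le> real ((2 * D + 1) ^ r) * (B * W)"
    using freqs_finite_card(2)[OF r, of D 0 q] B0 W0 by (intro mult_right_mono) (auto simp del: of_nat_power)
  finally show ?thesis by (simp add: algebra_simps)
qed

section \<open>Schur functions and the logarithmic derivative of a Szego polynomial\<close>

text \<open>
  The power series of the quotient $b_n = P_n / R_n$ of the two components of a solution of the Szego
  recursion, started from an arbitrary series \<open>b\<close>.
\<close>

primrec schur_series :: "complex fps \<Rightarrow> (nat \<Rightarrow> complex) \<Rightarrow> nat \<Rightarrow> complex fps" where
  "schur_series b a 0 = b"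
| "schur_series b a (Suc n) = (fps_X * schur_series b a n - fps_const (cnj (a n))) *
     inverse (1 - fps_const (a n) * (fps_X * schur_series b a n))"

definition schur_den :: "complex fps \<Rightarrow> (nat \<Rightarrow> complex) \<Rightarrow> nat \<Rightarrow> complex fps" where
  "schur_den b a n = 1 - fps_const (a n) * (fps_X * schur_series b a n)"

text \<open>
  The contribution of site \<open>n\<close> to $z \frac{d}{dz} \log$ of the polynomial \<open>q0\<close> below, which gains the
  factor $1 - \alpha_n z b_n$ at this site.
\<close>

definition log_increment :: "complex fps \<Rightarrow> (nat \<Rightarrow> complex) \<Rightarrow> nat \<Rightarrow> complex fps" where
  "log_increment b a n = fps_X * fps_deriv (schur_den b a n) * inverse (schur_den b a n)"

lemma schur_den_nth_0 [simp]: "fps_nth (schur_den b a n) 0 = 1"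
  by (simp add: schur_den_def)

lemma schur_den_inverse: "schur_den b a n * inverse (schur_den b a n) = 1"
  using inverse_mult_eq_1'[of "schur_den b a n"] by simp

lemma schur_series_Suc: "schur_series b a (Suc n) = (fps_X * schur_series b a n - fps_const (cnj (a n))) * inverse (schur_den b a n)"
  by (simp add: schur_den_def)

lemma schur_series_shift: "schur_series b a (m + n) = schur_series (schur_series b a m) (\<lambda>i. a (m + i)) n"
  by (induction n) simp_all

lemma log_increment_shift: "log_increment b a (m + n) = log_increment (schur_series b a m) (\<lambda>i. a (m + i)) n"
  by (simp add: log_increment_def schur_den_def schur_series_shift)

lemma moebius_difference:
  fixes x :: "'a :: comm_ring_1"
  assumes "D1 = 1 - a * (x * B)" "D2 = 1 - a * (x * C)" "D1 * i1 = 1" "D2 * i2 = 1"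
  shows "(x * B - c) * i1 - (x * C - c) * i2 = x * (B - C) * ((1 - a * c) * i1 * i2)"
proof -
  have "(x * B - c) * i1 - (x * C - c) * i2
      = (x * B - c) * i1 * (D2 * i2) - (x * C - c) * i2 * (D1 * i1)"
    using assms by simp
  also have "\<dots> = x * (B - C) * ((1 - a * c) * i1 * i2)"
    unfolding assms(1,2) by (simp add: algebra_simps)
  finally show ?thesis .
qed

text \<open>
  Each step multiplies the difference of two solutions by a multiple of the variable.
\<close>

lemma schur_series_initial_value: "\<exists>h. schur_series b a n - schur_series b' a n = fps_X ^ n * h"
proof (induction n)
  case 0
  show ?case by (intro exI[of _ "b - b'"]) simp
next
  case (Suc n)
  then obtain h where h: "schur_series b a n - schur_series b' a n = fps_X ^ n * h" by auto
  have "schur_series b a (Suc n) - schur_series b' a (Suc n) = fps_X * (schur_series b a n - schur_series b' a n) *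
      ((1 - fps_const (a n) * fps_const (cnj (a n))) * inverse (schur_den b a n) * inverse (schur_den b' a n))"
    unfolding schur_series_Suc
    by (rule moebius_difference[OF schur_den_def schur_den_def schur_den_inverse schur_den_inverse])
  then show ?case unfolding h by (auto simp: mult.assoc)
qed

lemma wronskian_perturbation:
  fixes d :: "'a :: comm_ring_1"
  shows "(d + e') * D - d * (D + e) = e' * D - d * e"
  by (simp add: algebra_simps)

lemma factor_power:
  fixes x :: "'a :: comm_ring_1"
  shows "x * (xn * k * D - d * (x * xn * g)) * i = x * xn * ((k * D - d * (x * g)) * i)"
  by (simp add: algebra_simps)

lemma log_increment_initial_value:
  assumes "j \<le> n"
  shows "fps_nth (log_increment b a n) j = fps_nth (log_increment b' a n) j"
proof -
  obtain h where h: "schur_series b a n - schur_series b' a n = fps_X ^ n * h" using schur_series_initial_value by blast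
  define D1 D2 i1 i2 where "D1 = schur_den b a n" and "D2 = schur_den b' a n"
    and "i1 = inverse (schur_den b a n)" and "i2 = inverse (schur_den b' a n)"
  have inv: "D1 * i1 = 1" "D2 * i2 = 1" by (simp_all add: D1_def D2_def i1_def i2_def schur_den_inverse)
  define g where "g = - (fps_const (a n) * h)"
  have E: "D1 - D2 = fps_X ^ Suc n * g"
  proof -
    have "D1 - D2 = - (fps_const (a n) * (fps_X * (schur_series b a n - schur_series b' a n)))"
      by (simp add: D1_def D2_def schur_den_def algebra_simps)
    then show ?thesis unfolding h g_def by (simp add: algebra_simps)
  qed
  then have D1: "D1 = D2 + fps_X ^ Suc n * g" by (simp add: algebra_simps)
  have dE: "fps_deriv (fps_X ^ Suc n * g) = fps_X ^ n * (fps_const (of_nat (Suc n)) * g + fps_X * fps_deriv g)"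
  proof -
    have "fps_deriv (fps_X ^ Suc n * g) = fps_X ^ Suc n * fps_deriv g + fps_deriv (fps_X ^ Suc n) * g"
      by (rule fps_deriv_mult)
    also have "fps_deriv (fps_X ^ Suc n :: complex fps) = fps_const (of_nat (Suc n)) * fps_X ^ n"
      by (simp only: fps_deriv_power fps_deriv_fps_X diff_Suc_1 mult_1_right)
    finally show ?thesis by (simp only: power_Suc distrib_left mult_ac add_ac)
  qed
  have "log_increment b a n - log_increment b' a n = fps_X * fps_deriv D1 * i1 * (D2 * i2) - fps_X * fps_deriv D2 * i2 * (D1 * i1)"
    unfolding inv by (simp add: log_increment_def D1_def D2_def i1_def i2_def)
  also have "\<dots> = fps_X * (fps_deriv D1 * D2 - fps_deriv D2 * D1) * (i1 * i2)"
    by (simp add: algebra_simps)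
  also have "fps_deriv D1 * D2 - fps_deriv D2 * D1
     = fps_deriv (fps_X ^ Suc n * g) * D2 - fps_deriv D2 * (fps_X ^ Suc n * g)"
    unfolding D1 fps_deriv_add by (rule wronskian_perturbation)
  also have "fps_X * \<dots> * (i1 * i2) = fps_X ^ Suc n *
     (((fps_const (of_nat (Suc n)) * g + fps_X * fps_deriv g) * D2 - fps_deriv D2 * (fps_X * g)) * (i1 * i2))"
    unfolding dE unfolding power_Suc by (rule factor_power)
  finally have "fps_nth (log_increment b a n - log_increment b' a n) j = 0"
    using assms by (simp only: fps_X_power_mult_nth) simp
  then show ?thesis by simp
qed

text \<open>
  Forgetting everything before site \<open>n - j\<close> changes the series only from order \<open>j + 1\<close> on; so along an orbit
  the \<open>j\<close>-th coefficient is a fixed function on the torus evaluated at $T^{n-j} x$.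
\<close>

lemma log_increment_local:
  assumes "j \<le> n"
  shows "fps_nth (log_increment b a n) j = fps_nth (log_increment b' (\<lambda>i. a (n - j + i)) j) j"
proof -
  have "log_increment b a n = log_increment (schur_series b a (n - j)) (\<lambda>i. a (n - j + i)) j"
    using log_increment_shift[of b a "n - j" j] assms by simp
  then show ?thesis by (simp only:) (rule log_increment_initial_value, simp)
qed

lemma moebius_norm_le:
  assumes "cmod a \<le> 1" "cmod w \<le> 1"
  shows "cmod (w - cnj a) \<le> cmod (1 - a * w)"
proof -
  have "(cmod (1 - a * w))\<^sup>2 - (cmod (w - cnj a))\<^sup>2 = (1 - (cmod a)\<^sup>2) * (1 - (cmod w)\<^sup>2)"
    unfolding cmod_power2 by (simp add: power2_eq_square algebra_simps)
  also have "\<dots> \<ge> 0"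
    using assms by (intro mult_nonneg_nonneg) (auto simp: abs_square_le_1)
  finally have "(cmod (w - cnj a))\<^sup>2 \<le> (cmod (1 - a * w))\<^sup>2" by simp
  then show ?thesis by (rule power2_le_imp_le) simp
qed

text \<open>
  The sum function of \<open>schur_series 0\<close>.  A Moebius map of the disc is applied at every step, so it stays
  bounded by one, which the power series alone does not show.
\<close>

primrec schur_fun :: "(nat \<Rightarrow> complex) \<Rightarrow> nat \<Rightarrow> complex \<Rightarrow> complex" where
  "schur_fun a 0 z = 0"
| "schur_fun a (Suc n) z = (z * schur_fun a n z - cnj (a n)) * inverse (1 - a n * (z * schur_fun a n z))"

lemma small_factor:
  assumes "cmod a \<le> L" "L < 1" "cmod z \<le> 1" "cmod b \<le> 1"
  shows "cmod (a * (z * b)) \<le> L"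
proof -
  have "cmod a * (cmod z * cmod b) \<le> L * (1 * 1)"
    using assms by (intro mult_mono) (auto intro: order_trans[OF norm_ge_zero])
  then show ?thesis by (simp add: norm_mult)
qed

lemma schur_fun_norm_le:
  assumes a: "\<And>n. cmod (a n) \<le> L" and L: "L < 1" and z: "cmod z \<le> 1"
  shows "cmod (schur_fun a n z) \<le> 1"
proof (induction n)
  case (Suc n)
  have "cmod (a n * (z * schur_fun a n z)) < 1"
    using small_factor[OF a L z Suc] L by (rule le_less_trans)
  then have nz: "1 - a n * (z * schur_fun a n z) \<noteq> 0" by force
  have "cmod (z * schur_fun a n z - cnj (a n)) \<le> cmod (1 - a n * (z * schur_fun a n z))"
    using Suc z a[of n] L by (intro moebius_norm_le) (auto simp: norm_mult intro!: mult_le_one)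
  then show ?case using nz by (simp add: norm_divide divide_le_eq_1 divide_inverse[symmetric])
qed simp

lemma schur_fun_den_bound:
  assumes a: "\<And>n. cmod (a n) \<le> L" and L: "L < 1" and z: "cmod z \<le> 1"
  shows "cmod (a n * (z * schur_fun a n z)) \<le> L"
  by (intro small_factor a L z schur_fun_norm_le[of a L])

lemma schur_fun_den_nz:
  assumes a: "\<And>n. cmod (a n) \<le> L" and L: "L < 1" and z: "cmod z \<le> 1"
  shows "1 - a n * (z * schur_fun a n z) \<noteq> 0"
proof
  assume "1 - a n * (z * schur_fun a n z) = 0"
  then have "a n * (z * schur_fun a n z) = 1" by simp
  then show False using schur_fun_den_bound[of a L z n, OF a L z] L by simp
qed

lemma schur_fun_holomorphic:
  assumes a: "\<And>n. cmod (a n) \<le> L" and L: "L < 1"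
  shows "schur_fun a n holomorphic_on ball 0 1"
proof (induction n)
  case 0
  have "schur_fun a 0 = (\<lambda>z. 0)" by auto
  then show ?case by simp
next
  case (Suc n)
  have "schur_fun a (Suc n) = (\<lambda>z. (z * schur_fun a n z - cnj (a n)) * inverse (1 - a n * (z * schur_fun a n z)))"
    by auto
  then show ?case
    using schur_fun_den_nz[of a L, OF a L] by (auto intro!: holomorphic_intros Suc)
qed

lemma schur_fun_expansion: "schur_fun a n has_fps_expansion schur_series 0 a n"
proof (induction n)
  case 0
  have "schur_fun a 0 = (\<lambda>z. 0)" by auto
  then show ?case by simp
next
  case (Suc n)
  have "schur_fun a (Suc n) = (\<lambda>z. (z * schur_fun a n z - cnj (a n)) * inverse (1 - a n * (z * schur_fun a n z)))"
    by auto
  then show ?case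
    by (auto intro!: fps_expansion_intros Suc)
qed

text \<open>
  The factor $1 - \alpha_n z b_n$ takes values in a disc around one of radius less than one, so its
  logarithm is bounded on the unit disc; Cauchy's estimate bounds the Taylor coefficients of the
  logarithm, and differentiating costs the factor \<open>j\<close>.
\<close>

lemma log_increment_coeff_bound:
  assumes a: "\<And>n. cmod (a n) \<le> L" and L: "L < 1"
  shows "cmod (fps_nth (log_increment 0 a n) j) \<le> 2 * (\<bar>ln (1 - L)\<bar> + ln 2 + pi) * real j"
proof (cases "j = 0")
  case True
  then show ?thesis by (simp add: log_increment_def)
next
  case False
  define H where "H = \<bar>ln (1 - L)\<bar> + ln 2 + pi"
  define D where "D z = 1 - a n * (z * schur_fun a n z)" for z
  define h where "h z = Ln (D z)" for z
  have L0: "0 \<le> L" using a[of 0] norm_ge_zero order_trans by blast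
  have Dn: "cmod (1 - D z) \<le> L" if "cmod z \<le> 1" for z
    using schur_fun_den_bound[of a L, OF a L that] by (simp add: D_def)
  have Dpos: "D z \<notin> \<real>\<^sub>\<le>\<^sub>0" if "cmod z \<le> 1" for z
  proof -
    have "\<bar>Re (1 - D z)\<bar> \<le> L" using Dn[OF that] abs_Re_le_cmod order_trans by blast
    then have "Re (D z) > 0" using L by simp
    then show ?thesis by (auto simp: complex_nonpos_Reals_iff)
  qed
  have D_holo: "D holomorphic_on ball 0 1"
    unfolding D_def using schur_fun_holomorphic[of a L, OF a L] by (auto intro!: holomorphic_intros)
  have h_holo: "h holomorphic_on ball 0 1"
    unfolding h_def using D_holo Dpos by (auto intro!: holomorphic_intros)
  have h_bound: "cmod (h z) \<le> H" if "cmod z \<le> 1" for z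
  proof -
    have "D z \<noteq> 0" using Dpos[OF that] by auto
    have "1 - L \<le> cmod (D z)" "cmod (D z) \<le> 2"
      using Dn[OF that] L norm_triangle_ineq2[of 1 "1 - D z"] norm_triangle_ineq4[of 1 "1 - D z"] by auto
    then have "ln (1 - L) \<le> ln (cmod (D z))" "ln (cmod (D z)) \<le> ln 2"
      using L by (auto simp del: ln_le_cancel_iff intro!: ln_mono)
    moreover have "Re (h z) = ln (cmod (D z))" "\<bar>Im (h z)\<bar> \<le> pi"
      using \<open>D z \<noteq> 0\<close> Im_Ln_le_pi[of "D z"] mpi_less_Im_Ln[of "D z"] by (auto simp: h_def)
    moreover have "0 \<le> ln (2::real)" by simp
    ultimately have "\<bar>Re (h z)\<bar> + \<bar>Im (h z)\<bar> \<le> H" unfolding H_def by linarith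
    then show ?thesis using cmod_le[of "h z"] by linarith
  qed
  define hh where "hh = fps_expansion h 0"
  have h_exp: "h has_fps_expansion hh"
    unfolding hh_def by (rule has_fps_expansion_fps_expansion[OF _ _ h_holo]) auto
  have D_exp: "D has_fps_expansion schur_den 0 a n"
    unfolding D_def schur_den_def by (auto intro!: fps_expansion_intros schur_fun_expansion)
  have e1: "(\<lambda>z. deriv h z * D z) has_fps_expansion fps_deriv hh * schur_den 0 a n"
    by (intro fps_expansion_intros h_exp D_exp)
  have e2: "deriv D has_fps_expansion fps_deriv (schur_den 0 a n)"
    by (intro fps_expansion_intros D_exp)
  have ev: "eventually (\<lambda>z. deriv D z = deriv h z * D z) (nhds 0)"
  proof -
    have "eventually (\<lambda>z::complex. z \<in> ball 0 1) (nhds 0)"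
      by (intro eventually_nhds_in_open) auto
    then show ?thesis
    proof eventually_elim
      case (elim z)
      have Dd: "(D has_field_derivative deriv D z) (at z)"
        using holomorphic_derivI[OF D_holo _ elim] by simp
      have "(h has_field_derivative inverse (D z) * deriv D z) (at z)"
        unfolding h_def
        by (rule DERIV_chain2[OF has_field_derivative_Ln Dd]) (use Dpos elim in auto)
      then have "deriv h z = inverse (D z) * deriv D z" by (rule DERIV_imp_deriv)
      moreover have "D z \<noteq> 0" using Dpos[of z] elim by auto
      ultimately show ?case by simp
    qed
  qed
  have "fps_deriv (schur_den 0 a n) = fps_deriv hh * schur_den 0 a n"
    using e1 e2 has_fps_expansion_cong[OF ev refl] fps_expansion_unique_complex by blast
  then have "log_increment 0 a n = fps_X * fps_deriv hh * (schur_den 0 a n * inverse (schur_den 0 a n))"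
    by (simp add: log_increment_def mult_ac)
  then have "log_increment 0 a n = fps_X * fps_deriv hh" by (simp add: schur_den_inverse)
  then have coeff: "fps_nth (log_increment 0 a n) j = of_nat j * fps_nth hh j"
    using False by simp
  \<comment> \<open>A radius that is large enough for $s^j \ge 1/2$, by the inequality of Bernoulli.\<close>
  define s where "s = 1 - 1 / (2 * real j)"
  have s: "0 < s" "s < 1" using False by (auto simp: s_def field_simps)
  have sj: "1 / 2 \<le> s ^ j"
    using Bernoulli_inequality[of "- (1 / (2 * real j))" j] False by (simp add: s_def field_simps)
  have "cmod ((deriv ^^ j) h 0) \<le> fact j * H / s ^ j"
  proof (rule Cauchy_inequality)
    show "h holomorphic_on ball 0 s" by (rule holomorphic_on_subset[OF h_holo]) (use s in auto)
    show "continuous_on (cball 0 s) h"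
      by (rule holomorphic_on_imp_continuous_on, rule holomorphic_on_subset[OF h_holo]) (use s in auto)
    show "cmod (h x) \<le> H" if "cmod (0 - x) = s" for x using h_bound[of x] that s by simp
  qed (use s in auto)
  also have "\<dots> \<le> fact j * H / (1 / 2)"
    using sj s by (intro divide_left_mono) (auto simp: H_def)
  finally have "cmod (fps_nth hh j) \<le> 2 * H"
    by (simp add: hh_def fps_expansion_def norm_divide divide_simps mult_ac)
  then have "cmod (fps_nth (log_increment 0 a n) j) \<le> real j * (2 * H)"
    unfolding coeff norm_mult by (simp add: mult_left_mono)
  then show ?thesis by (simp add: H_def mult_ac)
qed

section \<open>Cancellation in the power sums\<close>

lemma trig_poly_cong:
  assumes "r \<ge> 2" "trig_poly r D s t F" "D \<le> D'" "s = s'" "t = t'" "\<And>y. G y = F y"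
  shows "trig_poly r D' s' t' G"
  using trig_poly_mono[OF assms(1-3)] assms(4-) by (simp add: trig_poly_def)

lemma trig_poly_1: "r \<ge> 2 \<Longrightarrow> trig_poly r 0 0 0 (\<lambda>y. 1)"
  using trig_poly_character[of r "\<lambda>_. 0" 0 0 0 1] by (simp add: freqs_def character_def)

text \<open>
  The coefficient sequence started at the point \<open>y\<close>: by \<open>skew_orbit_binomial\<close> the last coordinate of
  $T^i y$ is the displayed phase.
\<close>

definition rot_seq :: "complex \<Rightarrow> real \<Rightarrow> nat \<Rightarrow> (nat \<Rightarrow> real) \<Rightarrow> nat \<Rightarrow> complex" where
  "rot_seq lam \<omega> r y i = lam * ee ((\<Sum>s<r. real (i choose s) * y (r - s)) + real (i choose r) * \<omega>)"

lemma cmod_rot_seq [simp]: "cmod (rot_seq lam \<omega> r y i) = cmod lam"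
  by (simp add: rot_seq_def norm_mult)

lemma rot_seq_orbit:
  assumes "skew_orbit \<omega> Y"
  shows "rot_seq lam \<omega> r (Y m) i = lam * ee (Y (m + int i) r)"
  using assms by (simp add: rot_seq_def skew_orbit_binomial[OF assms, of m i r] skew_orbit_def
      lessThan_Suc_atMost[symmetric])

lemma binomial_le_fixed_power: "i \<le> J \<Longrightarrow> s \<le> r \<Longrightarrow> i choose s \<le> Suc J ^ r"
proof (cases "s \<le> i")
  case True
  assume *: "i \<le> J" "s \<le> r"
  have "i choose s \<le> i ^ s" by (rule binomial_le_pow[OF True])
  also have "\<dots> \<le> Suc J ^ s" using * by (intro power_mono) auto
  also have "\<dots> \<le> Suc J ^ r" using * by (intro power_increasing) auto
  finally show ?thesis .
qed (simp add: binomial_eq_0)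

lemma trig_poly_rot_seq:
  assumes r: "r \<ge> 2" and i: "i \<le> J"
  shows "trig_poly r (Suc J ^ r) 1 (int i) (\<lambda>y. rot_seq lam \<omega> r y i)"
proof -
  define k where "k l = (if l \<in> {1..r} then int (i choose (r - l)) else 0)" for l
  have k: "k \<in> freqs r (Suc J ^ r) 1 (int i)"
    using r binomial_le_fixed_power[OF i, of _ r] by (auto simp: freqs_def k_def simp del: power_Suc of_nat_power)
  have "rot_seq lam \<omega> r y i = (lam * ee (real (i choose r) * \<omega>)) * character r k y" for y
  proof -
    have "(\<Sum>s<r. real (i choose s) * y (r - s)) = (\<Sum>l=1..r. of_int (k l) * y l)"
      by (rule sum.reindex_bij_witness[of _ "\<lambda>l. r - l" "\<lambda>s. r - s"]) (auto simp: k_def)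
    then show ?thesis by (simp add: rot_seq_def character_def ee_add mult_ac)
  qed
  then show ?thesis using trig_poly_character[OF r k] by simp
qed

lemma schur_series_nth_Suc:
  "fps_nth (schur_series b a (Suc n)) (Suc j) = fps_nth (schur_series b a n) j +
     a n * (\<Sum>i=0..j. fps_nth (schur_series b a n) i * fps_nth (schur_series b a (Suc n)) (j - i))"
proof -
  have "schur_series b a (Suc n) * schur_den b a n =
      (fps_X * schur_series b a n - fps_const (cnj (a n))) * (schur_den b a n * inverse (schur_den b a n))"
    unfolding schur_series_Suc by (simp only: mult_ac)
  then have "schur_series b a (Suc n) = fps_X * schur_series b a n - fps_const (cnj (a n)) +
      fps_const (a n) * (fps_X * (schur_series b a n * schur_series b a (Suc n)))"
    unfolding schur_den_inverse by (simp add: schur_den_def algebra_simps del: schur_series.simps(2))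
  from arg_cong[OF this, of "\<lambda>f. fps_nth f (Suc j)"] show ?thesis
    by (simp add: fps_mult_nth[of "schur_series b a n"] del: schur_series.simps(2))
qed

lemma inverse_schur_den_nth_Suc:
  "fps_nth (inverse (schur_den b a n)) (Suc j) =
     a n * (\<Sum>i=0..j. fps_nth (schur_series b a n) i * fps_nth (inverse (schur_den b a n)) (j - i))"
proof -
  have "inverse (schur_den b a n) = 1 + fps_const (a n) * (fps_X * (schur_series b a n * inverse (schur_den b a n)))"
    using schur_den_inverse[of b a n] by (simp add: schur_den_def algebra_simps)
  from arg_cong[OF this, of "\<lambda>f. fps_nth f (Suc j)"] show ?thesis
    by (simp add: fps_mult_nth[of "schur_series b a n"])
qed

lemma log_increment_nth_Suc:
  "fps_nth (log_increment b a n) (Suc j) = - a n *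
     (\<Sum>i=0..j. of_nat (Suc i) * (fps_nth (schur_series b a n) i * fps_nth (inverse (schur_den b a n)) (j - i)))"
proof -
  have "fps_nth (fps_deriv (schur_den b a n)) i = - a n * of_nat (Suc i) * fps_nth (schur_series b a n) i" for i
    by (cases "i = 0") (simp_all add: schur_den_def distrib_right)
  then have "fps_nth (fps_deriv (schur_den b a n) * inverse (schur_den b a n)) j
    = (\<Sum>i=0..j. - a n * of_nat (Suc i) * fps_nth (schur_series b a n) i * fps_nth (inverse (schur_den b a n)) (j - i))"
    by (simp add: fps_mult_nth)
  also have "\<dots> = - a n *
     (\<Sum>i=0..j. of_nat (Suc i) * (fps_nth (schur_series b a n) i * fps_nth (inverse (schur_den b a n)) (j - i)))"
    by (simp only: sum_distrib_left mult_ac)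
  finally show ?thesis by (simp add: log_increment_def mult.assoc)
qed

text \<open>
  The weights \<open>-1\<close> and \<open>j + 1 - n\<close> are those of $\overline{\alpha_{n-1-j}}$.  They are preserved by the
  recursion for the coefficients, in which every summand is a product of at most \<open>2 * j + 1\<close> of the
  $\alpha_i$ and their conjugates.
\<close>

lemma trig_poly_schur_series:
  assumes r: "r \<ge> 2"
  shows "n \<le> J \<Longrightarrow> trig_poly r ((2 * j + 1) * Suc J ^ r) (-1) (int j + 1 - int n)
    (\<lambda>y. fps_nth (schur_series 0 (rot_seq lam \<omega> r y) n) j)"
proof (induction n arbitrary: j)
  case 0
  then show ?case by (simp add: trig_poly_0)
next
  case (Suc n)
  define d where "d = Suc J ^ r"
  have n: "n \<le> J" using Suc.prems by simp
  note IH = Suc.IH[OF n, folded d_def]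
  note a = trig_poly_rot_seq[OF r n, of lam \<omega>, folded d_def]
  show ?case unfolding d_def[symmetric]
  proof (induction j rule: less_induct)
    case (less j)
    show ?case
    proof (cases j)
      case 0
      show ?thesis unfolding 0
        by (rule trig_poly_cong[OF r trig_poly_cmult[OF trig_poly_cnj[OF r a], of "-1"]]) (simp_all)
    next
      case (Suc j')
      have t: "trig_poly r ((2 * j + 1) * d) (-1) (int j + 1 - int (Suc n))
        (\<lambda>y. rot_seq lam \<omega> r y n * (fps_nth (schur_series 0 (rot_seq lam \<omega> r y) n) i *
           fps_nth (schur_series 0 (rot_seq lam \<omega> r y) (Suc n)) (j' - i)))" if i: "i \<in> {0..j'}" for i
      proof (rule trig_poly_cong[OF r trig_poly_mult[OF r a trig_poly_mult[OF r IH less.IH]]])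
        show "j' - i < j" using Suc by simp
        show "d + ((2 * i + 1) * d + (2 * (j' - i) + 1) * d) \<le> (2 * j + 1) * d"
        proof -
          have "d + ((2 * i + 1) * d + (2 * (j' - i) + 1) * d) = (1 + (2 * i + 1) + (2 * (j' - i) + 1)) * d"
            by (simp only: distrib_right mult_1)
          also have "1 + (2 * i + 1) + (2 * (j' - i) + 1) = 2 * j + 1" using i Suc by auto
          finally show ?thesis by simp
        qed
      qed (use i Suc in \<open>auto simp: of_nat_diff\<close>)
      have "trig_poly r ((2 * j + 1) * d) (-1) (int j + 1 - int (Suc n))
        (\<lambda>y. fps_nth (schur_series 0 (rot_seq lam \<omega> r y) n) j' + (\<Sum>i=0..j'. rot_seq lam \<omega> r y n *
           (fps_nth (schur_series 0 (rot_seq lam \<omega> r y) n) i * fps_nth (schur_series 0 (rot_seq lam \<omega> r y) (Suc n)) (j' - i))))"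
      proof (intro trig_poly_add trig_poly_sum t)
        show "trig_poly r ((2 * j + 1) * d) (- 1) (int j + 1 - int (Suc n)) (\<lambda>y. fps_nth (schur_series 0 (rot_seq lam \<omega> r y) n) j')"
          by (rule trig_poly_cong[OF r IH[of j']]) (use Suc in auto)
      qed
      then show ?thesis
        by (rule trig_poly_cong[OF r]) (simp_all add: Suc schur_series_nth_Suc sum_distrib_left del: schur_series.simps(2))
    qed
  qed
qed

lemma trig_poly_inverse_schur_den:
  assumes r: "r \<ge> 2" and n: "n \<le> J"
  shows "trig_poly r ((2 * j) * Suc J ^ r) 0 (int j)
    (\<lambda>y. fps_nth (inverse (schur_den 0 (rot_seq lam \<omega> r y) n)) j)"
proof (induction j rule: less_induct)
  case (less j)
  define d where "d = Suc J ^ r"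
  note B = trig_poly_schur_series[OF r n, of _ lam \<omega>, folded d_def]
  note a = trig_poly_rot_seq[OF r n, of lam \<omega>, folded d_def]
  show ?case
  proof (cases j)
    case 0
    then show ?thesis by (intro trig_poly_cong[OF r trig_poly_1[OF r]]) simp_all
  next
    case (Suc j')
    have t: "trig_poly r ((2 * j) * d) 0 (int j)
        (\<lambda>y. rot_seq lam \<omega> r y n * (fps_nth (schur_series 0 (rot_seq lam \<omega> r y) n) i *
           fps_nth (inverse (schur_den 0 (rot_seq lam \<omega> r y) n)) (j' - i)))" if i: "i \<in> {0..j'}" for i
    proof (rule trig_poly_cong[OF r trig_poly_mult[OF r a trig_poly_mult[OF r B less.IH[folded d_def]]]])
      show "j' - i < j" using Suc by simp
      show "d + ((2 * i + 1) * d + (2 * (j' - i)) * d) \<le> (2 * j) * d"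
      proof -
        have "d + ((2 * i + 1) * d + (2 * (j' - i)) * d) = (1 + (2 * i + 1) + (2 * (j' - i))) * d"
          by (simp only: distrib_right mult_1)
        also have "1 + (2 * i + 1) + (2 * (j' - i)) = 2 * j" using i Suc by auto
        finally show ?thesis by simp
      qed
    qed (use i Suc in \<open>auto simp: of_nat_diff\<close>)
    have "trig_poly r ((2 * j) * d) 0 (int j)
        (\<lambda>y. \<Sum>i=0..j'. rot_seq lam \<omega> r y n * (fps_nth (schur_series 0 (rot_seq lam \<omega> r y) n) i *
           fps_nth (inverse (schur_den 0 (rot_seq lam \<omega> r y) n)) (j' - i)))"
      by (intro trig_poly_sum t)
    then show ?thesis unfolding d_def
      by (rule trig_poly_cong[OF r]) (simp_all add: Suc inverse_schur_den_nth_Suc sum_distrib_left)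
  qed
qed

lemma trig_poly_log_increment:
  assumes r: "r \<ge> 2" and n: "n \<le> J"
  shows "trig_poly r ((2 * j) * Suc J ^ r) 0 (int j) (\<lambda>y. fps_nth (log_increment 0 (rot_seq lam \<omega> r y) n) j)"
proof (cases j)
  case 0
  then show ?thesis by (simp add: log_increment_def trig_poly_0)
next
  case (Suc j')
  define d where "d = Suc J ^ r"
  note B = trig_poly_schur_series[OF r n, of _ lam \<omega>, folded d_def]
  note P = trig_poly_inverse_schur_den[OF r n, of _ lam \<omega>, folded d_def]
  note a = trig_poly_rot_seq[OF r n, of lam \<omega>, folded d_def]
  have t: "trig_poly r ((2 * j) * d) 0 (int j)
      (\<lambda>y. rot_seq lam \<omega> r y n * (of_nat (Suc i) * (fps_nth (schur_series 0 (rot_seq lam \<omega> r y) n) i *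
         fps_nth (inverse (schur_den 0 (rot_seq lam \<omega> r y) n)) (j' - i))))" if i: "i \<in> {0..j'}" for i
  proof (rule trig_poly_cong[OF r trig_poly_mult[OF r a trig_poly_cmult[OF trig_poly_mult[OF r B P]]]])
    show "d + ((2 * i + 1) * d + (2 * (j' - i)) * d) \<le> (2 * j) * d"
    proof -
      have "d + ((2 * i + 1) * d + (2 * (j' - i)) * d) = (1 + (2 * i + 1) + (2 * (j' - i))) * d"
        by (simp only: distrib_right mult_1)
      also have "1 + (2 * i + 1) + (2 * (j' - i)) = 2 * j" using i Suc by auto
      finally show ?thesis by simp
    qed
  qed (use i Suc in \<open>auto simp: of_nat_diff\<close>)
  have "trig_poly r ((2 * j) * d) 0 (int j)
      (\<lambda>y. - 1 * (\<Sum>i=0..j'. rot_seq lam \<omega> r y n * (of_nat (Suc i) * (fps_nth (schur_series 0 (rot_seq lam \<omega> r y) n) i *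
         fps_nth (inverse (schur_den 0 (rot_seq lam \<omega> r y) n)) (j' - i)))))"
    by (intro trig_poly_cmult trig_poly_sum t)
  then show ?thesis unfolding d_def
  proof (rule trig_poly_cong[OF r])
    show "fps_nth (log_increment 0 (rot_seq lam \<omega> r y) n) j =
      - 1 * (\<Sum>i=0..j'. rot_seq lam \<omega> r y n * (of_nat (Suc i) * (fps_nth (schur_series 0 (rot_seq lam \<omega> r y) n) i *
         fps_nth (inverse (schur_den 0 (rot_seq lam \<omega> r y) n)) (j' - i))))" for y
      unfolding Suc log_increment_nth_Suc sum_distrib_left[symmetric] by (simp only: mult_minus_left mult_1_left)
  qed simp_all
qed

text \<open>
  The first \<open>j\<close> sites are too close to the start of the box and are estimated trivially.  For the others
  the summand is a bounded trigonometric polynomial along an orbit whose top frequency is \<open>j\<close>.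
\<close>

lemma log_increment_sum_bound:
  fixes \<omega> \<kappa> :: real
  assumes r: "r \<ge> 2" and lam: "cmod lam < 1"
    and kap: "\<kappa> > 0" and dioph: "\<And>q::int. q \<ge> 1 \<Longrightarrow> \<kappa> \<le> (real_of_int q)\<^sup>2 * infdist (real_of_int q * \<omega>) \<int>"
  shows "\<exists>K\<ge>0. \<exists>A::nat. \<exists>c. 0 < c \<and> c \<le> 1/2 \<and>
    (\<forall>Y m M N j. skew_orbit \<omega> Y \<longrightarrow> M \<le> N \<longrightarrow> 1 \<le> N \<longrightarrow> 1 \<le> j \<longrightarrow>
       cmod (\<Sum>n<M. fps_nth (log_increment 0 (\<lambda>i. lam * ee (Y (m + int i) r)) n) j)
         \<le> K * real j ^ A * real N powr (1 - c))"
proof -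
  obtain C A0 c where C: "C \<ge> 0" "0 < c" "c \<le> 1/2"
    and W: "\<And>q u M N. q \<noteq> 0 \<Longrightarrow> weyl_seq \<omega> (r - 2) q u \<Longrightarrow> M \<le> N \<Longrightarrow> 1 \<le> N \<Longrightarrow>
       cmod (\<Sum>n<M. u n) \<le> C * (real_of_int \<bar>q\<bar>) ^ A0 * real N powr (1 - c)"
    using weyl_sum_bound[OF kap dioph, where d = "r - 2"] by blast
  define H where "H = 2 * (\<bar>ln (1 - cmod lam)\<bar> + ln 2 + pi)"
  have H0: "H \<ge> 0" by (simp add: H_def)
  define A where "A = Suc r * r + 1 + A0"
  define K1 where "K1 = 3 ^ r * 2 ^ (Suc r * r) * H * C"
  have K1: "K1 \<ge> 0" using C H0 by (simp add: K1_def)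
  have main: "cmod (\<Sum>n<M. fps_nth (log_increment 0 (\<lambda>i. lam * ee (Y (m + int i) r)) n) j)
         \<le> (H + K1) * real j ^ A * real N powr (1 - c)"
    if Y: "skew_orbit \<omega> Y" and M: "M \<le> N" and N: "1 \<le> N" and j: "1 \<le> j" for Y m M N j
  proof -
    define a where "a i = lam * ee (Y (m + int i) r)" for i
    define f where "f n = fps_nth (log_increment 0 a n) j" for n
    define G where "G y = fps_nth (log_increment 0 (rot_seq lam \<omega> r y) j) j" for y
    have Np: "1 \<le> real N powr (1 - c)" using N C by (intro ge_one_powr_ge_zero) auto
    have f_bound: "cmod (f n) \<le> H * real j" for n
      unfolding f_def H_def using lam by (intro log_increment_coeff_bound) (auto simp: a_def norm_mult)
    have G_bound: "cmod (G y) \<le> H * real j" for y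
      unfolding G_def H_def using lam by (intro log_increment_coeff_bound) auto
    have fG: "f (j + n) = G (Y (m + int n))" for n
    proof -
      have "(\<lambda>i. a (j + n - j + i)) = rot_seq lam \<omega> r (Y (m + int n))"
        by (rule ext) (simp add: a_def rot_seq_orbit[OF Y] add.assoc)
      then show ?thesis unfolding f_def G_def
        using log_increment_local[of j "j + n" 0 a 0] by simp
    qed
    define D where "D = 2 * j * Suc j ^ r"
    have G_trig: "trig_poly r D 0 (int j) G"
      unfolding G_def D_def using trig_poly_log_increment[OF r, of j j j] by simp
    have "cmod (\<Sum>n<M - j. f (j + n)) \<le> (2 * real D + 1) ^ r * (H * real j) * (C * real j ^ A0 * real N powr (1 - c))"
      unfolding fG
    proof (rule trig_poly_orbit_sum[OF r Y G_trig G_bound])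
      fix u assume "weyl_seq \<omega> (r - 2) (int j) u"
      from W[OF _ this, of "M - j" N] show "cmod (\<Sum>n<M - j. u n) \<le> C * real j ^ A0 * real N powr (1 - c)"
        using M N j by simp
    qed
    also have "\<dots> \<le> (3 ^ r * 2 ^ (Suc r * r) * real j ^ (Suc r * r)) * (H * real j) * (C * real j ^ A0 * real N powr (1 - c))"
    proof (intro mult_right_mono)
      have "real D \<le> 2 * real j * (2 * real j) ^ r"
      proof -
        have "real (Suc j) ^ r \<le> (2 * real j) ^ r" using j by (intro power_mono) auto
        then show ?thesis unfolding D_def by (simp add: mult_left_mono del: of_nat_Suc)
      qed
      also have "\<dots> = (2 * real j) ^ Suc r" by simp
      finally have "2 * real D + 1 \<le> 3 * (2 * real j) ^ Suc r"
        using one_le_power[of "2 * real j" "Suc r"] j by simp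
      then have "(2 * real D + 1) ^ r \<le> (3 * (2 * real j) ^ Suc r) ^ r"
        by (intro power_mono) auto
      also have "\<dots> = 3 ^ r * 2 ^ (Suc r * r) * real j ^ (Suc r * r)"
        by (simp only: power_mult_distrib power_mult mult.assoc)
      finally show "(2 * real D + 1) ^ r \<le> 3 ^ r * 2 ^ (Suc r * r) * real j ^ (Suc r * r)" .
    qed (use C H0 in auto)
    also have "\<dots> = K1 * real j ^ A * real N powr (1 - c)"
      by (simp only: K1_def A_def power_add power_one_right mult_ac)
    finally have b2: "cmod (\<Sum>n<M - j. f (j + n)) \<le> K1 * real j ^ A * real N powr (1 - c)" .
    have "cmod (\<Sum>n<min j M. f n) \<le> (\<Sum>n<min j M. H * real j)"
      by (rule sum_norm_le) (rule f_bound)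
    also have "\<dots> = real (min j M) * (H * real j)" by simp
    also have "\<dots> \<le> real j * (H * real j)" using H0 by (intro mult_right_mono) auto
    also have "\<dots> = H * real j ^ 2 * 1" by (simp add: power2_eq_square)
    also have "\<dots> \<le> H * real j ^ A * real N powr (1 - c)"
      using H0 j Np r by (intro mult_mono mult_left_mono power_increasing) (auto simp: A_def)
    finally have b1: "cmod (\<Sum>n<min j M. f n) \<le> H * real j ^ A * real N powr (1 - c)" .
    have "(\<Sum>n<M. f n) = (\<Sum>n<min j M. f n) + (\<Sum>n<M - j. f (j + n))"
    proof (cases "j \<le> M")
      case True
      then show ?thesis using sum.nat_group[of f] sum.lessThan_Suc
        by (simp add: min_def lessThan_atLeast0 sum.atLeastLessThan_concat[of 0 j M, symmetric]
            sum.atLeastLessThan_shift_0[of f j M] add.commute)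
    qed simp
    then have "cmod (\<Sum>n<M. f n) \<le> cmod (\<Sum>n<min j M. f n) + cmod (\<Sum>n<M - j. f (j + n))"
      using norm_triangle_ineq by simp
    with b1 b2 have "cmod (\<Sum>n<M. f n) \<le> (H + K1) * real j ^ A * real N powr (1 - c)"
      by (simp only: distrib_right)
    then show ?thesis by (simp only: f_def a_def[abs_def])
  qed
  have "H + K1 \<ge> 0" using H0 K1 by simp
  with C main show ?thesis by blast
qed

section \<open>Products with controlled power sums\<close>

lemma power_le_fact_exp:
  fixes x :: real
  assumes "0 \<le> x"
  shows "x ^ A \<le> fact A * exp x"
proof -
  have "(\<Sum>n\<in>{A}. x ^ n /\<^sub>R fact n) \<le> (\<Sum>n. x ^ n /\<^sub>R fact n)"
    using assms by (intro sum_le_suminf summable_exp_generic) auto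
  then show ?thesis by (simp add: exp_def field_simps)
qed

text \<open>
  From $x^A \le A!\, e^x$ with $x = \eta j / 2$; half of the geometric decay absorbs the power of \<open>j\<close>.
\<close>

lemma power_geometric_series_bound:
  fixes \<eta> :: real
  assumes \<eta>: "0 < \<eta>" "\<eta> < 1"
  shows "summable (\<lambda>j. real j ^ A * (1 - \<eta>) ^ j)"
    and "(\<Sum>j. real j ^ A * (1 - \<eta>) ^ j) \<le> fact A * 2 ^ (A + 2) / \<eta> ^ (A + 1)"
proof -
  define x where "x = exp (- \<eta> / 2)"
  define B where "B = fact A * (2 / \<eta>) ^ A"
  have x: "0 < x" "x < 1" using \<eta> by (auto simp: x_def)
  have le: "real j ^ A * (1 - \<eta>) ^ j \<le> B * x ^ j" for j
  proof -
    have "(\<eta> * real j / 2) ^ A \<le> fact A * exp (\<eta> * real j / 2)"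
      using \<eta> by (intro power_le_fact_exp) auto
    then have "real j ^ A \<le> B * exp (\<eta> * real j / 2)"
      using \<eta> by (simp add: B_def power_mult_distrib power_divide field_simps)
    moreover have "(1 - \<eta>) ^ j \<le> exp (- \<eta>) ^ j"
      using \<eta> exp_ge_add_one_self[of "- \<eta>"] by (intro power_mono) auto
    ultimately have "real j ^ A * (1 - \<eta>) ^ j \<le> (B * exp (\<eta> * real j / 2)) * exp (- \<eta>) ^ j"
      using \<eta> by (intro mult_mono) (auto simp: B_def)
    also have "\<dots> = B * (exp (\<eta> * real j / 2) * exp (- (\<eta> * real j)))"
      by (simp add: exp_of_nat_mult[symmetric] mult_ac)
    also have "exp (\<eta> * real j / 2) * exp (- (\<eta> * real j)) = x ^ j"
      by (simp add: x_def exp_of_nat_mult[symmetric] exp_add[symmetric] field_simps)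
    finally show ?thesis .
  qed
  have geo: "(\<lambda>j. B * x ^ j) sums (B * (1 / (1 - x)))"
    using x by (intro sums_mult geometric_sums) auto
  show sm: "summable (\<lambda>j. real j ^ A * (1 - \<eta>) ^ j)"
    by (rule summable_comparison_test'[OF sums_summable[OF geo], of 0]) (use \<eta> le in auto)
  have "(\<Sum>j. real j ^ A * (1 - \<eta>) ^ j) \<le> B * (1 / (1 - x))"
    using suminf_le[OF le sm sums_summable[OF geo]] sums_unique[OF geo] by simp
  also have "\<dots> \<le> B * (4 / \<eta>)"
  proof (intro mult_left_mono)
    have "x \<le> 1 / (1 + \<eta> / 2)"
      using exp_ge_add_one_self[of "\<eta> / 2"] \<eta> by (simp add: x_def exp_minus field_simps)
    also have "\<dots> \<le> 1 - \<eta> / 4"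
      using \<eta> by (simp add: field_simps)
    finally have "\<eta> / 4 \<le> 1 - x" by simp
    then show "1 / (1 - x) \<le> 4 / \<eta>" using \<eta> x by (simp add: field_simps)
  qed (use \<eta> in \<open>auto simp: B_def\<close>)
  also have "\<dots> = fact A * 2 ^ (A + 2) / \<eta> ^ (A + 1)"
    using \<eta> by (simp add: B_def power_divide mult_ac)
  finally show "(\<Sum>j. real j ^ A * (1 - \<eta>) ^ j) \<le> fact A * 2 ^ (A + 2) / \<eta> ^ (A + 1)" .
qed

lemma unit_disc_ratio:
  assumes u: "cmod u \<le> 1" and \<rho>: "0 \<le> \<rho>" "\<rho> \<le> 1"
  shows "(1 + \<rho>) * cmod (1 - u) \<le> 2 * cmod (1 - of_real \<rho> * u)"
proof -
  define s c where "s = cmod u" and "c = Re u"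
  have s: "0 \<le> s" "s \<le> 1" and c: "- s \<le> c"
    using u abs_Re_le_cmod[of u] by (auto simp: s_def c_def)
  have n: "(cmod (1 - of_real x * u))\<^sup>2 = 1 - 2 * x * c + x\<^sup>2 * s\<^sup>2" for x
    unfolding s_def c_def cmod_power2 by (simp add: power2_eq_square algebra_simps)
  have "4 * (1 - 2 * \<rho> * c + \<rho>\<^sup>2 * s\<^sup>2) - (1 + \<rho>)\<^sup>2 * (1 - 2 * c + s\<^sup>2)
    = (1 - \<rho>) * ((3 + \<rho>) - s\<^sup>2 * (1 + 3 * \<rho>) + 2 * c * (1 - \<rho>))"
    by (simp add: power2_eq_square algebra_simps)
  also have "\<dots> \<ge> 0"
  proof (intro mult_nonneg_nonneg)
    have "s\<^sup>2 * (1 + 3 * \<rho>) \<le> 1 * (1 + 3 * \<rho>)"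
      using s \<rho> by (intro mult_right_mono) (auto simp: power_le_one)
    moreover have "(-1) * (1 - \<rho>) \<le> c * (1 - \<rho>)" using s c \<rho> by (intro mult_right_mono) auto
    ultimately show "0 \<le> (3 + \<rho>) - s\<^sup>2 * (1 + 3 * \<rho>) + 2 * c * (1 - \<rho>)" by simp
  qed (use \<rho> in auto)
  finally have "((1 + \<rho>) * cmod (1 - u))\<^sup>2 \<le> (2 * cmod (1 - of_real \<rho> * u))\<^sup>2"
    using n[of 1] n[of \<rho>] by (simp add: power_mult_distrib)
  then show ?thesis by (rule power2_le_imp_le) simp
qed

text \<open>
  The product over $1 - u_i z$
  on the unit circle is compared with its value at radius \<open>1 - \<eta>\<close>, where the power sums control it.
\<close>

locale power_sum_control =
  fixes u :: "nat \<Rightarrow> complex" and n :: nat and K :: real and A :: nat and \<eta> :: real and z :: complex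
  assumes u: "\<And>i. i < n \<Longrightarrow> cmod (u i) \<le> 1"
    and K: "\<And>j. j \<ge> 1 \<Longrightarrow> cmod (\<Sum>i<n. u i ^ j) \<le> K * real j ^ A"
    and \<eta>: "0 < \<eta>" "\<eta> < 1"
    and z: "cmod z = 1"
begin

definition m :: real where "m = K * (fact A * 2 ^ (A + 2) / \<eta> ^ (A + 1))"

definition v :: "nat \<Rightarrow> complex" where "v i = of_real (1 - \<eta>) * (u i * z)"

lemma K0: "K \<ge> 0"
  using order_trans[OF norm_ge_zero K[of 1]] by simp

lemma radius_norm: "cmod (of_real (1 - \<eta>)) = 1 - \<eta>"
  unfolding norm_of_real using \<eta> by simp

lemma v_norm: "i < n \<Longrightarrow> cmod (v i) \<le> 1 - \<eta>"
proof -
  assume "i < n"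
  then have "cmod (v i) = (1 - \<eta>) * cmod (u i)" unfolding v_def norm_mult radius_norm z by simp
  also have "\<dots> \<le> (1 - \<eta>) * 1" using \<eta> u[OF \<open>i < n\<close>] by (intro mult_left_mono) auto
  finally show ?thesis by simp
qed

lemma v_less: "i < n \<Longrightarrow> cmod (v i) < 1"
  using v_norm[of i] \<eta> by simp

lemma v_dist: "i < n \<Longrightarrow> \<eta> \<le> cmod (1 - v i)"
  using v_norm[of i] norm_triangle_ineq2[of 1 "v i"] by simp

lemma v_powers: "j \<ge> 1 \<Longrightarrow> cmod (\<Sum>i<n. v i ^ j) \<le> K * (real j ^ A * (1 - \<eta>) ^ j)"
proof -
  assume j: "j \<ge> 1"
  have "(\<Sum>i<n. v i ^ j) = (of_real (1 - \<eta>) * z) ^ j * (\<Sum>i<n. u i ^ j)"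
    by (simp add: v_def power_mult_distrib sum_distrib_left mult_ac)
  then have "cmod (\<Sum>i<n. v i ^ j) = (1 - \<eta>) ^ j * cmod (\<Sum>i<n. u i ^ j)"
    by (simp only: norm_mult norm_power radius_norm z mult_1_right)
  also have "\<dots> \<le> (1 - \<eta>) ^ j * (K * real j ^ A)" using K[OF j] \<eta> by (intro mult_left_mono) auto
  finally show ?thesis by (simp add: mult_ac)
qed

lemma series_bound:
  assumes f: "f sums s" and le: "\<And>j. \<bar>f j\<bar> \<le> K * (real j ^ A * (1 - \<eta>) ^ j)"
  shows "\<bar>s\<bar> \<le> m"
proof -
  have sm: "summable (\<lambda>j. K * (real j ^ A * (1 - \<eta>) ^ j))"
    by (intro summable_mult power_geometric_series_bound \<eta>)
  have "\<bar>suminf f\<bar> \<le> (\<Sum>j. K * (real j ^ A * (1 - \<eta>) ^ j))"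
    using norm_suminf_le[of f, OF _ sm] le by simp
  also have "\<dots> = K * (\<Sum>j. real j ^ A * (1 - \<eta>) ^ j)"
    by (intro suminf_mult power_geometric_series_bound \<eta>)
  also have "\<dots> \<le> m" unfolding m_def
    by (intro mult_left_mono power_geometric_series_bound \<eta> K0)
  finally show ?thesis using sums_unique[OF f] by simp
qed

text \<open>
  The logarithm is the series of the power sums with weights $-(1-\eta)^j z^j / j$.
\<close>

lemma inner_product_bound: "\<bar>\<Sum>i<n. ln (cmod (1 - v i))\<bar> \<le> m"
proof -
  have "(\<lambda>j. - (v i ^ j) / of_nat j) sums ln (1 - v i)" if "i < n" for i
    using Ln_series'[of "- v i"] v_less[OF that] by simp
  then have "(\<lambda>j. Re (- (v i ^ j) / of_nat j)) sums ln (cmod (1 - v i))" if "i < n" for i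
  proof -
    have "1 - v i \<noteq> 0" using v_dist[OF that] \<eta> by auto
    then show ?thesis using sums_Re[OF \<open>i < n \<Longrightarrow> _\<close>[OF that]] by simp
  qed
  then have "(\<lambda>j. \<Sum>i<n. Re (- (v i ^ j) / of_nat j)) sums (\<Sum>i<n. ln (cmod (1 - v i)))"
    by (intro sums_sum) auto
  moreover have "(\<Sum>i<n. Re (- (v i ^ j) / of_nat j)) = Re (- (\<Sum>i<n. v i ^ j) / of_nat j)" for j
    by (simp add: sum_negf sum_divide_distrib)
  ultimately have s: "(\<lambda>j. Re (- (\<Sum>i<n. v i ^ j) / of_nat j)) sums (\<Sum>i<n. ln (cmod (1 - v i)))"
    by simp
  show ?thesis
  proof (rule series_bound[OF s])
    fix j
    show "\<bar>Re (- (\<Sum>i<n. v i ^ j) / of_nat j)\<bar> \<le> K * (real j ^ A * (1 - \<eta>) ^ j)"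
    proof (cases "j = 0")
      case True
      then show ?thesis using K0 by simp
    next
      case False
      have "\<bar>Re (- (\<Sum>i<n. v i ^ j) / of_nat j)\<bar> \<le> cmod (- (\<Sum>i<n. v i ^ j) / of_nat j)"
        by (rule abs_Re_le_cmod)
      also have "\<dots> = cmod (\<Sum>i<n. v i ^ j) / real j" by (simp add: norm_divide)
      also have "\<dots> \<le> cmod (\<Sum>i<n. v i ^ j) / 1" using False by (intro divide_left_mono) auto
      also have "\<dots> \<le> K * (real j ^ A * (1 - \<eta>) ^ j)" using v_powers[of j] False by simp
      finally show ?thesis .
    qed
  qed
qed

definition q :: "nat \<Rightarrow> real" where "q i = \<eta> / cmod (1 - v i)"

text \<open>
  The real part of $(1 + v)/(1 - v)$ is the Poisson kernel $(1 - |v|^2)/|1 - v|^2$, and its sum is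
  again expressed by power sums.  The bound says that only a small proportion of the $u_i z$ can be
  within distance \<open>\<eta>\<close> of one.
\<close>

lemma poisson_sum_bound: "(\<Sum>i<n. (q i)\<^sup>2) \<le> \<eta> * (real n + 2 * m)"
proof -
  have each: "(\<lambda>j. Re (v i ^ Suc j)) sums (Re (1 / (1 - v i)) - 1)" if "i < n" for i
  proof -
    have "(\<lambda>j. v i ^ j) sums (1 / (1 - v i))" using v_less[OF that] by (rule geometric_sums)
    then have "(\<lambda>j. v i ^ Suc j) sums (1 / (1 - v i) - 1)" by (subst sums_Suc_iff) simp
    then show ?thesis using sums_Re by fastforce
  qed
  have s: "(\<lambda>j. Re (\<Sum>i<n. v i ^ Suc j)) sums (\<Sum>i<n. Re (1 / (1 - v i)) - 1)"
    using sums_sum[of "{..<n}" "\<lambda>i j. Re (v i ^ Suc j)", OF each] by simp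
  define f where "f j = (if j = 0 then 0 else Re (\<Sum>i<n. v i ^ j))" for j
  have "(\<lambda>j. f (Suc j)) sums (\<Sum>i<n. Re (1 / (1 - v i)) - 1)" using s by (simp add: f_def)
  then have fs: "f sums (\<Sum>i<n. Re (1 / (1 - v i)) - 1)" by (subst (asm) sums_Suc_iff) (simp add: f_def)
  have "\<bar>\<Sum>i<n. Re (1 / (1 - v i)) - 1\<bar> \<le> m"
  proof (rule series_bound[OF fs])
    fix j show "\<bar>f j\<bar> \<le> K * (real j ^ A * (1 - \<eta>) ^ j)"
      using v_powers[of j] K0 abs_Re_le_cmod[of "\<Sum>i<n. v i ^ j"] \<eta> by (cases "j = 0") (auto simp: f_def)
  qed
  then have b: "(\<Sum>i<n. 2 * (Re (1 / (1 - v i)) - 1) + 1) \<le> real n + 2 * m"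
  proof -
    have "(\<Sum>i<n. 2 * (Re (1 / (1 - v i)) - 1) + 1) = 2 * (\<Sum>i<n. Re (1 / (1 - v i)) - 1) + real n"
      by (simp only: sum.distrib sum_distrib_left) simp
    with \<open>\<bar>\<Sum>i<n. Re (1 / (1 - v i)) - 1\<bar> \<le> m\<close> show ?thesis by linarith
  qed
  have "(q i)\<^sup>2 \<le> \<eta> * (2 * (Re (1 / (1 - v i)) - 1) + 1)" if i: "i < n" for i
  proof -
    define w where "w = 1 - v i"
    have w: "0 < (cmod w)\<^sup>2" using v_dist[OF i] \<eta> by (auto simp: w_def)
    have wn: "(cmod w)\<^sup>2 = 1 - 2 * Re (v i) + (cmod (v i))\<^sup>2"
      unfolding w_def cmod_power2 by (simp add: power2_eq_square algebra_simps)
    have "(cmod (v i))\<^sup>2 \<le> (1 - \<eta>)\<^sup>2" using v_norm[OF i] by (intro power_mono) auto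
    also have "(1 - \<eta>)\<^sup>2 \<le> 1 - \<eta>" using \<eta> by (simp add: power2_eq_square mult_left_le)
    finally have ve: "\<eta> \<le> 1 - (cmod (v i))\<^sup>2" by simp
    have "2 * (Re (1 / w) - 1) + 1 = 2 * (Re w / (cmod w)\<^sup>2) - 1"
      by (simp add: Re_divide cmod_power2)
    also have "\<dots> = (2 * Re w - (cmod w)\<^sup>2) / (cmod w)\<^sup>2" using w by (simp add: field_simps)
    also have "2 * Re w - (cmod w)\<^sup>2 = 1 - (cmod (v i))\<^sup>2" unfolding wn by (simp add: w_def)
    finally have eq: "2 * (Re (1 / w) - 1) + 1 = (1 - (cmod (v i))\<^sup>2) / (cmod w)\<^sup>2" .
    have "(q i)\<^sup>2 = \<eta> * (\<eta> / (cmod w)\<^sup>2)" by (simp add: q_def w_def power_divide power2_eq_square)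
    also have "\<dots> \<le> \<eta> * ((1 - (cmod (v i))\<^sup>2) / (cmod w)\<^sup>2)"
      using \<eta> ve w by (intro mult_left_mono divide_right_mono) auto
    finally show ?thesis using eq by (simp add: w_def)
  qed
  then have "(\<Sum>i<n. (q i)\<^sup>2) \<le> (\<Sum>i<n. \<eta> * (2 * (Re (1 / (1 - v i)) - 1) + 1))"
    by (intro sum_mono) auto
  also have "\<dots> = \<eta> * (\<Sum>i<n. 2 * (Re (1 / (1 - v i)) - 1) + 1)" by (simp add: sum_distrib_left)
  also have "\<dots> \<le> \<eta> * (real n + 2 * m)" using b \<eta> by (intro mult_left_mono) auto
  finally show ?thesis .
qed

lemma inner_product_exp:
  "cmod (\<Prod>i<n. 1 - v i) = exp (\<Sum>i<n. ln (cmod (1 - v i)))"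
proof -
  have "cmod (1 - v i) = exp (ln (cmod (1 - v i)))" if "i < n" for i
  proof -
    have "0 < cmod (1 - v i)" using v_dist[OF that] \<eta> by linarith
    then show ?thesis by (simp only: exp_ln)
  qed
  then show ?thesis by (simp add: prod_norm[symmetric] exp_sum)
qed

lemma product_upper_bound: "cmod (\<Prod>i<n. 1 - u i * z) \<le> exp (\<eta> * real n + m)"
proof -
  have e: "exp (- \<eta>) * 1 \<le> 1 - \<eta> / 2"
  proof -
    have "exp (- \<eta>) \<le> 1 / (1 + \<eta>)"
      using exp_ge_add_one_self[of \<eta>] \<eta> by (simp add: exp_minus field_simps)
    also have "\<dots> \<le> 1 - \<eta> / 2" using \<eta> by (simp add: field_simps)
    finally show ?thesis by simp
  qed
  have "cmod (1 - u i * z) \<le> exp \<eta> * cmod (1 - v i)" if i: "i < n" for i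
  proof -
    have "(1 + (1 - \<eta>)) * cmod (1 - u i * z) \<le> 2 * cmod (1 - of_real (1 - \<eta>) * (u i * z))"
      using u[OF i] z \<eta> by (intro unit_disc_ratio) (auto simp: norm_mult)
    then have "(1 - \<eta> / 2) * cmod (1 - u i * z) \<le> cmod (1 - v i)"
      by (simp add: v_def algebra_simps)
    then have "exp (- \<eta>) * cmod (1 - u i * z) \<le> cmod (1 - v i)"
      using mult_right_mono[OF e, of "cmod (1 - u i * z)"] by simp
    then show ?thesis by (simp add: exp_minus field_simps)
  qed
  then have "(\<Prod>i<n. cmod (1 - u i * z)) \<le> (\<Prod>i<n. exp \<eta> * cmod (1 - v i))"
    by (intro prod_mono) auto
  also have "\<dots> = exp (\<eta> * real n) * cmod (\<Prod>i<n. 1 - v i)"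
    by (simp add: prod.distrib prod_norm exp_of_nat2_mult)
  also have "\<dots> \<le> exp (\<eta> * real n) * exp m"
    unfolding inner_product_exp using inner_product_bound by (intro mult_left_mono) auto
  finally show ?thesis by (simp add: prod_norm exp_add)
qed

text \<open>
  Moving from radius \<open>1 - \<eta>\<close> to the circle changes the factor \<open>i\<close> by a ratio of at least \<open>1 - q i\<close>.  Factors with
  \<open>q i \<le> 1/2\<close> lose \<open>2 * q i\<close>, and these losses are summed by Cauchy-Schwarz.  The others are few by
  \<open>poisson_sum_bound\<close>, and each loses at most the logarithm of \<open>2 / \<epsilon>\<close>.
\<close>

lemma product_lower_bound:
  assumes \<epsilon>: "0 < \<epsilon>" "\<epsilon> \<le> 1" and sep: "\<And>i. i < n \<Longrightarrow> \<epsilon> \<le> cmod (1 - u i * z)"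
  shows "exp (- (m + 2 * sqrt (real n * (\<eta> * (real n + 2 * m)))
           + 4 * (\<eta> * (real n + 2 * m)) * ln (2 / \<epsilon>))) \<le> cmod (\<Prod>i<n. 1 - u i * z)"
proof -
  have l0: "0 \<le> ln (2 / \<epsilon>)" using \<epsilon> by (intro ln_ge_zero) (auto simp: field_simps)
  have fac: "ln (cmod (1 - v i)) - 2 * q i - 4 * (q i)\<^sup>2 * ln (2 / \<epsilon>) \<le> ln (cmod (1 - u i * z))"
    if i: "i < n" for i
  proof -
    have d: "0 < cmod (1 - v i)" using v_dist[OF i] \<eta> by linarith
    have q0: "0 \<le> q i" using \<eta> by (simp add: q_def)
    have s: "0 < cmod (1 - u i * z)" using sep[OF i] \<epsilon> by linarith
    show ?thesis
    proof (cases "q i \<le> 1/2")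
      case True
      have "cmod (1 - v i) - \<eta> \<le> cmod (1 - u i * z)"
      proof -
        have "1 - v i = (1 - u i * z) + of_real \<eta> * (u i * z)" by (simp add: v_def algebra_simps)
        then have "cmod (1 - v i) \<le> cmod (1 - u i * z) + cmod (of_real \<eta> * (u i * z))"
          by (metis norm_triangle_ineq)
        also have "cmod (of_real \<eta> * (u i * z)) \<le> \<eta> * 1"
          unfolding norm_mult using \<eta> z u[OF i] by (simp add: mult_left_le)
        finally show ?thesis by simp
      qed
      then have "cmod (1 - v i) * (1 - q i) \<le> cmod (1 - u i * z)"
      proof -
        have "cmod (1 - v i) * (1 - q i) = cmod (1 - v i) - \<eta>"
          using d unfolding q_def by (simp add: right_diff_distrib)
        with \<open>cmod (1 - v i) - \<eta> \<le> cmod (1 - u i * z)\<close> show ?thesis by simp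
      qed
      moreover have "exp (- 2 * q i) \<le> 1 - q i"
      proof -
        have "exp (- 2 * q i) \<le> 1 / (1 + 2 * q i)"
          using exp_ge_add_one_self[of "2 * q i"] q0 by (simp add: exp_minus field_simps)
        also have "\<dots> \<le> 1 - q i"
        proof -
          have "q i * q i \<le> q i * (1/2)" using True q0 by (intro mult_left_mono)
          then show ?thesis using q0 by (simp add: field_simps)
        qed
        finally show ?thesis .
      qed
      ultimately have "cmod (1 - v i) * exp (- 2 * q i) \<le> cmod (1 - u i * z)"
        using d mult_left_mono[of "exp (- 2 * q i)" "1 - q i" "cmod (1 - v i)"] by linarith
      then have "ln (cmod (1 - v i) * exp (- 2 * q i)) \<le> ln (cmod (1 - u i * z))"
        using d s by (subst ln_le_cancel_iff) auto
      then have "ln (cmod (1 - v i)) - 2 * q i \<le> ln (cmod (1 - u i * z))"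
        using d by (simp add: ln_mult)
      moreover have "0 \<le> 4 * (q i)\<^sup>2 * ln (2 / \<epsilon>)" using l0 by simp
      ultimately show ?thesis by linarith
    next
      case False
      have "(1/2)\<^sup>2 \<le> (q i)\<^sup>2" using False by (intro power_mono) auto
      then have "1 * ln (2 / \<epsilon>) \<le> 4 * (q i)\<^sup>2 * ln (2 / \<epsilon>)"
        using l0 by (intro mult_right_mono) (auto simp: power2_eq_square)
      moreover have "ln (cmod (1 - v i)) \<le> ln 2"
        using d v_less[OF i] norm_triangle_ineq4[of 1 "v i"] by (subst ln_le_cancel_iff) auto
      moreover have "ln \<epsilon> \<le> ln (cmod (1 - u i * z))" using sep[OF i] \<epsilon> s by (subst ln_le_cancel_iff) auto
      moreover have "ln (2 / \<epsilon>) = ln 2 - ln \<epsilon>" using \<epsilon> by (simp add: ln_div)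
      ultimately show ?thesis using q0 by linarith
    qed
  qed
  have sq: "(\<Sum>i<n. q i) \<le> sqrt (real n * (\<eta> * (real n + 2 * m)))"
  proof (rule real_le_rsqrt)
    have "(\<Sum>i<n. q i)\<^sup>2 \<le> real n * (\<Sum>i<n. (q i)\<^sup>2)"
      using Cauchy_Schwarz_ineq_sum[of "\<lambda>_. 1" q "{..<n}"] by simp
    also have "\<dots> \<le> real n * (\<eta> * (real n + 2 * m))"
      by (intro mult_left_mono poisson_sum_bound) auto
    finally show "(\<Sum>i<n. q i)\<^sup>2 \<le> real n * (\<eta> * (real n + 2 * m))" .
  qed
  have "(\<Sum>i<n. ln (cmod (1 - v i))) - 2 * (\<Sum>i<n. q i) - 4 * (\<Sum>i<n. (q i)\<^sup>2) * ln (2 / \<epsilon>)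
     = (\<Sum>i<n. ln (cmod (1 - v i)) - 2 * q i - 4 * (q i)\<^sup>2 * ln (2 / \<epsilon>))"
    by (simp add: sum_subtractf sum_distrib_left sum_distrib_right)
  also have "\<dots> \<le> (\<Sum>i<n. ln (cmod (1 - u i * z)))" by (intro sum_mono fac) auto
  finally have "- (m + 2 * sqrt (real n * (\<eta> * (real n + 2 * m))) + 4 * (\<eta> * (real n + 2 * m)) * ln (2 / \<epsilon>))
      \<le> (\<Sum>i<n. ln (cmod (1 - u i * z)))"
    using sq inner_product_bound mult_right_mono[OF poisson_sum_bound l0] by (simp add: mult.assoc)
  moreover have "cmod (\<Prod>i<n. 1 - u i * z) = exp (\<Sum>i<n. ln (cmod (1 - u i * z)))"
  proof -
    have "cmod (1 - u i * z) = exp (ln (cmod (1 - u i * z)))" if "i < n" for i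
    proof -
      have "0 < cmod (1 - u i * z)" using sep[OF that] \<epsilon> by linarith
      then show ?thesis by (simp only: exp_ln)
    qed
    then show ?thesis by (simp add: prod_norm[symmetric] exp_sum)
  qed
  ultimately show ?thesis by simp
qed

end

section \<open>Szego polynomials and their zeros\<close>

primrec szego :: "(nat \<Rightarrow> complex) \<Rightarrow> complex \<Rightarrow> complex \<times> complex \<Rightarrow> nat \<Rightarrow> complex \<times> complex" where
  "szego a z v 0 = v"
| "szego a z v (Suc n) =
     (z * fst (szego a z v n) - cnj (a n) * snd (szego a z v n),
      snd (szego a z v n) - a n * (z * fst (szego a z v n)))"

text \<open>
  On the unit circle the second row of the transfer matrix determines the first, by
  \<open>szego_conjugate\<close> below; its second entry is a polynomial in \<open>z\<close> with value one at zero.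
\<close>

definition q0 :: "(nat \<Rightarrow> complex) \<Rightarrow> complex \<Rightarrow> nat \<Rightarrow> complex" where
  "q0 a z n = snd (szego a z (0, 1) n)"

definition q1 :: "(nat \<Rightarrow> complex) \<Rightarrow> complex \<Rightarrow> nat \<Rightarrow> complex" where
  "q1 a z n = snd (szego a z (1, 0) n)"

lemma szego_linear:
  "fst (szego a z (p, r) n) = p * fst (szego a z (1, 0) n) + r * fst (szego a z (0, 1) n)"
  "snd (szego a z (p, r) n) = p * q1 a z n + r * q0 a z n"
  by (induction n) (simp_all add: q0_def q1_def algebra_simps)

text \<open>
  For unimodular \<open>z\<close> each Szego matrix has the form with rows $(z \bar d, z \bar c)$ and $(c, d)$, and products
  keep this form with $z^n$ in place of \<open>z\<close>.
\<close>

lemma szego_conjugate: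
  assumes "cmod z = 1"
  shows "fst (szego a z (1, 0) n) = z ^ n * cnj (q0 a z n)"
    and "fst (szego a z (0, 1) n) = z ^ n * cnj (q1 a z n)"
proof -
  have zz: "z * cnj z = 1" using assms complex_norm_square[of z] by simp
  have "fst (szego a z (1, 0) n) = z ^ n * cnj (q0 a z n) \<and> fst (szego a z (0, 1) n) = z ^ n * cnj (q1 a z n)
      \<and> z ^ n * cnj (fst (szego a z (1, 0) n)) = q0 a z n \<and> z ^ n * cnj (fst (szego a z (0, 1) n)) = q1 a z n"
  proof (induction n)
    case 0
    then show ?case by (simp add: q0_def q1_def)
  next
    case (Suc n)
    have r1: "z ^ Suc n * cnj (z * p - cnj (a n) * r) = (z * cnj z) * (z ^ n * cnj p) - a n * (z * (z ^ n * cnj r))" for p r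
      by (simp add: algebra_simps)
    have r2: "z ^ Suc n * cnj (r - a n * (z * p)) = z * (z ^ n * cnj r) - cnj (a n) * ((z * cnj z) * (z ^ n * cnj p))" for p r
      by (simp add: algebra_simps)
    define P1 R1 P0 R0 where "P1 = fst (szego a z (1, 0) n)" and "R1 = snd (szego a z (1, 0) n)"
      and "P0 = fst (szego a z (0, 1) n)" and "R0 = snd (szego a z (0, 1) n)"
    have IH: "z ^ n * cnj R0 = P1" "z ^ n * cnj R1 = P0" "z ^ n * cnj P1 = R0" "z ^ n * cnj P0 = R1"
      using Suc by (auto simp only: q0_def q1_def P1_def R1_def P0_def R0_def)
    show ?case
      unfolding q0_def q1_def szego.simps fst_conv snd_conv
        P1_def[symmetric] R1_def[symmetric] P0_def[symmetric] R0_def[symmetric] r1 r2 zz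
      by (simp only: IH mult_1_left)
  qed
  then show "fst (szego a z (1, 0) n) = z ^ n * cnj (q0 a z n)"
    "fst (szego a z (0, 1) n) = z ^ n * cnj (q1 a z n)" by auto
qed

lemma szego_det:
  "fst (szego a z (1, 0) n) * q0 a z n - fst (szego a z (0, 1) n) * q1 a z n = z ^ n * (\<Prod>i<n. 1 - of_real ((cmod (a i))\<^sup>2))"
proof (induction n)
  case 0
  then show ?case by (simp add: q0_def q1_def)
next
  case (Suc n)
  have step: "(z * p - ac * r) * (r' - an * (z * p')) - (z * p' - ac * r') * (r - an * (z * p)) = z * (1 - an * ac) * (p * r' - p' * r)"
    for p r p' r' ac an :: complex by (simp add: algebra_simps)
  show ?case
    unfolding q0_def q1_def szego.simps fst_conv snd_conv step Suc[unfolded q0_def q1_def]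
    by (simp only: complex_norm_square power_Suc prod.lessThan_Suc mult_ac)
qed

text \<open>
  The determinant of the transfer matrix, rewritten by \<open>szego_conjugate\<close>.
\<close>

lemma q0_q1_norms:
  assumes z: "cmod z = 1" and a: "\<And>i. i < n \<Longrightarrow> (cmod (a i))\<^sup>2 = 1 - \<rho>\<^sup>2"
  shows "(cmod (q0 a z n))\<^sup>2 - (cmod (q1 a z n))\<^sup>2 = (\<rho> ^ n)\<^sup>2"
proof -
  have "(\<Prod>i<n. 1 - complex_of_real ((cmod (a i))\<^sup>2)) = (\<Prod>i<n. of_real (\<rho>\<^sup>2))"
    by (intro prod.cong refl) (simp add: a)
  also have "\<dots> = of_real ((\<rho> ^ n)\<^sup>2)" by (simp add: power_mult[symmetric] mult.commute)
  finally have "z ^ n * (cnj (q0 a z n) * q0 a z n - cnj (q1 a z n) * q1 a z n) = z ^ n * of_real ((\<rho> ^ n)\<^sup>2)"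
    using szego_det[of a z n] unfolding szego_conjugate[OF z] by (simp add: algebra_simps)
  moreover have "z ^ n \<noteq> 0" using z by auto
  ultimately have "cnj (q0 a z n) * q0 a z n - cnj (q1 a z n) * q1 a z n = of_real ((\<rho> ^ n)\<^sup>2)"
    by (simp only: mult_cancel_left) simp
  then have "complex_of_real ((cmod (q0 a z n))\<^sup>2 - (cmod (q1 a z n))\<^sup>2) = of_real ((\<rho> ^ n)\<^sup>2)"
    by (simp only: of_real_diff complex_norm_square mult.commute[of "cnj _"])
  then show ?thesis by (simp only: of_real_eq_iff)
qed

text \<open>
  Rotating the coefficients by $w W^i$ is a diagonal change of basis in the recursion, up to
  replacing \<open>z\<close> by \<open>z * W\<close>.
\<close>

lemma szego_gauge:
  assumes w: "cmod w = 1" and W: "cmod W = 1" and init: "w * p = W * p'"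
  shows "w * W ^ n * fst (szego (\<lambda>i. c i * (w * W ^ i)) z (p, r) n) = W * fst (szego c (z * W) (p', r) n)
    \<and> snd (szego (\<lambda>i. c i * (w * W ^ i)) z (p, r) n) = snd (szego c (z * W) (p', r) n)"
proof (induction n)
  case 0
  then show ?case using init by simp
next
  case (Suc n)
  define P R P' R' where "P = fst (szego (\<lambda>i. c i * (w * W ^ i)) z (p, r) n)"
    and "R = snd (szego (\<lambda>i. c i * (w * W ^ i)) z (p, r) n)"
    and "P' = fst (szego c (z * W) (p', r) n)" and "R' = snd (szego c (z * W) (p', r) n)"
  have IH: "w * W ^ n * P = W * P'" "R = R'" using Suc by (auto simp: P_def R_def P'_def R'_def)
  have ww: "w * cnj w = 1" using w complex_norm_square[of w] by simp
  have WW: "W ^ n * cnj W ^ n = 1"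
    using W complex_norm_square[of W] by (simp add: power_mult_distrib[symmetric])
  have "w * W ^ Suc n * (z * P - cnj (c n * (w * W ^ n)) * R)
     = W * (z * (w * W ^ n * P) - cnj (c n) * ((w * cnj w) * (W ^ n * cnj W ^ n)) * R)"
    by (simp add: algebra_simps)
  also have "\<dots> = W * (z * W * P' - cnj (c n) * R')" unfolding ww WW IH by (simp add: algebra_simps)
  finally have 1: "w * W ^ Suc n * (z * P - cnj (c n * (w * W ^ n)) * R) = W * (z * W * P' - cnj (c n) * R')" .
  have "R - c n * (w * W ^ n) * (z * P) = R - c n * z * (w * W ^ n * P)" by (simp add: algebra_simps)
  also have "\<dots> = R' - c n * (z * W * P')" unfolding IH by (simp add: algebra_simps)
  finally show ?case using 1 unfolding szego.simps fst_conv snd_conv P_def R_def P'_def R'_def by simp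
qed

lemma q0_gauge:
  assumes "cmod w = 1" "cmod W = 1"
  shows "q0 (\<lambda>i. c i * (w * W ^ i)) z n = q0 c (z * W) n"
  using szego_gauge[OF assms, of 0 0] by (simp add: q0_def)

lemma q1_gauge:
  assumes "cmod w = 1"
  shows "q1 (\<lambda>i. c i * w) z n = w * q1 c z n"
  using szego_gauge[OF assms, of 1 1 w n c z 0] szego_linear(2)[of c z w 0 n] by (simp add: q1_def)

primrec szego_poly :: "(nat \<Rightarrow> complex) \<Rightarrow> nat \<Rightarrow> complex poly \<times> complex poly" where
  "szego_poly a 0 = (0, 1)"
| "szego_poly a (Suc n) =
     (pCons 0 (fst (szego_poly a n)) - Polynomial.smult (cnj (a n)) (snd (szego_poly a n)),
      snd (szego_poly a n) - Polynomial.smult (a n) (pCons 0 (fst (szego_poly a n))))"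

definition ppoly :: "(nat \<Rightarrow> complex) \<Rightarrow> nat \<Rightarrow> complex poly" where "ppoly a n = fst (szego_poly a n)"
definition rpoly :: "(nat \<Rightarrow> complex) \<Rightarrow> nat \<Rightarrow> complex poly" where "rpoly a n = snd (szego_poly a n)"

lemma ppoly_rpoly_simps [simp]:
  "ppoly a 0 = 0" "rpoly a 0 = 1"
  "ppoly a (Suc n) = pCons 0 (ppoly a n) - Polynomial.smult (cnj (a n)) (rpoly a n)"
  "rpoly a (Suc n) = rpoly a n - Polynomial.smult (a n) (pCons 0 (ppoly a n))"
  by (simp_all add: ppoly_def rpoly_def)

lemma poly_szego:
  "poly (ppoly a n) z = fst (szego a z (0, 1) n) \<and> poly (rpoly a n) z = q0 a z n"
  by (induction n) (simp_all add: q0_def)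

lemma degree_szego: "degree (ppoly a n) \<le> n \<and> degree (rpoly a n) \<le> n"
proof (induction n)
  case (Suc n)
  have "degree (pCons 0 (ppoly a n)) \<le> Suc n" using Suc degree_pCons_le[of 0 "ppoly a n"] by linarith
  moreover have "degree (Polynomial.smult c (rpoly a n)) \<le> Suc n" for c
    using Suc degree_smult_le[of c "rpoly a n"] by linarith
  moreover have "degree (Polynomial.smult c (pCons 0 (ppoly a n))) \<le> Suc n" for c
    using calculation(1) degree_smult_le order_trans by blast
  ultimately show ?case using Suc by (auto intro!: degree_diff_le)
qed simp

lemma rpoly_coeff_0: "coeff (rpoly a n) 0 = 1"
  by (induction n) (simp_all)

text \<open>
  The second equation is a telescoping product, which turns the logarithmic derivative of \<open>rpoly\<close> into a
  sum over the sites.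
\<close>

lemma fps_szego:
  "fps_of_poly (ppoly a n) = schur_series 0 a n * fps_of_poly (rpoly a n) \<and>
   fps_of_poly (rpoly a (Suc n)) = fps_of_poly (rpoly a n) * schur_den 0 a n"
proof (induction n)
  case 0
  then show ?case by (simp add: schur_den_def)
next
  case (Suc n)
  define B R D where "B = schur_series 0 a n" and "R = fps_of_poly (rpoly a n)" and "D = schur_den 0 a n"
  have IH: "fps_of_poly (ppoly a n) = B * R" "fps_of_poly (rpoly a (Suc n)) = R * D"
    using Suc by (simp_all add: B_def R_def D_def)
  have "fps_of_poly (ppoly a (Suc n)) = fps_X * (B * R) - fps_const (cnj (a n)) * R"
    by (simp add: fps_of_poly_pCons fps_of_poly_diff fps_of_poly_smult IH R_def)
  also have "\<dots> = (fps_X * B - fps_const (cnj (a n))) * R * (D * inverse D)"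
    unfolding D_def schur_den_inverse by (simp add: algebra_simps)
  also have "\<dots> = schur_series 0 a (Suc n) * (R * D)" unfolding schur_series_Suc B_def D_def by (simp only: mult_ac)
  finally have 1: "fps_of_poly (ppoly a (Suc n)) = schur_series 0 a (Suc n) * fps_of_poly (rpoly a (Suc n))"
    by (simp only: IH)
  have "fps_of_poly (rpoly a (Suc (Suc n))) = fps_of_poly (rpoly a (Suc n)) -
     fps_const (a (Suc n)) * (fps_X * fps_of_poly (ppoly a (Suc n)))"
    by (simp only: ppoly_rpoly_simps(4)[of a "Suc n"] fps_of_poly_diff fps_of_poly_smult fps_of_poly_pCons) simp
  also have "\<dots> = fps_of_poly (rpoly a (Suc n)) * schur_den 0 a (Suc n)"
    unfolding 1 schur_den_def by (simp add: right_diff_distrib mult_ac del: schur_series.simps ppoly_rpoly_simps)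
  finally show ?case using 1 by blast
qed

lemma q0_nonzero:
  assumes a: "\<And>n. cmod (a n) \<le> L" and L: "L < 1" and z: "cmod z \<le> 1"
  shows "q0 a z n \<noteq> 0"
proof -
  have "fst (szego a z (0, 1) n) = schur_fun a n z * snd (szego a z (0, 1) n) \<and> snd (szego a z (0, 1) n) \<noteq> 0"
  proof (induction n)
    case (Suc n)
    define R where "R = snd (szego a z (0, 1) n)"
    define b where "b = schur_fun a n z"
    define D where "D = 1 - a n * (z * b)"
    have D: "D \<noteq> 0" unfolding D_def b_def by (rule schur_fun_den_nz[of a L, OF a L z])
    have IH: "fst (szego a z (0, 1) n) = b * R" "R \<noteq> 0" using Suc by (auto simp: b_def R_def)
    have s: "snd (szego a z (0, 1) (Suc n)) = R * D"
      unfolding szego.simps snd_conv IH R_def[symmetric] D_def by (simp add: algebra_simps)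
    have "fst (szego a z (0, 1) (Suc n)) = (z * b - cnj (a n)) * R"
      unfolding szego.simps fst_conv IH R_def[symmetric] by (simp add: algebra_simps)
    also have "\<dots> = ((z * b - cnj (a n)) * inverse D) * (R * D)" using D by simp
    also have "(z * b - cnj (a n)) * inverse D = schur_fun a (Suc n) z" by (simp add: b_def D_def)
    finally show ?case using s D IH by simp
  qed simp
  then show ?thesis by (simp add: q0_def)
qed

lemma poly_linear_factors:
  fixes q :: "complex poly"
  shows "coeff q 0 = 1 \<Longrightarrow> degree q \<le> n \<Longrightarrow>
    \<exists>u. q = (\<Prod>i<n. [:1, - u i:]) \<and> (\<forall>i<n. u i = 0 \<or> poly q (1 / u i) = 0)"
proof (induction n arbitrary: q)
  case 0
  then obtain c where "q = [:c:]" using degree_eq_zeroE[of q] by auto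
  then have "q = 1" using 0 by (simp add: one_pCons)
  then show ?case by simp
next
  case (Suc n)
  show ?case
  proof (cases "degree q \<le> n")
    case True
    then obtain u where u: "q = (\<Prod>i<n. [:1, - u i:])" "\<forall>i<n. u i = 0 \<or> poly q (1 / u i) = 0"
      using Suc by blast
    have "q = (\<Prod>i<Suc n. [:1, - (u(n := 0)) i:])" using u(1) by (simp add: one_pCons[symmetric])
    moreover have "\<forall>i<Suc n. (u(n := 0)) i = 0 \<or> poly q (1 / (u(n := 0)) i) = 0" using u(2) by (auto simp: less_Suc_eq)
    ultimately show ?thesis by blast
  next
    case False
    then have deg: "degree q = Suc n" using Suc by simp
    have "\<not> constant (poly q)" using deg constant_degree[of q] by simp
    from Fundamental_Theorem_Algebra.fundamental_theorem_of_algebra[OF this] obtain w where w: "poly q w = 0" by (rule exE)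
    have w0: "w \<noteq> 0"
    proof
      assume "w = 0"
      then show False using w Suc.prems(1) by (simp add: poly_0_coeff_0)
    qed
    have "[:- w, 1:] dvd q" using w by (simp only: poly_eq_0_iff_dvd)
    then obtain p where p: "q = [:- w, 1:] * p" by (rule dvdE)
    define p' where "p' = Polynomial.smult (- w) p"
    have lin: "[:- w, 1:] = Polynomial.smult (- w) [:1, - (1 / w):]" using w0 by simp
    have q: "q = [:1, - (1 / w):] * p'"
      unfolding p p'_def lin by (simp only: mult_smult_left mult_smult_right)
    have p0: "p' \<noteq> 0"
    proof
      assume "p' = 0"
      then have "q = 0" unfolding q by (simp only: mult_zero_right)
      then show False using deg by simp
    qed
    have "coeff q 0 = coeff p' 0" unfolding q by simp
    then have "coeff p' 0 = 1" using Suc.prems(1) by simp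
    moreover have "degree q = degree [:1, - (1 / w):] + degree p'"
      unfolding q using p0 w0 by (intro degree_mult_eq) auto
    then have "degree p' \<le> n" using deg w0 by simp
    ultimately obtain u where u: "p' = (\<Prod>i<n. [:1, - u i:])" "\<forall>i<n. u i = 0 \<or> poly p' (1 / u i) = 0"
      using Suc.IH by blast
    have "(\<Prod>i<n. [:1, - (u(n := 1 / w)) i:]) = (\<Prod>i<n. [:1, - u i:])"
      by (intro prod.cong) auto
    then have "q = (\<Prod>i<Suc n. [:1, - (u(n := 1 / w)) i:])"
      using q unfolding u(1) prod.lessThan_Suc by (simp only: fun_upd_same mult.commute)
    moreover have "\<forall>i<Suc n. (u(n := 1 / w)) i = 0 \<or> poly q (1 / (u(n := 1 / w)) i) = 0"
    proof (intro allI impI)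
      fix i assume "i < Suc n"
      show "(u(n := 1 / w)) i = 0 \<or> poly q (1 / (u(n := 1 / w)) i) = 0"
      proof (cases "i = n")
        case True
        then show ?thesis using w w0 by simp
      next
        case False
        then have "u i = 0 \<or> poly p' (1 / u i) = 0" using \<open>i < Suc n\<close> u(2) by simp
        then show ?thesis using False unfolding q poly_mult by auto
      qed
    qed
    ultimately show ?thesis by blast
  qed
qed

definition log_deriv :: "complex fps \<Rightarrow> complex fps" where
  "log_deriv F = fps_X * fps_deriv F * inverse F"

lemma log_deriv_mult:
  assumes "fps_nth F 0 \<noteq> 0" "fps_nth G 0 \<noteq> 0"
  shows "log_deriv (F * G) = log_deriv F + log_deriv G"
proof -
  have F: "F * inverse F = 1" and G: "G * inverse G = 1"
    using assms by (simp_all add: inverse_mult_eq_1')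
  have "log_deriv (F * G) = fps_X * (F * fps_deriv G + fps_deriv F * G) * (inverse F * inverse G)"
    by (simp add: log_deriv_def fps_inverse_mult)
  also have "\<dots> = fps_X * fps_deriv G * inverse G * (F * inverse F) + fps_X * fps_deriv F * inverse F * (G * inverse G)"
    by (simp add: algebra_simps)
  finally show ?thesis unfolding F G by (simp add: log_deriv_def)
qed

lemma log_deriv_1 [simp]: "log_deriv 1 = 0"
  by (simp add: log_deriv_def)

lemma log_deriv_linear_factor:
  assumes "j \<ge> 1"
  shows "fps_nth (log_deriv (fps_of_poly [:1, - u:])) j = - (u ^ j)"
proof -
  define G where "G = Abs_fps (\<lambda>n. u ^ n)"
  have F: "fps_of_poly [:1, - u:] = 1 - fps_const u * fps_X"
    by (simp add: fps_of_poly_pCons mult.commute fps_const_neg[symmetric] del: fps_const_neg)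
  have "(1 - fps_const u * fps_X) * G = 1"
  proof (rule fps_ext)
    fix n show "fps_nth ((1 - fps_const u * fps_X) * G) n = fps_nth 1 n"
      by (cases n) (simp_all add: G_def left_diff_distrib mult.assoc)
  qed
  then have inv: "inverse (fps_of_poly [:1, - u:]) = G" unfolding F by (rule fps_inverse_unique)
  obtain i where "j = Suc i" using assms by (cases j) auto
  then show ?thesis unfolding log_deriv_def inv
    by (simp add: F G_def mult.assoc fps_const_neg[symmetric] del: fps_const_neg)
qed

lemma rpoly_nth_0: "fps_nth (fps_of_poly (rpoly a n)) 0 = 1"
  by (simp add: rpoly_coeff_0)

lemma log_deriv_rpoly: "log_deriv (fps_of_poly (rpoly a n)) = (\<Sum>k<n. log_increment 0 a k)"
proof (induction n)
  case (Suc n)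
  have "log_deriv (fps_of_poly (rpoly a (Suc n))) = log_deriv (fps_of_poly (rpoly a n)) + log_deriv (schur_den 0 a n)"
    using fps_szego[of a n] by (simp only: log_deriv_mult rpoly_nth_0 schur_den_nth_0 zero_neq_one[symmetric] not_False_eq_True)
  then show ?case using Suc by (simp add: log_increment_def log_deriv_def del: ppoly_rpoly_simps)
qed simp

text \<open>
  The $1/u_i$ are the zeros of \<open>q0\<close>; zero is allowed for \<open>u i\<close> so that the number of
  factors is \<open>n\<close> even if the degree is smaller.
\<close>

lemma q0_factorization:
  assumes a: "\<And>n. cmod (a n) \<le> L" and L: "L < 1"
  shows "\<exists>u. (\<forall>z. q0 a z n = (\<Prod>i<n. 1 - u i * z)) \<and> (\<forall>i<n. cmod (u i) \<le> 1) \<and>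
    (\<forall>j\<ge>1. (\<Sum>i<n. u i ^ j) = - (\<Sum>k<n. fps_nth (log_increment 0 a k) j))"
proof -
  obtain u where u: "rpoly a n = (\<Prod>i<n. [:1, - u i:])" "\<forall>i<n. u i = 0 \<or> poly (rpoly a n) (1 / u i) = 0"
    using poly_linear_factors[of "rpoly a n" n] rpoly_coeff_0 degree_szego by blast
  have "q0 a z n = (\<Prod>i<n. 1 - u i * z)" for z
    using poly_szego[of a n z] by (simp add: u(1) poly_prod mult.commute)
  moreover have "cmod (u i) \<le> 1" if "i < n" for i
  proof (rule ccontr)
    assume "\<not> cmod (u i) \<le> 1"
    then have "u i \<noteq> 0" "cmod (1 / u i) \<le> 1" by (auto simp: norm_divide divide_simps)
    then have "q0 a (1 / u i) n = 0" using u(2) that poly_szego[of a n "1 / u i"] by auto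
    then show False using q0_nonzero[of a L, OF a L \<open>cmod (1 / u i) \<le> 1\<close>] by simp
  qed
  moreover have "(\<Sum>i<n. u i ^ j) = - (\<Sum>k<n. fps_nth (log_increment 0 a k) j)" if j: "j \<ge> 1" for j
  proof -
    have "log_deriv (fps_of_poly (\<Prod>i<k. [:1, - u i:])) = (\<Sum>i<k. log_deriv (fps_of_poly [:1, - u i:]))" for k
    proof (induction k)
      case (Suc k)
      have "fps_nth (fps_of_poly (\<Prod>i<k. [:1, - u i:])) 0 = 1"
        by (simp add: poly_0_coeff_0[symmetric] poly_prod)
      then show ?case using Suc unfolding prod.lessThan_Suc sum.lessThan_Suc fps_of_poly_mult
        by (subst log_deriv_mult) simp_all
    qed simp
    then have "(\<Sum>k<n. log_increment 0 a k) = (\<Sum>i<n. log_deriv (fps_of_poly [:1, - u i:]))"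
      using log_deriv_rpoly[of a n] u(1) by simp
    then have "fps_nth (\<Sum>k<n. log_increment 0 a k) j = fps_nth (\<Sum>i<n. log_deriv (fps_of_poly [:1, - u i:])) j" by simp
    then show ?thesis unfolding fps_sum_nth log_deriv_linear_factor[OF j] by (simp add: sum_negf)
  qed
  ultimately show ?thesis by blast
qed

section \<open>Subexponential bounds for the Szego polynomials\<close>

text \<open>
  The radius $1 - \eta$ with $\eta = N^{-2s}$ balances the losses: \<open>s\<close> is chosen so small that
  the factor $\eta^{-A-1}$ from the series over \<open>j\<close> costs only half of the saving $N^{-c}$ in the power sums.
  The points \<open>u\<close> do not depend on \<open>z\<close>, which is what makes the exceptional set a union of arcs.
\<close>

lemma szego_uniform_bounds:
  fixes \<omega> \<kappa> :: real
  assumes r: "r \<ge> 2" and lam: "cmod lam < 1"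
    and kap: "\<kappa> > 0" and dioph: "\<And>q::int. q \<ge> 1 \<Longrightarrow> \<kappa> \<le> (real_of_int q)\<^sup>2 * infdist (real_of_int q * \<omega>) \<int>"
  obtains C s where "0 \<le> C" "0 < s" "s \<le> 1/8"
    and "\<And>Y m M N z. skew_orbit \<omega> Y \<Longrightarrow> M \<le> N \<Longrightarrow> 2 \<le> N \<Longrightarrow> cmod z = 1 \<Longrightarrow>
        cmod (q0 (\<lambda>i. lam * ee (Y (m + int i) r)) z M) \<le> exp (C * real N powr (1 - s))"
    and "\<And>Y m M N. skew_orbit \<omega> Y \<Longrightarrow> M \<le> N \<Longrightarrow> 2 \<le> N \<Longrightarrow>
        \<exists>u. (\<forall>i<M. cmod (u i) \<le> 1) \<and>
        (\<forall>z. cmod z = 1 \<longrightarrow> (\<forall>i<M. exp (- (real N powr s)) \<le> cmod (1 - u i * z)) \<longrightarrow>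
          exp (- (C * real N powr (1 - s))) \<le> cmod (q0 (\<lambda>i. lam * ee (Y (m + int i) r)) z M))"
proof -
  obtain K A c where K0: "K \<ge> 0" and c: "0 < c" "c \<le> 1/2"
    and main: "\<And>Y m M N j. skew_orbit \<omega> Y \<Longrightarrow> M \<le> N \<Longrightarrow> 1 \<le> N \<Longrightarrow> 1 \<le> j \<Longrightarrow>
       cmod (\<Sum>n<M. fps_nth (log_increment 0 (\<lambda>i. lam * ee (Y (m + int i) r)) n) j)
         \<le> K * real j ^ A * real N powr (1 - c)"
    using log_increment_sum_bound[OF r lam kap dioph] by blast
  define s where "s = c / (4 * (real A + 1))"
  define k where "k = (fact A * 2 ^ (A + 2) :: real)"
  define C1 where "C1 = 1 + 2 * (K * k)"
  define C where "C = K * k + 1 + 2 * sqrt C1 + 8 * C1"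
  have s0: "0 < s" using c by (simp add: s_def)
  have sc: "4 * s \<le> c" using c by (simp add: s_def field_simps)
  have sA: "2 * s * real (A + 1) = c / 2" by (simp add: s_def field_simps)
  have k0: "0 \<le> k" by (simp add: k_def)
  have Kk: "0 \<le> K * k" using K0 k0 by simp
  then have C1: "1 \<le> C1" by (simp add: C1_def)
  have C0: "0 \<le> C" using Kk C1 by (simp add: C_def)
  have s8: "s \<le> 1/8" using sc c by simp
  have bounds: "(\<forall>z. cmod z = 1 \<longrightarrow> cmod (q0 (\<lambda>i. lam * ee (Y (m + int i) r)) z M) \<le> exp (C * real N powr (1 - s))) \<and>
      (\<exists>u. (\<forall>i<M. cmod (u i) \<le> 1) \<and>
        (\<forall>z. cmod z = 1 \<longrightarrow> (\<forall>i<M. exp (- (real N powr s)) \<le> cmod (1 - u i * z)) \<longrightarrow>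
          exp (- (C * real N powr (1 - s))) \<le> cmod (q0 (\<lambda>i. lam * ee (Y (m + int i) r)) z M)))"
    if Y: "skew_orbit \<omega> Y" and M: "M \<le> N" and N: "2 \<le> N" for Y m M N
  proof -
    define a where "a i = lam * ee (Y (m + int i) r)" for i
    have aL: "cmod (a i) \<le> cmod lam" for i by (simp add: a_def norm_mult)
    obtain u where prod: "\<And>z. q0 a z M = (\<Prod>i<M. 1 - u i * z)" and u1: "\<And>i. i < M \<Longrightarrow> cmod (u i) \<le> 1"
      and pw: "\<And>j. j \<ge> 1 \<Longrightarrow> (\<Sum>i<M. u i ^ j) = - (\<Sum>k<M. fps_nth (log_increment 0 a k) j)"
      using q0_factorization[of a "cmod lam" M, OF aL lam] by blast
    define X where "X = real N"
    have X: "2 \<le> X" using N by (simp add: X_def)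
    define \<eta> where "\<eta> = X powr (- 2 * s)"
    have \<eta>: "0 < \<eta>" "\<eta> < 1"
      using X s0 powr_less_mono2_neg[of "- 2 * s" 1 X] by (auto simp: \<eta>_def)
    have le: "X powr x \<le> X powr y" if "x \<le> y" for x y using X that by (intro powr_mono) auto
    have one: "1 \<le> X powr x" if "0 \<le> x" for x using X that by (intro ge_one_powr_ge_zero) auto
    have ctrl: "power_sum_control u M (K * X powr (1 - c)) A \<eta> z" if "cmod z = 1" for z
    proof
      show "cmod (u i) \<le> 1" if "i < M" for i using u1[OF that] .
      show "cmod (\<Sum>i<M. u i ^ j) \<le> K * X powr (1 - c) * real j ^ A" if "j \<ge> 1" for j
        using main[OF Y M _ that, of m] N unfolding pw[OF that] norm_minus_cancel
        by (simp add: a_def[abs_def] X_def mult_ac)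
    qed (use \<eta> that in auto)
    define mm where "mm = K * k * X powr (1 - c / 2)"
    have mm: "power_sum_control.m (K * X powr (1 - c)) A \<eta> = mm" if "cmod z = 1" for z :: complex
    proof -
      have "\<eta> ^ (A + 1) = X powr (- (2 * s * real (A + 1)))"
      proof -
        have "\<eta> ^ (A + 1) = \<eta> powr real (A + 1)" using \<eta> by (simp only: powr_realpow)
        also have "\<dots> = X powr (- 2 * s * real (A + 1))" unfolding \<eta>_def by (rule powr_powr)
        finally show ?thesis by (simp only: mult_minus_left)
      qed
      also have "\<dots> = X powr (- (c / 2))" unfolding sA ..
      finally have e: "\<eta> ^ (A + 1) = X powr (- (c / 2))" .
      have "X powr (1 - c) / X powr (- (c / 2)) = X powr (1 - c / 2)"
        by (simp add: powr_diff[symmetric])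
      then show ?thesis
        unfolding power_sum_control.m_def[OF ctrl[OF that]] e k_def[symmetric] mm_def
        by (metis (no_types) mult.assoc mult.commute times_divide_eq_right)
    qed
    have mm1: "mm \<le> K * k * X powr (1 - s)" unfolding mm_def
      using Kk sc s0 by (intro mult_left_mono le) auto
    have mm2: "real M + 2 * mm \<le> C1 * X"
    proof -
      have "mm \<le> K * k * X powr 1" unfolding mm_def using Kk c by (intro mult_left_mono le) auto
      moreover have "real M \<le> X" using M by (simp add: X_def)
      ultimately show ?thesis using X by (simp add: C1_def algebra_simps)
    qed
    have mm0: "0 \<le> mm" using Kk by (simp add: mm_def)
    have eX: "\<eta> * X = X powr (1 - 2 * s)"
      using X by (simp add: \<eta>_def powr_mult_base[symmetric] powr_diff powr_minus field_simps)
    have up: "cmod (q0 a z M) \<le> exp (C * X powr (1 - s))" if z: "cmod z = 1" for z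
    proof -
      have "cmod (q0 a z M) \<le> exp (\<eta> * real M + mm)"
        using power_sum_control.product_upper_bound[OF ctrl[OF z]] unfolding prod mm[OF z] .
      also have "\<eta> * real M + mm \<le> \<eta> * X + mm" using M \<eta> by (simp add: X_def)
      also have "\<eta> * X \<le> 1 * X powr (1 - s)" unfolding eX using s0 le[of "1 - 2 * s" "1 - s"] by simp
      also have "1 * X powr (1 - s) + mm \<le> C * X powr (1 - s)"
      proof -
        have "(1 + K * k) * X powr (1 - s) \<le> C * X powr (1 - s)"
          using C1 by (intro mult_right_mono) (auto simp: C_def)
        then show ?thesis using mm1 by (simp add: algebra_simps)
      qed
      finally show ?thesis by simp
    qed
    have low: "exp (- (C * X powr (1 - s))) \<le> cmod (q0 a z M)"
      if z: "cmod z = 1" and sep: "\<And>i. i < M \<Longrightarrow> exp (- (X powr s)) \<le> cmod (1 - u i * z)" for z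
    proof -
      define E where "E = \<eta> * (real M + 2 * mm)"
      have E0: "0 \<le> E" using \<eta> mm0 by (simp add: E_def)
      have E: "E \<le> C1 * X powr (1 - 2 * s)"
      proof -
        have "E \<le> \<eta> * (C1 * X)" unfolding E_def using mm2 \<eta> by (intro mult_left_mono) auto
        also have "\<dots> = C1 * (\<eta> * X)" by (simp only: mult_ac)
        finally show ?thesis unfolding eX .
      qed
      have sq: "sqrt (real M * E) \<le> sqrt C1 * X powr (1 - s)"
      proof (rule real_le_lsqrt)
        have "real M * E \<le> X * (C1 * X powr (1 - 2 * s))"
          using M E E0 X by (intro mult_mono) (auto simp: X_def)
        also have "X * (C1 * X powr (1 - 2 * s)) = C1 * (X powr 1 * X powr (1 - 2 * s))" using X by simp
        also have "X powr 1 * X powr (1 - 2 * s) = (X powr (1 - s))\<^sup>2"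
          unfolding power2_eq_square powr_add[symmetric] by simp
        also have "C1 * (X powr (1 - s))\<^sup>2 = (sqrt C1 * X powr (1 - s))\<^sup>2"
          using C1 by (simp add: power_mult_distrib)
        finally show "real M * E \<le> (sqrt C1 * X powr (1 - s))\<^sup>2" .
      qed (use C1 in auto)
      \<comment> \<open>The separation $\epsilon = e^{-X^s}$ costs a factor $X^s$ on a proportion $X^{-2s}$ of the points.\<close>
      have ln2: "ln (2 / exp (- (X powr s))) \<le> 2 * X powr s"
      proof -
        have "ln (2 / exp (- (X powr s))) = ln 2 + X powr s" by (simp add: ln_div)
        moreover have "ln (2::real) \<le> 1" using ln_2_less_1 by simp
        ultimately show ?thesis using one[of s] s0 by linarith
      qed
      have "E * ln (2 / exp (- (X powr s))) \<le> C1 * X powr (1 - 2 * s) * (2 * X powr s)"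
      proof (rule mult_mono[OF E ln2])
        have "exp (- (X powr s)) \<le> 2" by (rule order_trans[of _ "1::real"]) simp_all
        then have "1 \<le> 2 / exp (- (X powr s))" by (simp only: le_divide_eq_1_pos exp_gt_zero)
        then show "0 \<le> ln (2 / exp (- (X powr s)))" by (rule ln_ge_zero)
        show "0 \<le> C1 * X powr (1 - 2 * s)" using C1 by simp
      qed
      also have "\<dots> = 2 * C1 * (X powr (1 - 2 * s) * X powr s)" by simp
      also have "X powr (1 - 2 * s) * X powr s = X powr (1 - s)" by (simp add: powr_add[symmetric])
      finally have t3: "E * ln (2 / exp (- (X powr s))) \<le> 2 * C1 * X powr (1 - s)" .
      have "mm + 2 * sqrt (real M * E) + 4 * E * ln (2 / exp (- (X powr s)))
          \<le> (K * k + 2 * sqrt C1 + 8 * C1) * X powr (1 - s)"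
        using mm1 sq t3 by (simp add: algebra_simps)
      also have "\<dots> \<le> C * X powr (1 - s)" by (intro mult_right_mono) (auto simp: C_def)
      finally have "exp (- (C * X powr (1 - s))) \<le> exp (- (mm + 2 * sqrt (real M * E) + 4 * E * ln (2 / exp (- (X powr s)))))"
        by simp
      also have "\<dots> \<le> cmod (q0 a z M)"
        using power_sum_control.product_lower_bound[OF ctrl[OF z] _ _ sep]
        unfolding prod mm[OF z] E_def by simp
      finally show ?thesis .
    qed
    show ?thesis using up low u1 unfolding a_def[abs_def] X_def by blast
  qed
  show thesis
  proof (rule that[OF C0 s0 s8])
    fix Y :: "int \<Rightarrow> nat \<Rightarrow> real" and m :: int and M N :: nat assume *: "skew_orbit \<omega> Y" "M \<le> N" "2 \<le> N"
    show "\<exists>u. (\<forall>i<M. cmod (u i) \<le> 1) \<and>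
        (\<forall>z. cmod z = 1 \<longrightarrow> (\<forall>i<M. exp (- (real N powr s)) \<le> cmod (1 - u i * z)) \<longrightarrow>
          exp (- (C * real N powr (1 - s))) \<le> cmod (q0 (\<lambda>i. lam * ee (Y (m + int i) r)) z M))"
      by (rule conjunct2[OF bounds[OF *]])
    fix z :: complex assume "cmod z = 1"
    then show "cmod (q0 (\<lambda>i. lam * ee (Y (m + int i) r)) z M) \<le> exp (C * real N powr (1 - s))"
      using conjunct1[OF bounds[OF *]] by simp
  qed
qed

section \<open>Green's function of a finite CMV matrix\<close>

lemma restrict_op_carrier [simp]:
  "restrict_op A a b \<in> carrier_mat (nat (b - a + 1)) (nat (b - a + 1))"
  by (simp add: restrict_op_def)

lemma restrict_op_dim [simp]:
  "dim_row (restrict_op A a b) = nat (b - a + 1)" "dim_col (restrict_op A a b) = nat (b - a + 1)"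
  by (simp_all add: restrict_op_def)

lemma restrict_op_entry [simp]:
  "i < nat (b - a + 1) \<Longrightarrow> j < nat (b - a + 1) \<Longrightarrow> restrict_op A a b $$ (i, j) = A (a + int i) (a + int j)"
  by (simp add: restrict_op_def)

lemma restrict_op_cong:
  assumes "\<And>i j. i \<in> {a..b} \<Longrightarrow> j \<in> {a..b} \<Longrightarrow> A i j = B i j"
  shows "restrict_op A a b = restrict_op B a b"
  by (rule eq_matI) (auto intro!: assms)

lemma sum_sites:
  "(\<Sum>m\<in>{0..<nat (b - a + 1)}. f (a + int m)) = (\<Sum>k\<in>{a..b}. f k)"
  by (rule sum.reindex_bij_witness[of _ "\<lambda>k. nat (k - a)" "\<lambda>m. a + int m"]) auto

lemma restrict_op_mult:
  "restrict_op A a b * restrict_op B a b = restrict_op (\<lambda>i j. \<Sum>k\<in>{a..b}. A i k * B k j) a b"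
proof (rule eq_matI)
  fix i j assume ij: "i < dim_row (restrict_op (\<lambda>i j. \<Sum>k\<in>{a..b}. A i k * B k j) a b)"
    "j < dim_col (restrict_op (\<lambda>i j. \<Sum>k\<in>{a..b}. A i k * B k j) a b)"
  then have "(restrict_op A a b * restrict_op B a b) $$ (i, j)
    = (\<Sum>m\<in>{0..<nat (b - a + 1)}. A (a + int i) (a + int m) * B (a + int m) (a + int j))"
    by (simp add: scalar_prod_def)
  also have "\<dots> = (\<Sum>k\<in>{a..b}. A (a + int i) k * B k (a + int j))"
    by (rule sum_sites)
  finally show "(restrict_op A a b * restrict_op B a b) $$ (i, j)
    = restrict_op (\<lambda>i j. \<Sum>k\<in>{a..b}. A i k * B k j) a b $$ (i, j)" using ij by simp
qed simp_all

lemma mat_adjoint_carrier: "mat_adjoint A \<in> carrier_mat (dim_col A) (dim_row A)"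
  using mat_of_rows_carrier(1)[of "dim_row A" "map conjugate (cols A)"] by (simp add: mat_adjoint_def)

lemma mat_adjoint_entry:
  "i < dim_col A \<Longrightarrow> j < dim_row A \<Longrightarrow> mat_adjoint A $$ (i, j) = conjugate (A $$ (j, i))"
  by (simp add: mat_adjoint_def mat_of_rows_def)

lemma restrict_op_adjoint:
  "mat_adjoint (restrict_op A a b) = restrict_op (\<lambda>i j. cnj (A j i)) a b"
proof (rule eq_matI)
  show "mat_adjoint (restrict_op A a b) $$ (i, j) = restrict_op (\<lambda>i j. cnj (A j i)) a b $$ (i, j)"
    if "i < dim_row (restrict_op (\<lambda>i j. cnj (A j i)) a b)" "j < dim_col (restrict_op (\<lambda>i j. cnj (A j i)) a b)" for i j
    using that by (simp add: mat_adjoint_entry)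
qed (use mat_adjoint_carrier[of "restrict_op A a b"] in auto)

lemma restrict_op_one: "restrict_op (\<lambda>i j. if i = j then 1 else 0) a b = 1\<^sub>m (nat (b - a + 1))"
  by (rule eq_matI) auto

lemma restrict_op_resolvent:
  "z \<cdot>\<^sub>m restrict_op A a b - restrict_op B a b = restrict_op (\<lambda>i j. z * A i j - B i j) a b"
  by (rule eq_matI) auto

lemma mat_inv_eqI:
  assumes A: "A \<in> carrier_mat n n" and X: "X \<in> carrier_mat n n" and AX: "A * X = 1\<^sub>m n"
  shows "mat_inv A = X" "invertible_mat A"
proof -
  have XA: "X * A = 1\<^sub>m n" by (rule mat_mult_left_right_inverse[OF A X AX])
  have "A \<in> Units (ring_mat TYPE(complex) n ())"
    using A X AX XA by (auto simp: Units_def ring_mat_def)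
  then obtain B where B: "mat_inverse A = Some B"
    using mat_inverse(1)[OF A, of "()"] by (cases "mat_inverse A") auto
  from mat_inverse(2)[OF A B] have BA: "B * A = 1\<^sub>m n" and Bc: "B \<in> carrier_mat n n" by auto
  have "B = B * (A * X)" using Bc AX by simp
  also have "\<dots> = (B * A) * X" using A X Bc by simp
  also have "\<dots> = X" using BA X by simp
  finally show "mat_inv A = X" using B by (simp add: mat_inv_def)
  show "invertible_mat A"
    unfolding invertible_mat_def inverts_mat_def using A X AX XA by auto
qed

text \<open>
  A crude bound suffices, since powers of the dimension are negligible against $e^{N^\tau}$.
\<close>

lemma l2_norm_mult_le:
  assumes X: "X \<in> carrier_mat n n" and B: "\<And>i j. i < n \<Longrightarrow> j < n \<Longrightarrow> cmod (X $$ (i, j)) \<le> B" and B0: "0 \<le> B"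
    and v: "dim_vec v = n" "l2_norm_vec v \<le> 1"
  shows "l2_norm_vec (X *\<^sub>v v) \<le> (real n)\<^sup>2 * B"
proof -
  have vj: "cmod (vec_index v j) \<le> 1" if "j < n" for j
    using member_le_L2_set[of "{..<n}" j "\<lambda>i. cmod (vec_index v i)"] that v by (simp add: l2_norm_vec_def)
  have "cmod (vec_index (X *\<^sub>v v) i) \<le> real n * B" if i: "i < n" for i
  proof -
    have "vec_index (X *\<^sub>v v) i = (\<Sum>j\<in>{0..<n}. X $$ (i, j) * vec_index v j)"
      using i X v by (simp add: scalar_prod_def)
    also have "cmod \<dots> \<le> (\<Sum>j\<in>{0..<n}. B * 1)"
    proof (rule sum_norm_le)
      fix j assume "j \<in> {0..<n}"
      then have j: "j < n" by simp
      show "cmod (X $$ (i, j) * vec_index v j) \<le> B * 1"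
        unfolding norm_mult by (intro mult_mono B[OF i j] vj[OF j] B0 norm_ge_zero)
    qed
    finally show ?thesis by simp
  qed
  then have "(\<Sum>i<n. cmod (vec_index (X *\<^sub>v v) i)) \<le> (\<Sum>i<n. real n * B)" by (intro sum_mono) auto
  moreover have "l2_norm_vec (X *\<^sub>v v) \<le> (\<Sum>i<n. cmod (vec_index (X *\<^sub>v v) i))"
  proof -
    have dr: "dim_vec (X *\<^sub>v v) = n" using X by simp
    show ?thesis unfolding l2_norm_vec_def dr by (rule L2_set_le_sum) simp
  qed
  ultimately show ?thesis by (simp add: power2_eq_square)
qed

lemma unit_ball_nonempty: "{v \<in> carrier_vec n. l2_norm_vec v \<le> 1} \<noteq> {}"
proof -
  have "0\<^sub>v n \<in> {v \<in> carrier_vec n. l2_norm_vec v \<le> 1}"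
    by (simp add: l2_norm_vec_def L2_set_def)
  then show ?thesis by blast
qed

lemma l2_op_norm_le:
  assumes X: "X \<in> carrier_mat n n" and B: "\<And>i j. i < n \<Longrightarrow> j < n \<Longrightarrow> cmod (X $$ (i, j)) \<le> B" and B0: "0 \<le> B"
  shows "l2_op_norm X \<le> (real n)\<^sup>2 * B"
  unfolding l2_op_norm_def
  by (rule cSUP_least[OF unit_ball_nonempty]) (use X in \<open>auto intro!: l2_norm_mult_le[OF X B B0]\<close>)

definition resolvent_kernel :: "(int \<Rightarrow> complex) \<Rightarrow> complex \<Rightarrow> int \<Rightarrow> int \<Rightarrow> complex" where
  "resolvent_kernel t z i j = z * cnj (cmv_L t j i) - cmv_M t i j"

lemma resolvent_kernel_even:
  assumes "even l"
  shows "resolvent_kernel t z l l = z * t l + t (l - 1)"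
    and "resolvent_kernel t z l (l - 1) = - of_real (cmv_rho t (l - 1))"
    and "resolvent_kernel t z l (l + 1) = z * of_real (cmv_rho t l)"
  using assms by (simp_all add: resolvent_kernel_def cmv_L_def cmv_M_def cmv_Theta_def)

lemma resolvent_kernel_odd:
  assumes "odd l"
  shows "resolvent_kernel t z l l = - (z * cnj (t (l - 1))) - cnj (t l)"
    and "resolvent_kernel t z l (l - 1) = z * of_real (cmv_rho t (l - 1))"
    and "resolvent_kernel t z l (l + 1) = - of_real (cmv_rho t l)"
  using assms by (simp_all add: resolvent_kernel_def cmv_L_def cmv_M_def cmv_Theta_def)

lemma resolvent_kernel_zero:
  assumes "\<bar>i - j\<bar> > 1"
  shows "resolvent_kernel t z i j = 0"
  using assms by (auto simp: resolvent_kernel_def cmv_L_def cmv_M_def cmv_Theta_def)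

text \<open>
  The classical formula for the inverse of a tridiagonal matrix in terms of a solution \<open>u\<close> satisfying
  the left and a solution \<open>v\<close> satisfying the right boundary condition; \<open>W\<close> is their Wronskian.
\<close>

lemma tridiagonal_green:
  fixes A :: "int \<Rightarrow> int \<Rightarrow> complex"
  assumes tri: "\<And>i j. \<bar>i - j\<bar> > 1 \<Longrightarrow> A i j = 0"
    and left: "A a (a - 1) = 0" and right: "A b (b + 1) = 0" and W: "W \<noteq> 0"
    and U: "\<And>l. a \<le> l \<Longrightarrow> l < b \<Longrightarrow> A l (l - 1) * u (l - 1) + A l l * u l + A l (l + 1) * u (l + 1) = 0"
    and V: "\<And>l. a < l \<Longrightarrow> l \<le> b \<Longrightarrow> A l (l - 1) * v (l - 1) + A l l * v l + A l (l + 1) * v (l + 1) = 0"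
    and UV: "\<And>l. a \<le> l \<Longrightarrow> l \<le> b \<Longrightarrow>
       A l (l - 1) * (u (l - 1) * v l) + A l l * (u l * v l) + A l (l + 1) * (u l * v (l + 1)) = W"
    and l: "l \<in> {a..b}" and m: "m \<in> {a..b}"
  shows "(\<Sum>k\<in>{a..b}. A l k * (u (min k m) * v (max k m) / W)) = (if l = m then 1 else 0)"
proof -
  define f where "f k = A l k * (u (min k m) * v (max k m))" for k
  have out: "f k = 0" if "k \<notin> {l - 1, l, l + 1}" for k
  proof -
    have "\<bar>l - k\<bar> > 1" using that by auto
    then show ?thesis using tri[of l k] by (simp add: f_def)
  qed
  have "(\<Sum>k\<in>{a..b}. f k) = (\<Sum>k\<in>{a..b} \<inter> {l - 1, l, l + 1}. f k)"
    by (rule sum.mono_neutral_right) (use out in auto)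
  also have "\<dots> = (\<Sum>k\<in>{l - 1, l, l + 1}. f k)"
  proof (rule sum.mono_neutral_left)
    show "\<forall>k\<in>{l - 1, l, l + 1} - {a..b} \<inter> {l - 1, l, l + 1}. f k = 0"
    proof
      fix k assume "k \<in> {l - 1, l, l + 1} - {a..b} \<inter> {l - 1, l, l + 1}"
      then have "(l = a \<and> k = a - 1) \<or> (l = b \<and> k = b + 1)" using l by auto
      then show "f k = 0" using left right by (auto simp: f_def)
    qed
  qed auto
  also have "\<dots> = f (l - 1) + f l + f (l + 1)" by (simp add: add.assoc)
  also have "\<dots> = (if l = m then W else 0)"
  proof -
    consider "l = m" | "l < m" | "m < l" by linarith
    then show ?thesis
    proof cases
      case 1
      then show ?thesis using UV[of l] l by (simp add: f_def)
    next
      case 2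
      then have e: "min (l - 1) m = l - 1" "max (l - 1) m = m" "min l m = l" "max l m = m"
        "min (l + 1) m = l + 1" "max (l + 1) m = m" by auto
      have "f (l - 1) + f l + f (l + 1)
        = (A l (l - 1) * u (l - 1) + A l l * u l + A l (l + 1) * u (l + 1)) * v m"
        unfolding f_def e by (simp add: algebra_simps)
      then show ?thesis using U[of l] 2 l m by simp
    next
      case 3
      then have e: "min (l - 1) m = m" "max (l - 1) m = l - 1" "min l m = m" "max l m = l"
        "min (l + 1) m = m" "max (l + 1) m = l + 1" by auto
      have "f (l - 1) + f l + f (l + 1)
        = u m * (A l (l - 1) * v (l - 1) + A l l * v l + A l (l + 1) * v (l + 1))"
        unfolding f_def e by (simp add: algebra_simps)
      then show ?thesis using V[of l] 3 l m by simp
    qed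
  qed
  finally have "(\<Sum>k\<in>{a..b}. f k) / W = (if l = m then 1 else 0)" using W by simp
  then show ?thesis by (simp add: f_def sum_divide_distrib)
qed

text \<open>
  The scalars that turn the unnormalised Szego recursion into solutions on the sites: they contain
  $\rho^{-i}$ and the powers of \<open>z\<close> that come from the alternation between \<open>cmv_L\<close> and \<open>cmv_M\<close>.
\<close>

primrec phase :: "int \<Rightarrow> complex \<Rightarrow> real \<Rightarrow> nat \<Rightarrow> complex" where
  "phase a z \<rho> 0 = 1"
| "phase a z \<rho> (Suc i) = phase a z \<rho> i / (of_real \<rho> * (if even (a + int i) then z else 1))"

text \<open>
  With $s = M u$ the equation $z L^* u = M u$ reads $L s = z u$.  On an even site the Szego
  components are \<open>(u, s)\<close>, on an odd site \<open>(s, z * u)\<close>, both up to a scalar; so \<open>u\<close> is alternately the first and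
  the second component.
\<close>

definition site_solution :: "int \<Rightarrow> complex \<Rightarrow> real \<Rightarrow> (nat \<Rightarrow> complex) \<Rightarrow> complex \<times> complex \<Rightarrow> int \<Rightarrow> complex" where
  "site_solution a z \<rho> c v l = phase a z \<rho> (nat (l - a)) *
     (if even l then fst (szego c z v (nat (l - a))) else snd (szego c z v (nat (l - a))))"

lemma phase_norm:
  assumes "cmod z = 1" "0 < \<rho>"
  shows "cmod (phase a z \<rho> i) = 1 / \<rho> ^ i"
  using assms by (induction i) (auto simp: norm_divide norm_mult)

locale cmv_box =
  fixes \<alpha> :: "int \<Rightarrow> complex" and \<beta> \<beta>' z :: complex and \<rho> :: real and a b :: int
  assumes \<beta>: "cmod \<beta> = 1" and \<beta>': "cmod \<beta>' = 1" and z: "cmod z = 1" and \<rho>: "0 < \<rho>"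
    and \<alpha>: "\<And>n. (cmod (\<alpha> n))\<^sup>2 = 1 - \<rho>\<^sup>2" and ab: "a < b"
begin

definition t :: "int \<Rightarrow> complex" where "t = \<alpha>(a - 1 := \<beta>, b := \<beta>')"
definition c :: "nat \<Rightarrow> complex" where "c i = \<alpha> (a + int i)"
definition k :: nat where "k = nat (b - a)"

abbreviation "ker \<equiv> resolvent_kernel t z"
abbreviation "sol \<equiv> site_solution a z \<rho> c"

lemma t_simps: "t (a - 1) = \<beta>" "t b = \<beta>'" "l \<noteq> a - 1 \<Longrightarrow> l \<noteq> b \<Longrightarrow> t l = \<alpha> l"
  using ab by (auto simp: t_def)

lemma rho_simps: "cmv_rho t (a - 1) = 0" "cmv_rho t b = 0"
  "l \<noteq> a - 1 \<Longrightarrow> l \<noteq> b \<Longrightarrow> cmv_rho t l = \<rho>"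
  using \<beta> \<beta>' \<rho> by (auto simp: cmv_rho_def t_simps \<alpha>)

lemma z0: "z \<noteq> 0" using z by auto

lemma cc: "of_real \<rho> ^ 2 = 1 - \<alpha> n * cnj (\<alpha> n)"
proof -
  have "of_real \<rho> ^ 2 = complex_of_real (1 - (cmod (\<alpha> n))\<^sup>2)" by (simp add: \<alpha>)
  also have "\<dots> = 1 - \<alpha> n * cnj (\<alpha> n)" by (simp only: of_real_diff complex_norm_square of_real_1)
  finally show ?thesis .
qed

lemma bb: "\<beta> * cnj \<beta> = 1" "\<beta>' * cnj \<beta>' = 1"
  using \<beta> \<beta>' complex_norm_square[of \<beta>] complex_norm_square[of \<beta>'] by simp_all

lemma site_cases:
  assumes "a < l"
  obtains i where "l = a + int (Suc i)"
proof -
  have "l = a + int (Suc (nat (l - a - 1)))" using assms by simp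
  then show thesis using that by blast
qed

lemma sol_at: "sol v (a + int i) = phase a z \<rho> i *
     (if even (a + int i) then fst (szego c z v i) else snd (szego c z v i))"
  by (simp add: site_solution_def)

lemma two_term_even:
  assumes l: "l = a + int (Suc i)" "even l"
  shows "- of_real \<rho> * sol v (l - 1) + \<alpha> (l - 1) * sol v l
    = - phase a z \<rho> (Suc i) * snd (szego c z v (Suc i))"
proof -
  define P R where "P = fst (szego c z v i)" and "R = snd (szego c z v i)"
  have e: "odd (a + int i)" using l by simp
  have l1: "l - 1 = a + int i" using l by simp
  have ci: "c i = \<alpha> (l - 1)" using l by (simp add: c_def)
  define A where "A = \<alpha> (l - 1)"
  have s1: "sol v (l - 1) = phase a z \<rho> i * R" unfolding l1 sol_at using e by (simp add: R_def)
  have s2: "sol v l = phase a z \<rho> i / of_real \<rho> * (z * P - cnj A * R)"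
    unfolding l(1) sol_at using e l ci by (simp add: P_def R_def A_def)
  have s3: "- phase a z \<rho> (Suc i) * snd (szego c z v (Suc i)) = - (phase a z \<rho> i / of_real \<rho> * (R - A * (z * P)))"
    using e ci by (simp add: P_def R_def A_def)
  have "- of_real \<rho> * (phase a z \<rho> i * R) + A * (phase a z \<rho> i / of_real \<rho> * (z * P - cnj A * R))
    + (phase a z \<rho> i / of_real \<rho> * (R - A * (z * P)))
     = phase a z \<rho> i / of_real \<rho> * (R * (1 - A * cnj A - of_real \<rho> ^ 2))"
    using \<rho> by (simp add: field_simps power2_eq_square)
  also have "\<dots> = 0" unfolding A_def cc[of "l - 1"] by simp
  finally show ?thesis unfolding s1 s2 s3 A_def[symmetric] by (simp only: add_eq_0_iff minus_minus)
qed

lemma two_term_odd: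
  assumes l: "l = a + int (Suc i)" "odd l"
  shows "z * of_real \<rho> * sol v (l - 1) - z * cnj (\<alpha> (l - 1)) * sol v l
    = phase a z \<rho> (Suc i) * (z * fst (szego c z v (Suc i)))"
proof -
  define P R where "P = fst (szego c z v i)" and "R = snd (szego c z v i)"
  have e: "even (a + int i)" using l by simp
  have l1: "l - 1 = a + int i" using l by simp
  have ci: "c i = \<alpha> (l - 1)" using l by (simp add: c_def)
  define A where "A = \<alpha> (l - 1)"
  have s1: "sol v (l - 1) = phase a z \<rho> i * P" unfolding l1 sol_at using e by (simp add: P_def)
  have s2: "sol v l = phase a z \<rho> i / (of_real \<rho> * z) * (R - A * (z * P))"
    unfolding l(1) sol_at using e l ci by (simp add: P_def R_def A_def)
  have s3: "phase a z \<rho> (Suc i) * (z * fst (szego c z v (Suc i)))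
     = phase a z \<rho> i / (of_real \<rho> * z) * (z * (z * P - cnj A * R))"
    using e ci by (simp add: P_def R_def A_def)
  have "z * of_real \<rho> * (phase a z \<rho> i * P) - z * cnj A * (phase a z \<rho> i / (of_real \<rho> * z) * (R - A * (z * P)))
     - phase a z \<rho> i / (of_real \<rho> * z) * (z * (z * P - cnj A * R))
     = z * (phase a z \<rho> i / of_real \<rho>) * (P * (of_real \<rho> ^ 2 - (1 - A * cnj A)))"
    using \<rho> z0 by (simp add: field_simps power2_eq_square)
  also have "\<dots> = 0" unfolding A_def cc[of "l - 1"] by simp
  finally show ?thesis unfolding s1 s2 s3 A_def[symmetric] by (simp only: right_minus_eq)
qed

lemma next_term_even:
  assumes l: "l = a + int i" "even l"
  shows "z * of_real \<rho> * sol v (l + 1) = phase a z \<rho> i * snd (szego c z v i) - z * \<alpha> l * sol v l"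
proof -
  have l1: "l + 1 = a + int (Suc i)" using l by simp
  have ci: "c i = \<alpha> l" using l by (simp add: c_def)
  have "sol v (l + 1) = phase a z \<rho> i / (of_real \<rho> * z) * (snd (szego c z v i) - \<alpha> l * (z * fst (szego c z v i)))"
    unfolding l1 sol_at using l ci by simp
  moreover have "sol v l = phase a z \<rho> i * fst (szego c z v i)" unfolding l(1) sol_at using l by simp
  ultimately show ?thesis using \<rho> z0 by (simp add: field_simps)
qed

lemma next_term_odd:
  assumes l: "l = a + int i" "odd l"
  shows "of_real \<rho> * sol v (l + 1) = phase a z \<rho> i * (z * fst (szego c z v i)) - cnj (\<alpha> l) * sol v l"
proof -
  have l1: "l + 1 = a + int (Suc i)" using l by simp
  have ci: "c i = \<alpha> l" using l by (simp add: c_def)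
  have "sol v (l + 1) = phase a z \<rho> i / of_real \<rho> * (z * fst (szego c z v i) - cnj (\<alpha> l) * snd (szego c z v i))"
    unfolding l1 sol_at using l ci by simp
  moreover have "sol v l = phase a z \<rho> i * snd (szego c z v i)" unfolding l(1) sol_at using l by simp
  ultimately show ?thesis using \<rho> by (simp add: field_simps)
qed

lemma interior_row:
  assumes "a < l" "l < b"
  shows "ker l (l - 1) * sol v (l - 1) + ker l l * sol v l + ker l (l + 1) * sol v (l + 1) = 0"
proof -
  obtain i where l: "l = a + int (Suc i)" using assms by (rule_tac site_cases)
  have r: "cmv_rho t (l - 1) = \<rho>" "cmv_rho t l = \<rho>" "t (l - 1) = \<alpha> (l - 1)" "t l = \<alpha> l"
    using assms by (auto intro!: rho_simps t_simps)
  show ?thesis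
  proof (cases "even l")
    case True
    have "ker l (l - 1) * sol v (l - 1) + ker l l * sol v l + ker l (l + 1) * sol v (l + 1)
      = (- of_real \<rho> * sol v (l - 1) + \<alpha> (l - 1) * sol v l) + (z * of_real \<rho> * sol v (l + 1) + z * \<alpha> l * sol v l)"
      unfolding resolvent_kernel_even[OF True] r by (simp add: algebra_simps)
    then show ?thesis unfolding two_term_even[OF l True] next_term_even[OF l True] by simp
  next
    case False
    have "ker l (l - 1) * sol v (l - 1) + ker l l * sol v l + ker l (l + 1) * sol v (l + 1)
      = (z * of_real \<rho> * sol v (l - 1) - z * cnj (\<alpha> (l - 1)) * sol v l) - (of_real \<rho> * sol v (l + 1) + cnj (\<alpha> l) * sol v l)"
      unfolding resolvent_kernel_odd[OF False] r by (simp add: algebra_simps)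
    then show ?thesis unfolding two_term_odd[OF l False] next_term_odd[OF l False] by simp
  qed
qed

lemma left_row:
  "ker a (a - 1) * sol (1, - \<beta>) (a - 1) + ker a a * sol (1, - \<beta>) a + ker a (a + 1) * sol (1, - \<beta>) (a + 1) = 0"
proof -
  have r: "cmv_rho t (a - 1) = 0" "cmv_rho t a = \<rho>" "t (a - 1) = \<beta>" "t a = \<alpha> a"
    using ab by (auto intro!: rho_simps t_simps)
  have a0: "a = a + int 0" by simp
  show ?thesis
  proof (cases "even a")
    case True
    have "sol (1, - \<beta>) a = 1" using True sol_at[of "(1, - \<beta>)" 0] by simp
    then show ?thesis
      using next_term_even[OF a0 True, of "(1, - \<beta>)"]
      unfolding resolvent_kernel_even[OF True] r by (simp add: algebra_simps)
  next
    case False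
    have s: "sol (1, - \<beta>) a = - \<beta>" using False sol_at[of "(1, - \<beta>)" 0] by simp
    have "of_real \<rho> * sol (1, - \<beta>) (a + 1) = z + cnj (\<alpha> a) * \<beta>"
      using next_term_odd[OF a0 False, of "(1, - \<beta>)"] s by simp
    then show ?thesis
      unfolding resolvent_kernel_odd[OF False] r s using bb by (simp add: algebra_simps)
  qed
qed

lemma right_row:
  "ker b (b - 1) * sol v (b - 1) + ker b b * sol v b
   = phase a z \<rho> k * (if even b then \<beta>' else 1) *
     (z * fst (szego c z v k) - cnj \<beta>' * snd (szego c z v k))"
proof -
  obtain i where b: "b = a + int (Suc i)" using ab by (rule site_cases)
  have "nat (b - a) = Suc i" using b by simp
  then have k: "k = Suc i" by (simp only: k_def)
  have r: "cmv_rho t (b - 1) = \<rho>" "t b = \<beta>'" "t (b - 1) = \<alpha> (b - 1)"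
    using ab by (auto intro!: rho_simps t_simps)
  have sb: "sol v b = phase a z \<rho> k * (if even b then fst (szego c z v k) else snd (szego c z v k))"
    using sol_at[of v "Suc i"] b k by simp
  show ?thesis
  proof (cases "even b")
    case True
    have "ker b (b - 1) * sol v (b - 1) + ker b b * sol v b
      = (- of_real \<rho> * sol v (b - 1) + \<alpha> (b - 1) * sol v b) + z * \<beta>' * sol v b"
      unfolding resolvent_kernel_even[OF True] r by (simp add: algebra_simps)
    also have "\<dots> = phase a z \<rho> k * (z * \<beta>' * fst (szego c z v k) - (\<beta>' * cnj \<beta>') * snd (szego c z v k))"
      unfolding two_term_even[OF b True] unfolding sb k[symmetric] bb using True by (simp add: algebra_simps)
    finally show ?thesis using True by (simp add: algebra_simps)
  next
    case False
    have "ker b (b - 1) * sol v (b - 1) + ker b b * sol v b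
      = (z * of_real \<rho> * sol v (b - 1) - z * cnj (\<alpha> (b - 1)) * sol v b) - cnj \<beta>' * sol v b"
      unfolding resolvent_kernel_odd[OF False] r by (simp add: algebra_simps)
    also have "\<dots> = phase a z \<rho> k * (z * fst (szego c z v k) - cnj \<beta>' * snd (szego c z v k))"
      unfolding two_term_odd[OF b False] unfolding sb k[symmetric] using False by (simp add: algebra_simps)
    finally show ?thesis using False by simp
  qed
qed

text \<open>
  The right boundary condition, pulled back to the site with index \<open>i\<close>.
\<close>

definition row_functional :: "nat \<Rightarrow> complex \<times> complex \<Rightarrow> complex" where
  "row_functional i v = z * fst (szego (\<lambda>j. c (i + j)) z v (k - i)) - cnj \<beta>' * snd (szego (\<lambda>j. c (i + j)) z v (k - i))"

definition D :: complex where "D = row_functional 0 (1, - \<beta>)"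

lemma szego_compose: "szego e z v (i + j) = szego (\<lambda>l. e (i + l)) z (szego e z v i) j"
  by (induction j) simp_all

lemma row_functional_shift:
  assumes "i \<le> k"
  shows "row_functional 0 v = row_functional i (szego c z v i)"
  using szego_compose[of c v i "k - i"] assms by (simp add: row_functional_def)

lemma row_functional_linear:
  "row_functional i (p, r) = p * row_functional i (1, 0) + r * row_functional i (0, 1)"
  by (simp add: row_functional_def szego_linear[of _ z p r] q0_def q1_def algebra_simps)

text \<open>
  The initial value annihilated by the right boundary condition.
\<close>

definition vinit :: "complex \<times> complex" where
  "vinit = (- row_functional 0 (0, 1), row_functional 0 (1, 0))"

text \<open>
  Each step multiplies the Wronskian of two solutions by the determinant of the Szego matrix.
\<close>

lemma szego_cross:
  "fst (szego e z v i) * snd (szego e z w i) - snd (szego e z v i) * fst (szego e z w i)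
    = z ^ i * (\<Prod>j<i. 1 - e j * cnj (e j)) * (fst v * snd w - snd v * fst w)"
proof (induction i)
  case (Suc i)
  have step: "(z * p - ac * r) * (r' - an * (z * p')) - (r - an * (z * p)) * (z * p' - ac * r') = z * (1 - an * ac) * (p * r' - r * p')"
    for p r p' r' ac an :: complex by (simp add: algebra_simps)
  show ?case unfolding szego.simps fst_conv snd_conv step Suc
    by (simp add: mult_ac)
qed simp

lemma c_prod: "(\<Prod>j<i. 1 - c j * cnj (c j)) = of_real \<rho> ^ (2 * i)"
proof -
  have "(\<Prod>j<i. 1 - c j * cnj (c j)) = (\<Prod>j<i. of_real \<rho> ^ 2)"
    by (simp add: c_def cc[symmetric])
  then show ?thesis by (simp add: power_mult)
qed

text \<open>
  Evaluates the right solution from the right end: it is given by the transfer matrix from \<open>i\<close> to the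
  right end, not by the one from the left end, which would be exponentially too large.
\<close>

lemma vinit_row:
  assumes i: "i \<le> k"
  shows "szego c z vinit i = (z ^ i * of_real \<rho> ^ (2 * i) * (- row_functional i (0, 1)),
     z ^ i * of_real \<rho> ^ (2 * i) * row_functional i (1, 0))"
proof -
  define P1 R1 P0 R0 where "P1 = fst (szego c z (1, 0) i)" and "R1 = snd (szego c z (1, 0) i)"
    and "P0 = fst (szego c z (0, 1) i)" and "R0 = snd (szego c z (0, 1) i)"
  define f1 f0 where "f1 = row_functional i (1, 0)" and "f0 = row_functional i (0, 1)"
  have F1: "row_functional 0 (1, 0) = P1 * f1 + R1 * f0"
    using row_functional_shift[OF i, of "(1, 0)"] row_functional_linear[of i P1 R1]
    by (simp add: P1_def R1_def f1_def f0_def)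
  have F0: "row_functional 0 (0, 1) = P0 * f1 + R0 * f0"
    using row_functional_shift[OF i, of "(0, 1)"] row_functional_linear[of i P0 R0]
    by (simp add: P0_def R0_def f1_def f0_def)
  have lin: "szego c z vinit i = (- row_functional 0 (0, 1) * P1 + row_functional 0 (1, 0) * P0,
     - row_functional 0 (0, 1) * R1 + row_functional 0 (1, 0) * R0)"
    using szego_linear[of c z "- row_functional 0 (0, 1)" "row_functional 0 (1, 0)" i]
    by (intro prod_eqI) (simp_all add: vinit_def P1_def P0_def R1_def R0_def q0_def q1_def)
  have d: "P1 * R0 - R1 * P0 = z ^ i * of_real \<rho> ^ (2 * i)"
    using szego_cross[of c "(1, 0)" i "(0, 1)"] c_prod[of i] by (simp add: P1_def P0_def R1_def R0_def)
  have "- row_functional 0 (0, 1) * P1 + row_functional 0 (1, 0) * P0 = (P1 * R0 - R1 * P0) * (- f0)"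
    unfolding F1 F0 by (simp add: algebra_simps)
  moreover have "- row_functional 0 (0, 1) * R1 + row_functional 0 (1, 0) * R0 = (P1 * R0 - R1 * P0) * f1"
    unfolding F1 F0 by (simp add: algebra_simps)
  ultimately show ?thesis unfolding lin d f1_def f0_def by simp
qed

lemma right_row_vinit: "ker b (b - 1) * sol vinit (b - 1) + ker b b * sol vinit b + ker b (b + 1) * sol vinit (b + 1) = 0"
proof -
  have "ker b (b + 1) = 0"
    by (cases "even b") (simp_all add: resolvent_kernel_even resolvent_kernel_odd rho_simps)
  moreover have "z * fst (szego c z vinit k) - cnj \<beta>' * snd (szego c z vinit k) = 0"
    unfolding vinit_row[OF order_refl] by (simp add: row_functional_def)
  ultimately show ?thesis by (simp add: right_row)
qed

definition W :: complex where "W = (if even a then 1 else z) * D"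

lemma phase_square:
  "phase a z \<rho> i * phase a z \<rho> i * (z ^ i * of_real \<rho> ^ (2 * i)) * (if even (a + int i) then 1 else z)
    = (if even a then 1 else z)"
proof (induction i)
  case (Suc i)
  have "phase a z \<rho> (Suc i) * phase a z \<rho> (Suc i) * (z ^ Suc i * of_real \<rho> ^ (2 * Suc i)) * (if even (a + int (Suc i)) then 1 else z)
    = phase a z \<rho> i * phase a z \<rho> i * (z ^ i * of_real \<rho> ^ (2 * i)) * (if even (a + int i) then 1 else z)"
    using \<rho> z0 by (cases "even (a + int i)") (simp_all add: field_simps power2_eq_square)
  then show ?case using Suc by simp
qed simp

abbreviation "u \<equiv> sol (1, - \<beta>)"
abbreviation "v \<equiv> sol vinit"

lemma cross_value:
  "fst (szego c z (1, - \<beta>) i) * snd (szego c z vinit i) - snd (szego c z (1, - \<beta>) i) * fst (szego c z vinit i)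
    = z ^ i * of_real \<rho> ^ (2 * i) * D"
proof -
  have e: "1 * snd vinit - (- \<beta>) * fst vinit = D"
    using row_functional_linear[of 0 1 "- \<beta>"] by (simp add: vinit_def D_def)
  show ?thesis using szego_cross[of c "(1, - \<beta>)" i vinit] unfolding c_prod fst_conv snd_conv e .
qed

text \<open>
  The powers of \<open>z\<close> and \<open>\<rho>\<close> in \<open>phase\<close> cancel those in \<open>szego_cross\<close>, so that the Wronskian is constant
  along the box and has the modulus of \<open>D\<close>.
\<close>

lemma wronskian_row:
  assumes "a \<le> l" "l \<le> b"
  shows "ker l (l - 1) * (u (l - 1) * v l) + ker l l * (u l * v l) + ker l (l + 1) * (u l * v (l + 1)) = W"
proof (cases "l = b")
  case True
  have b0: "ker b (b + 1) = 0"
    by (cases "even b") (simp_all add: resolvent_kernel_even resolvent_kernel_odd rho_simps)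
  have b: "b = a + int k" using ab by (simp add: k_def)
  have vb: "(if even b then \<beta>' else 1) * v b = phase a z \<rho> k * (z ^ k * of_real \<rho> ^ (2 * k)) * (if even b then 1 else z)"
    using sol_at[of vinit k] bb unfolding b[symmetric] vinit_row[OF order_refl]
    by (simp add: row_functional_def mult_ac)
  have D': "D = z * fst (szego c z (1, - \<beta>) k) - cnj \<beta>' * snd (szego c z (1, - \<beta>) k)"
    by (simp add: D_def row_functional_def)
  have "ker b (b - 1) * (u (b - 1) * v b) + ker b b * (u b * v b) + ker b (b + 1) * (u b * v (b + 1))
     = (ker b (b - 1) * u (b - 1) + ker b b * u b) * v b" using b0 by (simp add: algebra_simps)
  also have "\<dots> = phase a z \<rho> k * D * ((if even b then \<beta>' else 1) * v b)"
    unfolding right_row D'[symmetric] by (simp add: mult_ac)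
  also have "\<dots> = phase a z \<rho> k * phase a z \<rho> k * (z ^ k * of_real \<rho> ^ (2 * k)) * (if even b then 1 else z) * D"
    unfolding vb by (simp only: mult_ac)
  also have "\<dots> = W" using phase_square[of k] unfolding b[symmetric] W_def by simp
  finally show ?thesis using True by simp
next
  case False
  then have lb: "l < b" using assms by simp
  have U: "ker l (l - 1) * u (l - 1) + ker l l * u l + ker l (l + 1) * u (l + 1) = 0"
    using interior_row[of l] left_row assms lb by (cases "l = a") auto
  define i where "i = nat (l - a)"
  have l: "l = a + int i" using assms by (simp add: i_def)
  have r: "cmv_rho t l = \<rho>" using assms lb by (intro rho_simps) auto
  have "ker l (l - 1) * (u (l - 1) * v l) + ker l l * (u l * v l) + ker l (l + 1) * (u l * v (l + 1))
     = (ker l (l - 1) * u (l - 1) + ker l l * u l + ker l (l + 1) * u (l + 1)) * v l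
       + (u l * (ker l (l + 1) * v (l + 1)) - (ker l (l + 1) * u (l + 1)) * v l)"
    by (simp add: algebra_simps)
  also have "\<dots> = u l * (ker l (l + 1) * v (l + 1)) - (ker l (l + 1) * u (l + 1)) * v l" unfolding U by simp
  also have "\<dots> = phase a z \<rho> i * phase a z \<rho> i * (if even l then 1 else z) *
     (fst (szego c z (1, - \<beta>) i) * snd (szego c z vinit i) - snd (szego c z (1, - \<beta>) i) * fst (szego c z vinit i))"
  proof (cases "even l")
    case True
    have e: "sol w l = phase a z \<rho> i * fst (szego c z w i)" for w using sol_at[of w i] True l by simp
    show ?thesis using True
      unfolding resolvent_kernel_even[OF True] r next_term_even[OF l True] e by (simp add: algebra_simps)
  next
    case False
    have e: "sol w l = phase a z \<rho> i * snd (szego c z w i)" for w using sol_at[of w i] False l by simp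
    have k: "ker l (l + 1) * sol w (l + 1) = - (phase a z \<rho> i * (z * fst (szego c z w i)) - cnj (\<alpha> l) * sol w l)" for w
      unfolding resolvent_kernel_odd[OF False] r using next_term_odd[OF l False, of w] by simp
    show ?thesis using False unfolding k e by (simp add: algebra_simps)
  qed
  also have "\<dots> = phase a z \<rho> i * phase a z \<rho> i * (z ^ i * of_real \<rho> ^ (2 * i)) * (if even (a + int i) then 1 else z) * D"
    unfolding cross_value l by (simp only: mult_ac)
  also have "\<dots> = W" unfolding phase_square W_def ..
  finally show ?thesis .
qed

lemma green_kernel:
  assumes D: "D \<noteq> 0" and l: "l \<in> {a..b}" and m: "m \<in> {a..b}"
  shows "(\<Sum>k\<in>{a..b}. ker l k * (u (min k m) * v (max k m) / W)) = (if l = m then 1 else 0)"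
proof (rule tridiagonal_green[OF _ _ _ _ _ _ _ l m])
  show "ker a (a - 1) = 0"
    by (cases "even a") (simp_all add: resolvent_kernel_even resolvent_kernel_odd rho_simps)
  show "ker b (b + 1) = 0"
    by (cases "even b") (simp_all add: resolvent_kernel_even resolvent_kernel_odd rho_simps)
  show "W \<noteq> 0" using D z0 by (simp add: W_def)
  show "ker l (l - 1) * u (l - 1) + ker l l * u l + ker l (l + 1) * u (l + 1) = 0" if "a \<le> l" "l < b" for l
    using interior_row[of l] left_row that by (cases "l = a") auto
  show "ker l (l - 1) * v (l - 1) + ker l l * v l + ker l (l + 1) * v (l + 1) = 0" if "a < l" "l \<le> b" for l
    using interior_row[of l] right_row_vinit that by (cases "l = b") auto
qed (auto intro: resolvent_kernel_zero wronskian_row)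

lemma q0_dominates: "cmod (q1 (\<lambda>j. c (i + j)) z n) \<le> cmod (q0 (\<lambda>j. c (i + j)) z n)"
proof -
  have "(cmod (q0 (\<lambda>j. c (i + j)) z n))\<^sup>2 - (cmod (q1 (\<lambda>j. c (i + j)) z n))\<^sup>2 = (\<rho> ^ n)\<^sup>2"
    by (rule q0_q1_norms[OF z]) (simp add: c_def \<alpha>)
  then have "(cmod (q1 (\<lambda>j. c (i + j)) z n))\<^sup>2 \<le> (cmod (q0 (\<lambda>j. c (i + j)) z n))\<^sup>2"
    using zero_le_power2[of "\<rho> ^ n"] by linarith
  then show ?thesis by (rule power2_le_imp_le) simp
qed

lemma szego_bound:
  fixes p r :: complex
  assumes "cmod p \<le> 1" "cmod r \<le> 1"
  shows "cmod (fst (szego (\<lambda>j. c (i + j)) z (p, r) n)) \<le> 2 * cmod (q0 (\<lambda>j. c (i + j)) z n)"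
    and "cmod (snd (szego (\<lambda>j. c (i + j)) z (p, r) n)) \<le> 2 * cmod (q0 (\<lambda>j. c (i + j)) z n)"
proof -
  define Q0 Q1 where "Q0 = q0 (\<lambda>j. c (i + j)) z n" and "Q1 = q1 (\<lambda>j. c (i + j)) z n"
  have Q: "cmod Q1 \<le> cmod Q0" unfolding Q0_def Q1_def by (rule q0_dominates)
  have zn: "cmod (z ^ n) = 1" using z by (simp add: norm_power)
  have comb: "cmod (p * x + r * y) \<le> 2 * cmod Q0" if "cmod x \<le> cmod Q0" "cmod y \<le> cmod Q0" for x y
  proof -
    have "cmod (p * x) \<le> 1 * cmod Q0" "cmod (r * y) \<le> 1 * cmod Q0"
      unfolding norm_mult by (intro mult_mono assms that zero_le_one norm_ge_zero)+
    then show ?thesis using norm_triangle_ineq[of "p * x" "r * y"] by linarith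
  qed
  show "cmod (fst (szego (\<lambda>j. c (i + j)) z (p, r) n)) \<le> 2 * cmod Q0"
    unfolding szego_linear[of _ z p r] szego_conjugate[OF z]
    by (rule comb) (use Q zn in \<open>auto simp: norm_mult Q0_def Q1_def\<close>)
  show "cmod (snd (szego (\<lambda>j. c (i + j)) z (p, r) n)) \<le> 2 * cmod Q0"
    unfolding szego_linear[of _ z p r] by (rule comb) (use Q in \<open>auto simp: Q0_def Q1_def\<close>)
qed

text \<open>
  The left solution contributes $\rho^{-i}$, the right one $\rho^{-j} \rho^{2j}$; together they
  give the decay $\rho^{j - i}$.
\<close>

lemma green_kernel_bound:
  assumes Q: "\<And>i n. i + n \<le> k \<Longrightarrow> cmod (q0 (\<lambda>j. c (i + j)) z n) \<le> Q" and D: "D \<noteq> 0"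
    and lm: "a \<le> l" "l \<le> m" "m \<le> b"
  shows "cmod (u l * v m / W) \<le> 8 * Q\<^sup>2 / cmod D * \<rho> ^ nat (m - l)"
proof -
  define i j where "i = nat (l - a)" and "j = nat (m - a)"
  have l: "l = a + int i" and m: "m = a + int j" and ij: "i \<le> j" "j \<le> k"
    using lm by (simp_all add: i_def j_def k_def)
  have Q0: "0 \<le> Q" using order_trans[OF norm_ge_zero Q[of 0 0]] by simp
  have "cmod (u l) \<le> 1 / \<rho> ^ i * (2 * Q)"
  proof -
    have "cmod (fst (szego c z (1, - \<beta>) i)) \<le> 2 * Q" "cmod (snd (szego c z (1, - \<beta>) i)) \<le> 2 * Q"
      using szego_bound[of 1 "- \<beta>" 0 i] Q[of 0 i] ij \<beta> by auto
    then show ?thesis unfolding l sol_at norm_mult phase_norm[OF z \<rho>]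
      using \<rho> by (intro mult_left_mono) auto
  qed
  moreover have "cmod (v m) \<le> \<rho> ^ j * (4 * Q)"
  proof -
    have f: "cmod (row_functional j (p, r)) \<le> 4 * Q" if "cmod p \<le> 1" "cmod r \<le> 1" for p r
    proof -
      have "cmod (row_functional j (p, r)) \<le> cmod (z * fst (szego (\<lambda>i. c (j + i)) z (p, r) (k - j)))
          + cmod (cnj \<beta>' * snd (szego (\<lambda>i. c (j + i)) z (p, r) (k - j)))"
        unfolding row_functional_def by (rule norm_triangle_ineq4)
      also have "\<dots> \<le> 2 * Q + 2 * Q"
        using szego_bound[OF that, of j "k - j"] Q[of j "k - j"] ij z \<beta>' by (intro add_mono) (auto simp: norm_mult)
      finally show ?thesis by simp
    qed
    have pr: "cmod (z ^ j * of_real \<rho> ^ (2 * j)) = \<rho> ^ (2 * j)"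
      using z \<rho> by (simp add: norm_mult norm_power)
    have "cmod (v m) = 1 / \<rho> ^ j * (\<rho> ^ (2 * j) * cmod (if even m then - row_functional j (0, 1) else row_functional j (1, 0)))"
      unfolding m sol_at vinit_row[OF ij(2)] norm_mult[of "phase _ _ _ _"] phase_norm[OF z \<rho>]
      using pr by (simp add: norm_mult)
    also have "\<dots> \<le> 1 / \<rho> ^ j * (\<rho> ^ (2 * j) * (4 * Q))"
      using f[of 0 1] f[of 1 0] \<rho> by (intro mult_left_mono) auto
    also have "\<dots> = \<rho> ^ j * (4 * Q)" using \<rho> by (simp add: mult_2 power_add)
    finally show ?thesis .
  qed
  ultimately have "cmod (u l) * cmod (v m) \<le> (1 / \<rho> ^ i * (2 * Q)) * (\<rho> ^ j * (4 * Q))"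
    using Q0 \<rho> by (intro mult_mono) auto
  also have "\<dots> = 8 * Q\<^sup>2 * (\<rho> ^ j / \<rho> ^ i)" by (simp add: power2_eq_square)
  also have "\<rho> ^ j / \<rho> ^ i = \<rho> ^ nat (m - l)"
    using \<rho> ij by (simp add: l m power_diff[symmetric] nat_diff_distrib)
  finally have "cmod (u l) * cmod (v m) / cmod D \<le> 8 * Q\<^sup>2 * \<rho> ^ nat (m - l) / cmod D"
    by (intro divide_right_mono) auto
  moreover have "cmod W = cmod D" using z by (simp add: W_def norm_mult)
  ultimately show ?thesis by (simp add: norm_mult norm_divide)
qed

lemma L_row_sum:
  assumes i: "i \<in> {a..b}" and j: "j \<in> {a..b}"
  shows "(\<Sum>k\<in>{a..b}. cmv_L t i k * cnj (cmv_L t j k)) = (if i = j then 1 else 0)"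
proof -
  define n where "n = (if even i then i else i - 1)"
  have n: "even n" "i = n \<or> i = n + 1" "n \<in> {a-1..b}" using i by (auto simp: n_def)
  define f where "f k = cmv_L t i k * cnj (cmv_L t j k)" for k
  have out: "f k = 0" if "k \<notin> {n, n + 1}" for k
    using that by (auto simp: f_def cmv_L_def cmv_Theta_def n_def[symmetric])
  have fe: "f k = 0" if k: "k \<in> {n, n + 1}" "k \<notin> {a..b}" for k
  proof -
    have "(k = a - 1 \<and> n = a - 1 \<and> i = a) \<or> (k = b + 1 \<and> n = b \<and> i = b)" using k i n by auto
    then have "cmv_L t i k = 0"
      using rho_simps(1,2) n(1) by (auto simp: cmv_L_def cmv_Theta_def)
    then show ?thesis by (simp add: f_def)
  qed
  have "(\<Sum>k\<in>{a..b}. f k) = (\<Sum>k\<in>{a..b} \<inter> {n, n + 1}. f k)"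
    by (rule sum.mono_neutral_right) (use out in auto)
  also have "\<dots> = (\<Sum>k\<in>{n, n + 1}. f k)"
  proof (rule sum.mono_neutral_left)
    show "\<forall>k\<in>{n, n + 1} - {a..b} \<inter> {n, n + 1}. f k = 0"
    proof
      fix k assume "k \<in> {n, n + 1} - {a..b} \<inter> {n, n + 1}"
      then show "f k = 0" by (intro fe) auto
    qed
  qed auto
  also have "\<dots> = f n + f (n + 1)" by simp
  also have "\<dots> = (if i = j then 1 else 0)"
  proof -
    have rr: "of_real (cmv_rho t n) * of_real (cmv_rho t n) + t n * cnj (t n) = (1::complex)"
    proof -
      have le: "(cmod (t n))\<^sup>2 \<le> 1"
      proof -
        consider "n = a - 1" | "n = b" | "n \<noteq> a - 1" "n \<noteq> b" by blast
        then show ?thesis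
          by cases (simp_all add: t_simps(1,2) t_simps(3) \<beta> \<beta>' \<alpha>)
      qed
      have "(cmv_rho t n)\<^sup>2 = 1 - (cmod (t n))\<^sup>2" using le by (simp add: cmv_rho_def)
      then have "complex_of_real ((cmv_rho t n)\<^sup>2 + (cmod (t n))\<^sup>2) = 1" by simp
      then show ?thesis by (simp only: of_real_add complex_norm_square) (simp add: power2_eq_square)
    qed
    have bi: "cmv_L t i k = cmv_Theta t n i k" for k by (simp add: cmv_L_def n_def)
    show ?thesis
    proof (cases "j = n \<or> j = n + 1")
      case True
      have bj: "cmv_L t j k = cmv_Theta t n j k" for k using True n(1) by (auto simp: cmv_L_def)
      show ?thesis using True n(2) rr unfolding f_def bi bj
        by (auto simp: cmv_Theta_def algebra_simps)
    next
      case False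
      have "cmv_L t j n = 0" "cmv_L t j (n + 1) = 0"
        using False n(1) by (auto simp: cmv_L_def cmv_Theta_def split: if_splits)
      then show ?thesis using False n(2) by (auto simp: f_def)
    qed
  qed
  finally show ?thesis by (simp add: f_def)
qed

text \<open>
  Since \<open>L\<close> is unitary, $E - z = - L (z L^* - M)$, so the inverse of $E - z$ is $- G L^*$ with the kernel
  \<open>G\<close> just bounded.
\<close>

lemma resolvent_bounds:
  assumes Q: "\<And>i n. i + n \<le> k \<Longrightarrow> cmod (q0 (\<lambda>j. c (i + j)) z n) \<le> Q" and D: "D \<noteq> 0" and \<rho>1: "\<rho> \<le> 1"
  defines "n \<equiv> nat (b - a + 1)"
  shows "invertible_mat (cmv_E_box_minus \<alpha> \<beta> \<beta>' a b z)"
    and "l2_op_norm (mat_inv (cmv_E_box_minus \<alpha> \<beta> \<beta>' a b z)) \<le> (real n)\<^sup>2 * (real n * (8 * Q\<^sup>2 / cmod D))"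
    and "\<And>l m. l \<in> {a..b} \<Longrightarrow> m \<in> {a..b} \<Longrightarrow>
      cmod (green \<alpha> \<beta> \<beta>' a b z l m) \<le> 8 * Q\<^sup>2 / cmod D * \<rho> ^ nat \<bar>l - m\<bar>"
proof -
  define g where "g l m = u (min l m) * v (max l m) / W" for l m
  define L M A G where "L = restrict_op (cmv_L t) a b" and "M = restrict_op (cmv_M t) a b"
    and "A = restrict_op ker a b" and "G = restrict_op g a b"
  have car: "L \<in> carrier_mat n n" "M \<in> carrier_mat n n" "A \<in> carrier_mat n n" "G \<in> carrier_mat n n"
    by (simp_all add: L_def M_def A_def G_def n_def)
  have boxL: "cmv_L_box \<alpha> \<beta> \<beta>' a b = L" and boxM: "cmv_M_box \<alpha> \<beta> \<beta>' a b = M"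
    by (simp_all add: cmv_L_box_def cmv_M_box_def L_def M_def t_def)
  define Lad where "Lad = mat_adjoint L"
  have Lad: "Lad = restrict_op (\<lambda>i j. cnj (cmv_L t j i)) a b"
    by (simp add: Lad_def L_def restrict_op_adjoint)
  have Ladc: "Lad \<in> carrier_mat n n" by (simp add: Lad n_def)
  have A: "z \<cdot>\<^sub>m Lad - M = A"
    unfolding Lad M_def A_def restrict_op_resolvent by (simp add: resolvent_kernel_def[abs_def])
  have AG: "A * G = 1\<^sub>m n"
    unfolding A_def G_def restrict_op_mult n_def restrict_op_one[symmetric] g_def
    by (rule restrict_op_cong) (rule green_kernel[OF D])
  have LL: "L * Lad = 1\<^sub>m n"
    unfolding L_def Lad restrict_op_mult n_def restrict_op_one[symmetric]
    by (rule restrict_op_cong) (rule L_row_sum)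
  have gb: "cmod (g l m) \<le> 8 * Q\<^sup>2 / cmod D * \<rho> ^ nat \<bar>l - m\<bar>" if "l \<in> {a..b}" "m \<in> {a..b}" for l m
  proof (cases "l \<le> m")
    case True
    then have e: "min l m = l" "max l m = m" "nat \<bar>l - m\<bar> = nat (m - l)" by auto
    show ?thesis unfolding g_def e by (rule green_kernel_bound[OF Q D]) (use True that in auto)
  next
    case False
    then have e: "min l m = m" "max l m = l" "nat \<bar>l - m\<bar> = nat (l - m)" by auto
    show ?thesis unfolding g_def e by (rule green_kernel_bound[OF Q D]) (use False that in auto)
  qed
  show "cmod (green \<alpha> \<beta> \<beta>' a b z l m) \<le> 8 * Q\<^sup>2 / cmod D * \<rho> ^ nat \<bar>l - m\<bar>"
    if "l \<in> {a..b}" "m \<in> {a..b}" for l m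
  proof -
    have "green \<alpha> \<beta> \<beta>' a b z l m = G $$ (nat (l - a), nat (m - a))"
      unfolding green_def boxL boxM Lad_def[symmetric] A
      using mat_inv_eqI(1)[OF car(3,4) AG] by simp
    also have "\<dots> = g l m" using that by (simp add: G_def)
    finally show ?thesis using gb[OF that] by simp
  qed
  define E where "E = cmv_E_box_minus \<alpha> \<beta> \<beta>' a b z"
  define Y where "Y = (-1) \<cdot>\<^sub>m (G * Lad)"
  have Ec: "E \<in> carrier_mat n n"
    unfolding E_def cmv_E_box_minus_def cmv_E_box_def boxL boxM n_def[symmetric]
    by (intro minus_carrier_mat) simp
  have Yc: "Y \<in> carrier_mat n n" using car Ladc by (simp add: Y_def)
  have LA: "L * A = z \<cdot>\<^sub>m 1\<^sub>m n - L * M"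
    unfolding A[symmetric] using car Ladc LL
    by (simp add: mult_minus_distrib_mat[of L n n _ n] mult_smult_distrib[of L n n Lad n])
  have E: "E = (-1) \<cdot>\<^sub>m (L * A)"
    unfolding LA E_def cmv_E_box_minus_def cmv_E_box_def boxL boxM n_def[symmetric]
    by (rule eq_matI) (use car in auto)
  have "E * Y = (-1) \<cdot>\<^sub>m ((-1) \<cdot>\<^sub>m ((L * A) * (G * Lad)))"
    unfolding E Y_def using car Ladc
    by (simp add: mult_smult_assoc_mat[of "L * A" n n _ n] mult_smult_distrib[of "L * A" n n _ n])
  also have "(L * A) * (G * Lad) = L * ((A * G) * Lad)"
    using car Ladc by (simp add: assoc_mult_mat[of _ n n _ n _ n])
  also have "\<dots> = 1\<^sub>m n" unfolding AG using Ladc LL by simp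
  also have "(-1) \<cdot>\<^sub>m ((-1) \<cdot>\<^sub>m 1\<^sub>m n) = (1\<^sub>m n :: complex mat)" by (rule eq_matI) auto
  finally have EY: "E * Y = 1\<^sub>m n" .
  note inv = mat_inv_eqI[OF Ec Yc EY]
  show "invertible_mat (cmv_E_box_minus \<alpha> \<beta> \<beta>' a b z)" using inv(2) by (simp add: E_def)
  define B where "B = 8 * Q\<^sup>2 / cmod D"
  have B0: "0 \<le> B" by (simp add: B_def)
  have "cmod (Y $$ (i, j)) \<le> real n * B" if ij: "i < n" "j < n" for i j
  proof -
    have Gb: "cmod (G $$ (i, m)) \<le> B" if m: "m < n" for m
    proof -
      have s: "a + int i \<in> {a..b}" "a + int m \<in> {a..b}" using ij m by (auto simp: n_def)
      have "cmod (g (a + int i) (a + int m)) \<le> B * \<rho> ^ nat \<bar>int i - int m\<bar>"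
        using gb[OF s] by (simp add: B_def)
      also have "\<dots> \<le> B * 1" using \<rho> \<rho>1 B0 by (intro mult_left_mono power_le_one) auto
      finally show ?thesis using ij m by (simp add: G_def n_def)
    qed
    have Lb: "cmod (Lad $$ (m, j)) \<le> 1" if m: "m < n" for m
    proof -
      have s: "a + int j \<in> {a..b}" "a + int m \<in> {a..b}" using ij m by (auto simp: n_def)
      have "complex_of_real ((\<Sum>k\<in>{a..b}. (cmod (cmv_L t (a + int j) k))\<^sup>2)) = 1"
        using L_row_sum[OF s(1) s(1)] by (simp only: of_real_sum complex_norm_square) simp
      then have "(\<Sum>k\<in>{a..b}. (cmod (cmv_L t (a + int j) k))\<^sup>2) = 1" by (simp only: of_real_eq_1_iff)
      then have "(cmod (cmv_L t (a + int j) (a + int m)))\<^sup>2 \<le> 1"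
        using member_le_sum[of "a + int m" "{a..b}" "\<lambda>k. (cmod (cmv_L t (a + int j) k))\<^sup>2"] s by simp
      then show ?thesis using ij m by (simp add: Lad n_def abs_square_le_1)
    qed
    have "Y $$ (i, j) = - (\<Sum>m\<in>{0..<n}. G $$ (i, m) * Lad $$ (m, j))"
      using ij car Ladc by (simp add: Y_def scalar_prod_def)
    then have "cmod (Y $$ (i, j)) \<le> (\<Sum>m\<in>{0..<n}. cmod (G $$ (i, m) * Lad $$ (m, j)))"
      by (simp add: norm_sum)
    also have "\<dots> \<le> (\<Sum>m\<in>{0..<n}. B * 1)"
      unfolding norm_mult using Gb Lb B0 by (intro sum_mono mult_mono) auto
    finally show ?thesis by simp
  qed
  then have "l2_op_norm Y \<le> (real n)\<^sup>2 * (real n * B)"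
    using B0 by (intro l2_op_norm_le[OF Yc]) auto
  then show "l2_op_norm (mat_inv (cmv_E_box_minus \<alpha> \<beta> \<beta>' a b z)) \<le> (real n)\<^sup>2 * (real n * (8 * Q\<^sup>2 / cmod D))"
    using inv(1) by (simp add: E_def B_def)
qed

end

section \<open>The skew-shift on the torus and its lift\<close>

text \<open>
  A real lift of the iterate \<open>n\<close>, coordinate \<open>l\<close>, which is affine in the starting point and hence
  measurable; negative \<open>n\<close> are included without inverting the map.
\<close>

primrec skew_lift :: "real \<Rightarrow> (nat \<Rightarrow> real) \<Rightarrow> nat \<Rightarrow> int \<Rightarrow> real" where
  "skew_lift \<omega> x 0 n = \<omega>"
| "skew_lift \<omega> x (Suc l) n = x (Suc l) +
     (if 0 \<le> n then \<Sum>m\<in>{0..<n}. skew_lift \<omega> x l m else - (\<Sum>m\<in>{n..<0}. skew_lift \<omega> x l m))"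

lemma skew_lift_step: "skew_lift \<omega> x (Suc l) (n + 1) = skew_lift \<omega> x (Suc l) n + skew_lift \<omega> x l n"
proof -
  consider "0 \<le> n" | "n = - 1" | "n < - 1" by linarith
  then show ?thesis
  proof cases
    case 1
    then have "{0..<n + 1} = insert n {0..<n}" by auto
    then show ?thesis using 1 by simp
  next
    case 2
    have "{- 1..<0::int} = {- 1}" by auto
    then show ?thesis using 2 by simp
  next
    case 3
    then have "{n..<0} = insert n {n + 1..<0}" by auto
    then show ?thesis using 3 by simp
  qed
qed

lemma skew_lift_orbit: "skew_orbit \<omega> (\<lambda>n l. skew_lift \<omega> x l n)"
  unfolding skew_orbit_def by (intro conjI allI skew_lift_step) simp

lemma skew_lift_cong: "(\<And>i. 1 \<le> i \<Longrightarrow> i \<le> l \<Longrightarrow> x i = x' i) \<Longrightarrow> skew_lift \<omega> x l n = skew_lift \<omega> x' l n"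
proof (induction l arbitrary: n)
  case (Suc l)
  then have "skew_lift \<omega> x l m = skew_lift \<omega> x' l m" for m by simp
  then show ?case using Suc.prems by simp
qed simp

lemma skew_lift_last:
  assumes "r \<ge> 1"
  shows "skew_lift \<omega> (x(r := s)) r n = s + skew_lift \<omega> (x(r := 0)) r n"
proof -
  obtain l where r: "r = Suc l" using assms by (cases r) auto
  have "skew_lift \<omega> (x(r := s)) l m = skew_lift \<omega> (x(r := 0)) l m" for m
    by (rule skew_lift_cong) (auto simp: r)
  then show ?thesis by (simp add: r)
qed

lemma skew_lift_last_but_one:
  assumes "r \<ge> 2"
  shows "skew_lift \<omega> (x(r - 1 := s)) r n = of_int n * s + skew_lift \<omega> (x(r - 1 := 0)) r n"
proof -
  obtain l where r: "r = Suc (Suc l)" using assms by (cases r; cases "r - 1") auto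
  have e: "skew_lift \<omega> (x(Suc l := s)) (Suc l) m = s + skew_lift \<omega> (x(Suc l := 0)) (Suc l) m" for m
    using skew_lift_last[of "Suc l"] by simp
  have c: "(\<Sum>m\<in>{0..<n}. s + f m) = of_int n * s + (\<Sum>m\<in>{0..<n}. f m)" if "0 \<le> n" for f
    using that by (simp add: sum.distrib)
  have c': "- (\<Sum>m\<in>{n..<0}. s + f m) = of_int n * s - (\<Sum>m\<in>{n..<0}. f m)" if "\<not> 0 \<le> n" for f
    using that by (simp add: sum.distrib)
  show ?thesis
    unfolding r diff_Suc_1 skew_lift.simps(2)[of _ _ "Suc l"] e
    using c c' by (simp del: skew_lift.simps(2))
qed

lemma skew_iter_step:
  assumes "x \<in> torus r"
  shows "skew_iter \<omega> r n x \<in> torus r" "skew_iter \<omega> r (n + 1) x = skew_shift \<omega> r (skew_iter \<omega> r n x)"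
proof -
  note bij = bij_betw_skew_shift[of \<omega> r]
  define T S where "T = skew_shift \<omega> r" and "S = inv_into (torus r) T"
  have T: "T y \<in> torus r" if "y \<in> torus r" for y using bij that by (auto simp: bij_betw_def T_def)
  have S: "S y \<in> torus r" if "y \<in> torus r" for y
    using bij that unfolding S_def T_def by (intro inv_into_into) (auto simp: bij_betw_def)
  have TS: "T (S y) = y" if "y \<in> torus r" for y
    using bij_betw_inv_into_right[OF bij that] by (simp add: S_def T_def)
  have Tn: "(T ^^ k) x \<in> torus r" for k by (induction k) (auto simp: assms T)
  have Sn: "(S ^^ k) x \<in> torus r" for k by (induction k) (auto simp: assms S)
  have it: "skew_iter \<omega> r n = (if 0 \<le> n then T ^^ nat n else S ^^ nat (- n))" for n
    by (simp add: skew_iter_def T_def S_def)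
  show "skew_iter \<omega> r n x \<in> torus r" using Tn Sn by (simp add: it)
  show "skew_iter \<omega> r (n + 1) x = skew_shift \<omega> r (skew_iter \<omega> r n x)"
  proof (cases "0 \<le> n")
    case True
    then have "nat (n + 1) = Suc (nat n)" by simp
    then show ?thesis using True by (simp add: it T_def)
  next
    case False
    then have "nat (- n) = Suc (nat (- (n + 1)))" by simp
    then have e: "skew_iter \<omega> r n x = S ((S ^^ nat (- (n + 1))) x)" using False by (simp add: it)
    have "skew_iter \<omega> r (n + 1) x = (S ^^ nat (- (n + 1))) x"
      using False by (cases "n = - 1") (auto simp: it)
    then show ?thesis using TS[OF Sn] by (simp add: e T_def)
  qed
qed

lemma frac_minus_Ints: "frac (a::real) - a \<in> \<int>"
  by (simp add: frac_def)

lemma skew_iter_lift: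
  assumes x: "x \<in> torus r"
  shows "1 \<le> l \<Longrightarrow> l \<le> r \<Longrightarrow> skew_iter \<omega> r n x l - skew_lift \<omega> x l n \<in> \<int>"
proof (induction l arbitrary: n)
  case (Suc l)
  define S where "S n = skew_iter \<omega> r n x" for n
  define d where "d n = S n (Suc l) - skew_lift \<omega> x (Suc l) n" for n
  have S0: "S 0 = x" by (simp add: S_def skew_iter_def)
  have step: "d (n + 1) - d n \<in> \<int>" for n
  proof -
    have Sn: "S (n + 1) (Suc l) = frac (S n (Suc l) + (if l = 0 then \<omega> else S n l))"
      using skew_iter_step(2)[OF x, of \<omega> n] Suc.prems by (simp add: S_def skew_shift_def)
    have "(if l = 0 then \<omega> else S n l) - skew_lift \<omega> x l n \<in> \<int>"
      using Suc by (auto simp: S_def)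
    moreover have "frac (S n (Suc l) + (if l = 0 then \<omega> else S n l)) - (S n (Suc l) + (if l = 0 then \<omega> else S n l)) \<in> \<int>"
      by (rule frac_minus_Ints)
    moreover have "d (n + 1) - d n = (frac (S n (Suc l) + (if l = 0 then \<omega> else S n l)) - (S n (Suc l) + (if l = 0 then \<omega> else S n l)))
       + ((if l = 0 then \<omega> else S n l) - skew_lift \<omega> x l n)"
      unfolding d_def Sn skew_lift_step by simp
    ultimately show ?thesis by (simp only: Ints_add)
  qed
  have "d n \<in> \<int>"
  proof (induction n rule: int_induct[where k = 0])
    case base
    then show ?case by (simp add: d_def S0)
  next
    case (step1 i)
    then show ?case using Ints_add[OF step[of i] step1(2)] by simp
  next
    case (step2 i)
    then show ?case using Ints_diff[OF step2(2) step[of "i - 1"]] by simp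
  qed
  then show ?case by (simp add: d_def S_def)
qed simp

lemma skew_alpha_lift:
  assumes "x \<in> torus r" "r \<ge> 1"
  shows "skew_alpha lam \<omega> r x n = lam * ee (skew_lift \<omega> x r n)"
proof -
  have "ee (skew_iter \<omega> r n x r) = ee (skew_lift \<omega> x r n)"
    using skew_iter_lift[OF assms(1), of r \<omega> n] assms(2) by (intro ee_cong) auto
  moreover have "exp (2 * of_real pi * \<i> * of_real t) = ee t" for t
    by (simp add: ee_def cis_conv_exp mult_ac)
  ultimately show ?thesis by (simp add: skew_alpha_def)
qed

section \<open>Measures of sets with thin one-dimensional sections\<close>

definition unit_measure :: "real measure" where
  "unit_measure = restrict_space lborel {0..<1}"

lemma space_unit_measure: "space unit_measure = {0..<1}"
  by (simp add: unit_measure_def space_restrict_space)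

lemma prob_space_unit_measure: "prob_space unit_measure"
proof
  have "emeasure unit_measure (space unit_measure) = emeasure lborel {0..<1::real}"
    unfolding space_unit_measure unit_measure_def by (subst emeasure_restrict_space) auto
  then show "emeasure unit_measure (space unit_measure) = 1" by simp
qed

definition torus_borel :: "nat \<Rightarrow> (nat \<Rightarrow> real) measure" where
  "torus_borel r = (\<Pi>\<^sub>M l\<in>{1..r}. unit_measure)"

lemma torus_measure_eq: "torus_measure r = completion (torus_borel r)"
  by (simp add: torus_measure_def torus_borel_def unit_measure_def)

lemma space_torus_borel: "space (torus_borel r) = torus r"
  by (simp add: torus_borel_def torus_def space_PiM space_unit_measure)

text \<open>
  Tonelli in one coordinate.  The sections are only required to lie in a Borel set of small measure.
\<close>

lemma emeasure_by_sections:
  assumes i: "i \<in> {1..r}" and B: "B \<in> sets (torus_borel r)"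
    and sec: "\<And>x. x \<in> torus r \<Longrightarrow> \<exists>A. A \<in> sets borel \<and> {s \<in> {0..<1}. x(i := s) \<in> B} \<subseteq> A \<and> emeasure lborel A \<le> c"
  shows "emeasure (torus_borel r) B \<le> c"
proof -
  interpret prob_space unit_measure by (rule prob_space_unit_measure)
  interpret product_prob_space "\<lambda>_. unit_measure" "{1..r}" by unfold_locales
  interpret product_sigma_finite "\<lambda>_::nat. unit_measure" by unfold_locales
  define J where "J = {1..r} - {i}"
  have I: "{1..r} = insert i J" and iJ: "i \<notin> J" "finite J" using i by (auto simp: J_def)
  have B': "B \<in> sets (Pi\<^sub>M (insert i J) (\<lambda>_. unit_measure))" using B unfolding torus_borel_def I .
  have "emeasure (torus_borel r) B = (\<integral>\<^sup>+x. indicator B x \<partial>Pi\<^sub>M (insert i J) (\<lambda>_. unit_measure))"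
    using B' unfolding torus_borel_def I by simp
  also have "\<dots> = (\<integral>\<^sup>+x. (\<integral>\<^sup>+s. indicator B (x(i := s)) \<partial>unit_measure) \<partial>Pi\<^sub>M J (\<lambda>_. unit_measure))"
    by (rule product_nn_integral_insert) (use iJ B' in auto)
  also have "\<dots> \<le> (\<integral>\<^sup>+x. c \<partial>Pi\<^sub>M J (\<lambda>_. unit_measure))"
  proof (rule nn_integral_mono)
    fix x assume x: "x \<in> space (Pi\<^sub>M J (\<lambda>_. unit_measure))"
    define x0 where "x0 = x(i := 0)"
    have "x0 \<in> torus r"
      using x i unfolding x0_def torus_def I by (auto simp: space_PiM space_unit_measure PiE_def Pi_def extensional_def)
    then obtain A where A: "A \<in> sets borel" "{s \<in> {0..<1}. x0(i := s) \<in> B} \<subseteq> A" "emeasure lborel A \<le> c"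
      using sec by blast
    have "(\<integral>\<^sup>+s. indicator B (x(i := s)) \<partial>unit_measure) = (\<integral>\<^sup>+s. indicator B (x(i := s)) * indicator {0..<1} s \<partial>lborel)"
      unfolding unit_measure_def by (subst nn_integral_restrict_space) auto
    also have "\<dots> \<le> (\<integral>\<^sup>+s. indicator A s \<partial>lborel)"
      using A(2) by (intro nn_integral_mono) (auto simp: indicator_def x0_def)
    also have "\<dots> = emeasure lborel A" using A(1) by simp
    also have "\<dots> \<le> c" by (rule A)
    finally show "(\<integral>\<^sup>+s. indicator B (x(i := s)) \<partial>unit_measure) \<le> c" .
  qed
  also have "\<dots> = c * emeasure (Pi\<^sub>M J (\<lambda>_. unit_measure)) (space (Pi\<^sub>M J (\<lambda>_. unit_measure)))"
    by simp
  also have "emeasure (Pi\<^sub>M J (\<lambda>_. unit_measure)) (space (Pi\<^sub>M J (\<lambda>_. unit_measure))) = 1"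
  proof -
    interpret J: product_prob_space "\<lambda>_. unit_measure" J by unfold_locales
    show ?thesis by (rule J.emeasure_space_1)
  qed
  finally show ?thesis by simp
qed

text \<open>
  A set whose image on the circle has small diameter lies in an arc around any of its points, that is, in
  three intervals when the arc is unrolled.
\<close>

lemma arc_cover:
  assumes S: "S \<subseteq> {0..<1::real}" and d: "0 < d" "d \<le> 1"
    and close: "\<And>s t. s \<in> S \<Longrightarrow> t \<in> S \<Longrightarrow> cmod (ee s - ee t) < 4 * d"
  shows "\<exists>A. A \<in> sets borel \<and> S \<subseteq> A \<and> emeasure lborel A \<le> ennreal (6 * d)"
proof (cases "S = {}")
  case True
  then show ?thesis by (intro exI[of _ "{}"]) auto
next
  case False
  then obtain s0 where s0: "s0 \<in> S" by blast
  define I where "I j = {s0 + j - d..s0 + j + d}" for j :: real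
  define A where "A = I 0 \<union> I 1 \<union> I (- 1)"
  have "t \<in> A" if t: "t \<in> S" for t
  proof -
    have "cmod (1 - ee (t - s0)) = cmod (ee s0 - ee t)"
    proof -
      have "ee s0 * cnj (ee s0) = 1" using complex_norm_square[of "ee s0"] by simp
      then have "ee s0 * (1 - ee (t - s0)) = ee s0 - ee t" by (simp add: ee_diff algebra_simps)
      then show ?thesis using norm_mult[of "ee s0" "1 - ee (t - s0)"] by simp
    qed
    then have "4 * infdist (t - s0) \<int> < 4 * d"
      using one_minus_ee_ge[of "t - s0"] close[OF s0 t] by linarith
    moreover have ne: "(\<int> :: real set) \<noteq> {}" using Ints_0 by blast
    ultimately have "(INF a\<in>\<int>. dist (t - s0) a) < d" by (simp add: infdist_notempty[OF ne])
    then obtain a where a: "a \<in> (\<int> :: real set)" "dist (t - s0) a < d"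
      by (subst (asm) cINF_less_iff) (auto intro: bdd_belowI2[where m = 0])
    obtain j :: int where j: "a = of_int j" using a(1) by (auto elim: Ints_cases)
    have "\<bar>t - s0 - real_of_int j\<bar> < d" using a(2) by (simp add: j dist_real_def)
    moreover have "\<bar>t - s0\<bar> < 1"
    proof -
      have "0 \<le> t" "t < 1" "0 \<le> s0" "s0 < 1" using t s0 S by auto
      then show ?thesis by linarith
    qed
    ultimately have "\<bar>real_of_int j\<bar> < 2" using d by linarith
    then have "j = 0 \<or> j = 1 \<or> j = - 1" by linarith
    then show ?thesis using \<open>\<bar>t - s0 - real_of_int j\<bar> < d\<close> unfolding A_def I_def by auto
  qed
  moreover have "emeasure lborel A \<le> ennreal (6 * d)"
  proof -
    have I: "I j \<in> sets lborel" "emeasure lborel (I j) = ennreal (2 * d)" for j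
      using d by (auto simp: I_def)
    have "emeasure lborel A \<le> emeasure lborel (I 0 \<union> I 1) + emeasure lborel (I (- 1))"
      unfolding A_def using I by (intro emeasure_subadditive) auto
    also have "emeasure lborel (I 0 \<union> I 1) \<le> emeasure lborel (I 0) + emeasure lborel (I 1)"
      using I by (intro emeasure_subadditive) auto
    finally have "emeasure lborel A \<le> ennreal (2 * d) + ennreal (2 * d) + ennreal (2 * d)"
      using I by (simp add: add_right_mono)
    also have "\<dots> = ennreal (6 * d)" using d by (simp flip: ennreal_plus)
    finally show ?thesis .
  qed
  moreover have "A \<in> sets borel" by (auto simp: A_def I_def)
  ultimately show ?thesis by blast
qed

lemma arc_union_cover:
  assumes "\<And>i. i < n \<Longrightarrow> \<exists>A. A \<in> sets borel \<and> S i \<subseteq> A \<and> emeasure lborel A \<le> ennreal c" and c: "0 \<le> c"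
  shows "\<exists>A. A \<in> sets borel \<and> (\<Union>i<n. S i) \<subseteq> A \<and> emeasure lborel A \<le> ennreal (real n * c)"
proof -
  obtain A where A: "\<And>i. i < n \<Longrightarrow> A i \<in> sets borel \<and> S i \<subseteq> A i \<and> emeasure lborel (A i) \<le> ennreal c"
    using assms by metis
  have "emeasure lborel (\<Union>i<n. A i) \<le> (\<Sum>i<n. emeasure lborel (A i))"
    using A by (intro emeasure_subadditive_finite) auto
  also have "\<dots> \<le> (\<Sum>i<n. ennreal c)" using A by (intro sum_mono) auto
  also have "\<dots> = ennreal (real n * c)" using c by (simp add: ennreal_mult ennreal_of_nat_eq_real_of_nat)
  finally show ?thesis using A by (intro exI[of _ "\<Union>i<n. A i"]) (auto intro!: sets.finite_UN)
qed

lemma complex_quadratic_factor: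
  fixes A B C :: complex
  assumes "B \<noteq> 0"
  shows "\<exists>\<zeta>1 \<zeta>2. \<forall>w. B * w ^ 2 + A * w + C = B * ((w - \<zeta>1) * (w - \<zeta>2))"
proof -
  define d where "d = csqrt (A ^ 2 - 4 * B * C)"
  have d: "d ^ 2 = A ^ 2 - 4 * B * C" by (simp add: d_def)
  define \<zeta>1 \<zeta>2 where "\<zeta>1 = (- A + d) / (2 * B)" and "\<zeta>2 = (- A - d) / (2 * B)"
  have s: "B * (\<zeta>1 + \<zeta>2) = - A" using assms by (simp add: \<zeta>1_def \<zeta>2_def field_simps)
  have "\<zeta>1 * \<zeta>2 = (A ^ 2 - d ^ 2) / (4 * B ^ 2)"
    by (simp add: \<zeta>1_def \<zeta>2_def power2_eq_square field_simps)
  also have "\<dots> = C / B" unfolding d using assms by (simp add: power2_eq_square)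
  finally have p: "B * (\<zeta>1 * \<zeta>2) = C" using assms by simp
  have "B * w ^ 2 + A * w + C = B * ((w - \<zeta>1) * (w - \<zeta>2))" for w
  proof -
    have "B * ((w - \<zeta>1) * (w - \<zeta>2)) = B * w ^ 2 - B * (\<zeta>1 + \<zeta>2) * w + B * (\<zeta>1 * \<zeta>2)"
      by (simp add: power2_eq_square algebra_simps)
    then show ?thesis unfolding s p by simp
  qed
  then show ?thesis by blast
qed

text \<open>
  If the quadratic polynomial is small on the circle, then one of its two linear factors is.
\<close>

lemma quadratic_arc_cover:
  fixes A B C :: complex
  assumes B: "B \<noteq> 0" and d: "0 < d" "d \<le> 1"
  shows "\<exists>S. S \<in> sets borel \<and> {s \<in> {0..<1}. cmod (B * ee s ^ 2 + A * ee s + C) < (2 * d)\<^sup>2 * cmod B} \<subseteq> S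
    \<and> emeasure lborel S \<le> ennreal (2 * (6 * d))"
proof -
  obtain \<zeta>1 \<zeta>2 where z: "\<And>w. B * w ^ 2 + A * w + C = B * ((w - \<zeta>1) * (w - \<zeta>2))"
    using complex_quadratic_factor[OF B] by blast
  define S where "S i = {s \<in> {0..<1}. cmod (ee s - (if i = 0 then \<zeta>1 else \<zeta>2)) < 2 * d}" for i :: nat
  have cov: "\<exists>A. A \<in> sets borel \<and> S i \<subseteq> A \<and> emeasure lborel A \<le> ennreal (6 * d)" for i
  proof (rule arc_cover[OF _ d])
    fix s t assume st: "s \<in> S i" "t \<in> S i"
    define \<zeta> where "\<zeta> = (if i = 0 then \<zeta>1 else \<zeta>2)"
    have "cmod (ee s - ee t) \<le> cmod (ee s - \<zeta>) + cmod (ee t - \<zeta>)"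
      using norm_triangle_ineq4[of "ee s - \<zeta>" "ee t - \<zeta>"] by simp
    then show "cmod (ee s - ee t) < 4 * d" using st by (simp add: S_def \<zeta>_def)
  qed (auto simp: S_def)
  have sub: "{s \<in> {0..<1}. cmod (B * ee s ^ 2 + A * ee s + C) < (2 * d)\<^sup>2 * cmod B} \<subseteq> (\<Union>i<2. S i)"
  proof
    fix s assume "s \<in> {s \<in> {0..<1}. cmod (B * ee s ^ 2 + A * ee s + C) < (2 * d)\<^sup>2 * cmod B}"
    then have s: "s \<in> {0..<1}" and lt: "cmod (ee s - \<zeta>1) * cmod (ee s - \<zeta>2) < (2 * d) * (2 * d)"
      using B unfolding z by (auto simp: norm_mult power2_eq_square mult.commute)
    have "cmod (ee s - \<zeta>1) < 2 * d \<or> cmod (ee s - \<zeta>2) < 2 * d"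
    proof (rule ccontr)
      assume "\<not> ?thesis"
      then have "(2 * d) * (2 * d) \<le> cmod (ee s - \<zeta>1) * cmod (ee s - \<zeta>2)"
        using d by (intro mult_mono) auto
      then show False using lt by simp
    qed
    then have "s \<in> S 0 \<or> s \<in> S 1" using s by (auto simp: S_def)
    then show "s \<in> (\<Union>i<2. S i)" by auto
  qed
  obtain A where "A \<in> sets borel" "(\<Union>i<2. S i) \<subseteq> A" "emeasure lborel A \<le> ennreal (real 2 * (6 * d))"
    using arc_union_cover[of 2 S "6 * d"] cov d by auto
  then show ?thesis using sub by (intro exI[of _ A]) auto
qed

section \<open>Measurability of suitability\<close>

definition mat_measurable :: "'a measure \<Rightarrow> nat \<Rightarrow> ('a \<Rightarrow> complex mat) \<Rightarrow> bool" where
  "mat_measurable P n F \<longleftrightarrow> (\<forall>x\<in>space P. F x \<in> carrier_mat n n) \<and>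
     (\<forall>i<n. \<forall>j<n. (\<lambda>x. F x $$ (i, j)) \<in> borel_measurable P)"

lemma mat_measurable_restrict_op:
  assumes "\<And>i j. (\<lambda>x. A x i j) \<in> borel_measurable P"
  shows "mat_measurable P (nat (b - a + 1)) (\<lambda>x. restrict_op (A x) a b)"
  using assms by (simp add: mat_measurable_def)

lemma mat_measurable_delete:
  assumes F: "mat_measurable P n F" and k: "k < n" "l < n"
  shows "mat_measurable P (n - 1) (\<lambda>x. mat_delete (F x) k l)"
  unfolding mat_measurable_def
proof (intro conjI ballI allI impI)
  fix x assume x: "x \<in> space P"
  then have c: "F x \<in> carrier_mat n n" using F by (simp add: mat_measurable_def)
  show "mat_delete (F x) k l \<in> carrier_mat (n - 1) (n - 1)"
    by (rule mat_delete_carrier[OF c])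
next
  fix i j assume ij: "i < n - 1" "j < n - 1"
  define i' j' where "i' = (if i < k then i else Suc i)" and "j' = (if j < l then j else Suc j)"
  have "(\<lambda>x. F x $$ (i', j')) \<in> borel_measurable P"
    using F ij by (auto simp: mat_measurable_def i'_def j'_def)
  moreover have "mat_delete (F x) k l $$ (i, j) = F x $$ (i', j')" if "x \<in> space P" for x
  proof -
    have "F x \<in> carrier_mat n n" using F that by (simp add: mat_measurable_def)
    then show ?thesis using ij by (auto simp: mat_delete_def i'_def j'_def)
  qed
  ultimately show "(\<lambda>x. mat_delete (F x) k l $$ (i, j)) \<in> borel_measurable P"
    by (subst measurable_cong) auto
qed

lemma det_measurable:
  assumes F: "mat_measurable P n F"
  shows "(\<lambda>x. det (F x)) \<in> borel_measurable P"
proof -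
  have "(\<lambda>x. \<Sum>p\<in>{p. p permutes {0..<n}}. signof p * (\<Prod>i=0..<n. F x $$ (i, p i))) \<in> borel_measurable P"
  proof (intro borel_measurable_sum borel_measurable_times borel_measurable_const borel_measurable_prod)
    fix p i assume p: "p \<in> {p. p permutes {0..<n}}" and i: "i \<in> {0..<n}"
    then have "p i < n" using permutes_in_image[of p "{0..<n}" i] by simp
    then show "(\<lambda>x. F x $$ (i, p i)) \<in> borel_measurable P" using F i by (simp add: mat_measurable_def)
  qed
  then show ?thesis
    using F by (subst measurable_cong[where g = "\<lambda>x. \<Sum>p\<in>{p. p permutes {0..<n}}. signof p * (\<Prod>i=0..<n. F x $$ (i, p i))"])
      (auto simp: mat_measurable_def intro!: det_def')
qed

text \<open>
  Cramer's rule.  For a singular matrix the entry is that of the fixed but unspecified matrix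
  \<open>the None\<close>, so it is constant there and does not spoil measurability.
\<close>

lemma mat_inv_entry:
  assumes A: "A \<in> carrier_mat n n" and ij: "i < n" "j < n"
  shows "mat_inv A $$ (i, j) = (if det A = 0 then (the None :: complex mat) $$ (i, j)
    else (- 1) ^ (j + i) * det (mat_delete A j i) / det A)"
proof (cases "det A = 0")
  case True
  have "mat_inverse A = None"
  proof (rule ccontr)
    assume "mat_inverse A \<noteq> None"
    then obtain B where "mat_inverse A = Some B" by auto
    from mat_inverse(2)[OF A this] have B: "A * B = 1\<^sub>m n" "B \<in> carrier_mat n n" by auto
    then have "det A * det B = 1" using det_mult[OF A B(2)] by simp
    then show False using True by simp
  qed
  then show ?thesis using True by (simp add: mat_inv_def)
next
  case False
  define X where "X = (1 / det A) \<cdot>\<^sub>m adj_mat A"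
  have adj: "adj_mat A \<in> carrier_mat n n" by (rule adj_mat(1)[OF A])
  then have X: "X \<in> carrier_mat n n" by (simp add: X_def)
  have "A * X = (1 / det A) \<cdot>\<^sub>m (det A \<cdot>\<^sub>m 1\<^sub>m n)"
    unfolding X_def adj_mat(2)[OF A, symmetric] by (rule mult_smult_distrib[OF A adj])
  also have "\<dots> = 1\<^sub>m n" using False by (intro eq_matI) auto
  finally have "mat_inv A = X" using mat_inv_eqI(1)[OF A X] by simp
  then show ?thesis using False A ij by (simp add: X_def adj_mat_def cofactor_def)
qed

lemma invertible_mat_iff_det:
  fixes A :: "complex mat"
  assumes A: "A \<in> carrier_mat n n"
  shows "invertible_mat A \<longleftrightarrow> det A \<noteq> 0"
proof
  assume "invertible_mat A"
  then obtain B where B: "A * B = 1\<^sub>m n" "B * A = 1\<^sub>m (dim_row B)"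
    using A by (auto simp: invertible_mat_def inverts_mat_def)
  have "dim_col B = n" using arg_cong[OF B(1), of dim_col] by simp
  moreover have "dim_row B = n" using arg_cong[OF B(2), of dim_col] A by simp
  ultimately have "B \<in> carrier_mat n n" by auto
  then have "det A * det B = 1" using det_mult[OF A, of B] B(1) by simp
  then show "det A \<noteq> 0" by auto
next
  assume d: "det A \<noteq> 0"
  define X where "X = (1 / det A) \<cdot>\<^sub>m adj_mat A"
  have adj: "adj_mat A \<in> carrier_mat n n" by (rule adj_mat(1)[OF A])
  then have X: "X \<in> carrier_mat n n" by (simp add: X_def)
  have "A * X = (1 / det A) \<cdot>\<^sub>m (det A \<cdot>\<^sub>m 1\<^sub>m n)"
    unfolding X_def adj_mat(2)[OF A, symmetric] by (rule mult_smult_distrib[OF A adj])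
  also have "\<dots> = 1\<^sub>m n" using d by (intro eq_matI) auto
  finally show "invertible_mat A" using mat_inv_eqI(2)[OF A X] by simp
qed

lemma mat_inv_carrier:
  fixes A :: "complex mat"
  assumes A: "A \<in> carrier_mat n n" and d: "det A \<noteq> 0"
  shows "mat_inv A \<in> carrier_mat n n"
proof -
  have "mat_inverse A \<noteq> None"
    using mat_inverse(1)[OF A, of "()"] det_non_zero_imp_unit[OF A d, of "()"] by blast
  then obtain B where "mat_inverse A = Some B" by auto
  then show ?thesis using mat_inverse(2)[OF A] by (simp add: mat_inv_def)
qed

lemma mat_inv_measurable:
  assumes F: "mat_measurable P n F" and ij: "i < n" "j < n"
  shows "(\<lambda>x. mat_inv (F x) $$ (i, j)) \<in> borel_measurable P"
proof -
  have d: "(\<lambda>x. det (F x)) \<in> borel_measurable P" by (rule det_measurable[OF F])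
  have dd: "(\<lambda>x. det (mat_delete (F x) j i)) \<in> borel_measurable P"
    by (rule det_measurable[OF mat_measurable_delete[OF F ij(2,1)]])
  have set0: "{x \<in> space P. det (F x) = 0} \<in> sets P"
    using d by measurable
  have "(\<lambda>x. if det (F x) = 0 then (the None :: complex mat) $$ (i, j)
    else (- 1) ^ (j + i) * det (mat_delete (F x) j i) / det (F x)) \<in> borel_measurable P"
    using set0 by (intro measurable_If borel_measurable_divide borel_measurable_times borel_measurable_const d dd)
  then show ?thesis
    using F ij by (subst measurable_cong[where g = "\<lambda>x. if det (F x) = 0 then (the None :: complex mat) $$ (i, j)
      else (- 1) ^ (j + i) * det (mat_delete (F x) j i) / det (F x)"]) (auto simp: mat_measurable_def mat_inv_entry)
qed

lemma l2_op_norm_le_iff: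
  assumes X: "X \<in> carrier_mat n n"
  shows "l2_op_norm X \<le> c \<longleftrightarrow> (\<forall>v\<in>{v \<in> carrier_vec n. l2_norm_vec v \<le> 1}.
    L2_set (\<lambda>i. cmod (\<Sum>j<n. X $$ (i, j) * vec_index v j)) {..<n} \<le> c)"
proof -
  define B where "B = (\<Sum>i<n. \<Sum>j<n. cmod (X $$ (i, j)))"
  have B: "cmod (X $$ (i, j)) \<le> B" if "i < n" "j < n" for i j
  proof -
    have "cmod (X $$ (i, j)) \<le> (\<Sum>j<n. cmod (X $$ (i, j)))" using that by (intro member_le_sum) auto
    also have "\<dots> \<le> B" unfolding B_def
      using member_le_sum[of i "{..<n}" "\<lambda>i. \<Sum>j<n. cmod (X $$ (i, j))"] that by (simp add: sum_nonneg)
    finally show ?thesis .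
  qed
  have B0: "0 \<le> B" by (simp add: B_def sum_nonneg)
  have bdd: "bdd_above ((\<lambda>v. l2_norm_vec (X *\<^sub>v v)) ` {v \<in> carrier_vec (dim_col X). l2_norm_vec v \<le> 1})"
    using X by (intro bdd_aboveI2[where M = "(real n)\<^sup>2 * B"]) (auto intro!: l2_norm_mult_le[OF X B B0])
  have e: "l2_norm_vec (X *\<^sub>v v) = L2_set (\<lambda>i. cmod (\<Sum>j<n. X $$ (i, j) * vec_index v j)) {..<n}"
    if "v \<in> carrier_vec n" for v
  proof -
    have d: "dim_vec (X *\<^sub>v v) = n" using X by simp
    show ?thesis unfolding l2_norm_vec_def d
    proof (rule L2_set_cong[OF refl])
      fix i assume "i \<in> {..<n}"
      then show "cmod (vec_index (X *\<^sub>v v) i) = cmod (\<Sum>j<n. X $$ (i, j) * vec_index v j)"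
        using X that by (simp add: scalar_prod_def lessThan_atLeast0)
    qed
  qed
  have dX: "dim_col X = n" using X by simp
  show ?thesis
    unfolding l2_op_norm_def cSUP_le_iff[OF unit_ball_nonempty bdd] unfolding dX using e by auto
qed

text \<open>
  The condition on the norm is an intersection of closed conditions on the entries, one for each unit
  vector, so it is closed although there are uncountably many of them.
\<close>

lemma l2_op_norm_measurable:
  assumes F: "mat_measurable P n F"
  shows "{x \<in> space P. det (F x) \<noteq> 0 \<and> l2_op_norm (mat_inv (F x)) \<le> c} \<in> sets P"
proof -
  define V where "V = {v \<in> carrier_vec n. l2_norm_vec v \<le> 1}"
  define K where "K = (\<Inter>v\<in>V. {y :: nat \<times> nat \<Rightarrow> complex.
     L2_set (\<lambda>i. cmod (\<Sum>j<n. y (i, j) * vec_index v j)) {..<n} \<le> c})"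
  have "closed K"
    unfolding K_def L2_set_def
    by (intro closed_INT ballI closed_Collect_le continuous_intros continuous_on_product_coordinates)
  then have K: "K \<in> sets borel" by (rule borel_closed)
  define h where "h x = (\<lambda>(i, j). if i < n \<and> j < n then mat_inv (F x) $$ (i, j) else 0)" for x
  have h: "h \<in> borel_measurable P"
  proof (rule measurable_coordinatewise_then_product)
    fix p :: "nat \<times> nat"
    show "(\<lambda>x. h x p) \<in> borel_measurable P"
    proof (cases "fst p < n \<and> snd p < n")
      case True
      then show ?thesis using mat_inv_measurable[OF F, of "fst p" "snd p"] by (simp add: h_def case_prod_beta)
    next
      case False
      then have "h x p = 0" for x by (auto simp: h_def case_prod_beta)
      then show ?thesis by simp
    qed
  qed
  have hK: "h -` K \<inter> space P \<in> sets P" by (rule measurable_sets[OF h K])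
  have d: "{x \<in> space P. det (F x) \<noteq> 0} \<in> sets P" using det_measurable[OF F] by measurable
  have "(l2_op_norm (mat_inv (F x)) \<le> c) = (h x \<in> K)" if x: "x \<in> space P" "det (F x) \<noteq> 0" for x
  proof -
    have "F x \<in> carrier_mat n n" using F x by (simp add: mat_measurable_def)
    then have "mat_inv (F x) \<in> carrier_mat n n" using x(2) by (rule mat_inv_carrier)
    from l2_op_norm_le_iff[OF this, of c] show ?thesis
      by (simp add: K_def V_def h_def L2_set_def)
  qed
  then have "{x \<in> space P. det (F x) \<noteq> 0 \<and> l2_op_norm (mat_inv (F x)) \<le> c}
    = {x \<in> space P. det (F x) \<noteq> 0} \<inter> (h -` K \<inter> space P)" by auto
  then show ?thesis using d hK by simp
qed

lemma cnj_measurable: "f \<in> borel_measurable P \<Longrightarrow> (\<lambda>x. cnj (f x)) \<in> borel_measurable P"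
  by (rule borel_measurable_continuous_on[of cnj]) (auto intro!: continuous_intros)

lemma cmv_Theta_measurable:
  assumes T: "\<And>n. (\<lambda>x. T x n) \<in> borel_measurable P"
  shows "(\<lambda>x. cmv_Theta (T x) n i j) \<in> borel_measurable P"
proof -
  have "(\<lambda>x. complex_of_real (cmv_rho (T x) n)) \<in> borel_measurable P"
    unfolding cmv_rho_def using T[of n] by measurable
  moreover have "(\<lambda>x. - T x n) \<in> borel_measurable P" using T[of n] by measurable
  ultimately show ?thesis
    using cnj_measurable[OF T[of n]] unfolding cmv_Theta_def by (intro measurable_If) auto
qed

lemma suitable_measurable:
  assumes \<alpha>: "\<And>n. (\<lambda>x. \<alpha> x n) \<in> borel_measurable P"
  shows "{x \<in> space P. suitable \<gamma> \<Gamma> p (\<alpha> x) \<beta> \<beta>' z N} \<in> sets P"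
proof -
  define a b n where "a = - int N" and "b = int N" and "n = nat (b - a + 1)"
  define t where "t x = (\<alpha> x)(a - 1 := \<beta>, b := \<beta>')" for x
  have T: "(\<lambda>x. t x m) \<in> borel_measurable P" for m
    using \<alpha>[of m] by (cases "m = b"; cases "m = a - 1") (simp_all add: t_def)
  have L: "(\<lambda>x. cmv_L (t x) i j) \<in> borel_measurable P" for i j
    unfolding cmv_L_def by (rule cmv_Theta_measurable[OF T])
  have M: "(\<lambda>x. cmv_M (t x) i j) \<in> borel_measurable P" for i j
    unfolding cmv_M_def by (rule cmv_Theta_measurable[OF T])
  define E where "E x = cmv_E_box_minus (\<alpha> x) \<beta> \<beta>' a b z" for x
  define A where "A x = z \<cdot>\<^sub>m mat_adjoint (cmv_L_box (\<alpha> x) \<beta> \<beta>' a b) - cmv_M_box (\<alpha> x) \<beta> \<beta>' a b" for x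
  have boxes: "cmv_L_box (\<alpha> x) \<beta> \<beta>' a b = restrict_op (cmv_L (t x)) a b"
    "cmv_M_box (\<alpha> x) \<beta> \<beta>' a b = restrict_op (cmv_M (t x)) a b" for x
    by (simp_all add: cmv_L_box_def cmv_M_box_def t_def)
  have A_eq: "A x = restrict_op (\<lambda>i j. z * cnj (cmv_L (t x) j i) - cmv_M (t x) i j) a b" for x
    unfolding A_def boxes restrict_op_adjoint restrict_op_resolvent ..
  have A_mm: "mat_measurable P n A"
    unfolding A_eq[abs_def] n_def
    by (intro mat_measurable_restrict_op borel_measurable_diff borel_measurable_times
        borel_measurable_const cnj_measurable L M)
  have E_eq: "E x = restrict_op (\<lambda>i j. (\<Sum>k\<in>{a..b}. cmv_L (t x) i k * cmv_M (t x) k j) - z * (if i = j then 1 else 0)) a b" for x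
    unfolding E_def cmv_E_box_minus_def cmv_E_box_def boxes restrict_op_mult
    by (rule eq_matI) auto
  have E_mm: "mat_measurable P n E"
    unfolding E_eq[abs_def] n_def
    by (intro mat_measurable_restrict_op borel_measurable_diff borel_measurable_times
        borel_measurable_const borel_measurable_sum L M)
  have Ec: "E x \<in> carrier_mat n n" for x by (simp add: E_eq n_def)
  define R where "R = {(k, l). k \<in> {a..b} \<and> l \<in> {a..b} \<and> real N / 2 \<le> real_of_int \<bar>k - l\<bar>}"
  have "R \<subseteq> {a..b} \<times> {a..b}" by (auto simp: R_def)
  then have R: "finite R" by (rule finite_subset) auto
  define S where "S kl = {x \<in> space P. cmod (mat_inv (A x) $$ (nat (fst kl - a), nat (snd kl - a)))
     \<le> 2 powr (- (p + 1)) * exp (- \<gamma> * real_of_int \<bar>fst kl - snd kl\<bar>)}" for kl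
  have S: "S kl \<in> sets P" if "kl \<in> R" for kl
  proof -
    have "(\<lambda>x. mat_inv (A x) $$ (nat (fst kl - a), nat (snd kl - a))) \<in> borel_measurable P"
      using that by (intro mat_inv_measurable[OF A_mm]) (auto simp: R_def n_def)
    then show ?thesis unfolding S_def by measurable
  qed
  have "{x \<in> space P. suitable \<gamma> \<Gamma> p (\<alpha> x) \<beta> \<beta>' z N}
    = {x \<in> space P. det (E x) \<noteq> 0 \<and> l2_op_norm (mat_inv (E x)) \<le> 2 powr (- p) * exp \<Gamma>}
      \<inter> {x \<in> space P. \<forall>kl\<in>R. x \<in> S kl}"
  proof -
    have det: "invertible_mat (cmv_E_box_minus (\<alpha> x) \<beta> \<beta>' (- int N) (int N) z) = (det (E x) \<noteq> 0)" for x
      using invertible_mat_iff_det[OF Ec[of x]] by (simp only: E_def a_def b_def)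
    define ok where "ok x k l \<longleftrightarrow>
      cmod (mat_inv (A x) $$ (nat (k - a), nat (l - a))) \<le> 2 powr (- (p + 1)) * exp (- \<gamma> * real_of_int \<bar>k - l\<bar>)" for x k l
    define far where "far k l \<longleftrightarrow> real N / 2 \<le> real_of_int \<bar>k - l\<bar>" for k l
    define res where "res x \<longleftrightarrow> l2_op_norm (mat_inv (E x)) \<le> 2 powr (- p) * exp \<Gamma>" for x
    have iff: "suitable \<gamma> \<Gamma> p (\<alpha> x) \<beta> \<beta>' z N \<longleftrightarrow> det (E x) \<noteq> 0 \<and> res x \<and>
      (\<forall>k\<in>{a..b}. \<forall>l\<in>{a..b}. far k l \<longrightarrow> ok x k l)" for x
      unfolding suitable_def det unfolding ok_def far_def res_def green_def E_def A_def a_def b_def by (rule refl)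
    have S_ok: "x \<in> S kl \<longleftrightarrow> x \<in> space P \<and> ok x (fst kl) (snd kl)" for x kl
      unfolding S_def ok_def mem_Collect_eq by (rule refl)
    have R_far: "R = {(k, l). k \<in> {a..b} \<and> l \<in> {a..b} \<and> far k l}"
      unfolding R_def far_def by (rule refl)
    show ?thesis unfolding res_def[symmetric] iff S_ok R_far by auto
  qed
  moreover have "{x \<in> space P. \<forall>kl\<in>R. x \<in> S kl} \<in> sets P"
  proof (rule sets.sets_Collect_finite_All[OF _ R])
    fix kl assume "kl \<in> R"
    then have "S kl \<in> sets P" by (rule S)
    moreover have "{x \<in> space P. x \<in> S kl} = space P \<inter> S kl" by blast
    ultimately show "{x \<in> space P. x \<in> S kl} \<in> sets P" by (simp only: sets.Int sets.top)
  qed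
  ultimately show ?thesis using sets.Int[OF l2_op_norm_measurable[OF E_mm]] by simp
qed

lemma ee_measurable: "f \<in> borel_measurable P \<Longrightarrow> (\<lambda>x. ee (f x)) \<in> borel_measurable P"
  unfolding ee_def cis_conv_exp
  by (rule borel_measurable_continuous_on[where f = "\<lambda>t. exp (\<i> * of_real (2 * pi * t))"]) (auto intro!: continuous_intros)

lemma unit_measure_borel: "(\<lambda>x. x) \<in> borel_measurable unit_measure"
  unfolding unit_measure_def by (rule measurable_restrict_space1) simp

lemma skew_lift_measurable: "l \<le> r \<Longrightarrow> (\<lambda>x. skew_lift \<omega> x l n) \<in> borel_measurable (torus_borel r)"
proof (induction l arbitrary: n)
  case (Suc l)
  have c: "(\<lambda>x. x (Suc l)) \<in> borel_measurable (torus_borel r)"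
    unfolding torus_borel_def
    using measurable_compose[OF measurable_component_singleton[of "Suc l" "{1..r}" "\<lambda>_. unit_measure"] unit_measure_borel] Suc.prems
    by simp
  show ?case using c Suc by (cases "0 \<le> n") auto
qed simp

lemma skew_alpha_measurable:
  assumes "r \<ge> 1"
  shows "(\<lambda>x. skew_alpha lam \<omega> r x n) \<in> borel_measurable (torus_borel r)"
proof -
  have "(\<lambda>x. lam * ee (skew_lift \<omega> x r n)) \<in> borel_measurable (torus_borel r)"
    by (intro borel_measurable_times borel_measurable_const ee_measurable skew_lift_measurable order_refl)
  then show ?thesis
    using assms by (subst measurable_cong[where g = "\<lambda>x. lam * ee (skew_lift \<omega> x r n)"])
      (auto simp: space_torus_borel skew_alpha_lift)
qed

section \<open>The measure of the unsuitable set\<close>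

lemma szego_measurable:
  assumes a: "\<And>i. (\<lambda>x. a x i) \<in> borel_measurable P"
  shows "(\<lambda>x. fst (szego (a x) z v n)) \<in> borel_measurable P \<and> (\<lambda>x. snd (szego (a x) z v n)) \<in> borel_measurable P"
proof (induction n)
  case (Suc n)
  then show ?case using a[of n] cnj_measurable[OF a[of n]]
    by (auto intro!: borel_measurable_diff borel_measurable_times)
qed simp

text \<open>
  Multiplying all coefficients by \<open>w\<close> fixes \<open>q0\<close> and multiplies \<open>q1\<close> by \<open>w\<close> and its
  conjugate by $w^{-1}$.
\<close>

lemma boundary_form_rotation:
  assumes w: "cmod w = 1" and z: "cmod z = 1"
  shows "w * (z * fst (szego (\<lambda>i. c i * w) z (1, - \<beta>) M) - cnj \<beta>' * snd (szego (\<lambda>i. c i * w) z (1, - \<beta>) M))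
    = (- cnj \<beta>' * q1 c z M) * w ^ 2 + (z ^ Suc M * cnj (q0 c z M) + \<beta> * cnj \<beta>' * q0 c z M) * w
      + (- \<beta> * z ^ Suc M * cnj (q1 c z M))"
proof -
  have q: "q0 (\<lambda>i. c i * w) z M = q0 c z M" "q1 (\<lambda>i. c i * w) z M = w * q1 c z M"
    using q0_gauge[OF w, of 1 c z M] q1_gauge[OF w, of c z M] by simp_all
  have ww: "w * cnj w = 1" using w complex_norm_square[of w] by simp
  have "w * (z * fst (szego (\<lambda>i. c i * w) z (1, - \<beta>) M) - cnj \<beta>' * snd (szego (\<lambda>i. c i * w) z (1, - \<beta>) M))
    = (- cnj \<beta>' * q1 c z M) * w ^ 2 + (z ^ Suc M * cnj (q0 c z M) + \<beta> * cnj \<beta>' * q0 c z M) * w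
      + (- \<beta> * z ^ Suc M * cnj (q1 c z M)) * (w * cnj w)"
    unfolding szego_linear[of _ z 1 "- \<beta>"] szego_conjugate[OF z] q
    by (simp add: power2_eq_square algebra_simps)
  then show ?thesis unfolding ww by simp
qed

lemma eventually_exponents:
  fixes C K \<gamma> s :: real
  assumes s: "0 < s" "s \<le> 1/8" and C: "0 \<le> C" and \<gamma>: "0 < \<gamma>"
  shows "\<forall>\<^sub>F N in sequentially.
     ln 4 + 3 * ln (2 * real N + 1) + 3 * C * (2 * real N) powr (1 - s) + 2 * (2 * real N) powr s + K \<le> real N powr (1 - s / 2)"
    and "\<forall>\<^sub>F N in sequentially.
     ln 4 + 3 * C * (2 * real N) powr (1 - s) + 2 * (2 * real N) powr s + K \<le> \<gamma> * real N / 2"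
    and "\<forall>\<^sub>F N in sequentially.
     2 * C * (2 * real N) powr (1 - s) + K \<le> \<gamma> * real N"
    and "\<forall>\<^sub>F N in sequentially.
     ln (12 * real N + 12) + real N powr (s / 2) \<le> (2 * real N) powr s"
proof -
  have small1: "\<forall>\<^sub>F N in sequentially. B * real N powr (1 - s) \<le> real N powr (1 - s / 2)" for B
  proof -
    have "\<forall>\<^sub>F N in sequentially. B \<le> real N powr (s / 2)" using s by real_asymp
    then show ?thesis
    proof eventually_elim
      case (elim N)
      have "B * real N powr (1 - s) \<le> real N powr (s / 2) * real N powr (1 - s)"
        using elim by (intro mult_right_mono) auto
      also have "\<dots> = real N powr (1 - s / 2)" by (simp add: powr_add[symmetric])
      finally show ?case .
    qed
  qed
  have e1: "\<forall>\<^sub>F N in sequentially. ln 4 + 3 * ln (2 * real N + 1) + K \<le> real N powr (1/2)"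
    by real_asymp
  have e2: "\<forall>\<^sub>F N in sequentially. 1 \<le> real N" by real_asymp
  have pw: "(2 * real N) powr (1 - s) \<le> 2 * real N powr (1 - s)" "(2 * real N) powr s \<le> 2 * real N powr (1 - s)"
    "real N powr (1/2) \<le> real N powr (1 - s)" if "1 \<le> real N" for N
  proof -
    have "2 powr (1 - s) \<le> 2 powr (1::real)" "2 powr s \<le> 2 powr (1::real)"
      using s by (intro powr_mono; simp)+
    moreover have "real N powr s \<le> real N powr (1 - s)" "real N powr (1/2) \<le> real N powr (1 - s)"
      using that s by (intro powr_mono; simp)+
    ultimately show "(2 * real N) powr (1 - s) \<le> 2 * real N powr (1 - s)" "(2 * real N) powr s \<le> 2 * real N powr (1 - s)"
      "real N powr (1/2) \<le> real N powr (1 - s)"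
      by (auto simp: powr_mult intro!: mult_mono)
  qed
  have bound: "3 * C * (2 * real N) powr (1 - s) + 2 * (2 * real N) powr s \<le> (6 * C + 4) * real N powr (1 - s)"
    if "1 \<le> real N" for N
  proof -
    have "3 * C * (2 * real N) powr (1 - s) \<le> 3 * C * (2 * real N powr (1 - s))"
      using C pw(1)[OF that] by (intro mult_left_mono) auto
    then show ?thesis using pw(2)[OF that] by (simp add: algebra_simps)
  qed
  show "\<forall>\<^sub>F N in sequentially.
     ln 4 + 3 * ln (2 * real N + 1) + 3 * C * (2 * real N) powr (1 - s) + 2 * (2 * real N) powr s + K \<le> real N powr (1 - s / 2)"
    using small1[of "6 * C + 5"] e1 e2
  proof eventually_elim
    case (elim N)
    have "ln 4 + 3 * ln (2 * real N + 1) + 3 * C * (2 * real N) powr (1 - s) + 2 * (2 * real N) powr s + K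
      \<le> real N powr (1 - s) + (6 * C + 4) * real N powr (1 - s)"
      using elim(2) bound[OF elim(3)] pw(3)[OF elim(3)] by linarith
    also have "\<dots> = (6 * C + 5) * real N powr (1 - s)" by (simp add: algebra_simps)
    finally show ?case using elim(1) by linarith
  qed
  have small2: "\<forall>\<^sub>F N in sequentially. B * real N powr (1 - s) + L \<le> \<gamma> * real N / 2" for B L
  proof -
    have "\<forall>\<^sub>F N in sequentially. B * real N powr (1 - s) \<le> real N powr (1 - s / 2)" by (rule small1)
    moreover have "\<forall>\<^sub>F N in sequentially. real N powr (1 - s / 2) + L \<le> \<gamma> * real N / 2"
      using s \<gamma> by real_asymp
    ultimately show ?thesis by eventually_elim linarith
  qed
  show "\<forall>\<^sub>F N in sequentially.
     ln 4 + 3 * C * (2 * real N) powr (1 - s) + 2 * (2 * real N) powr s + K \<le> \<gamma> * real N / 2"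
    using small2[of "6 * C + 4" "ln 4 + K"] e2
  proof eventually_elim
    case (elim N)
    then show ?case using bound[OF elim(2)] by linarith
  qed
  show "\<forall>\<^sub>F N in sequentially. 2 * C * (2 * real N) powr (1 - s) + K \<le> \<gamma> * real N"
    using small2[of "4 * C" "K"] e2
  proof eventually_elim
    case (elim N)
    have "2 * C * (2 * real N) powr (1 - s) \<le> 2 * C * (2 * real N powr (1 - s))"
      using C pw(1)[OF elim(2)] by (intro mult_left_mono) auto
    moreover have "0 \<le> \<gamma> * real N" using \<gamma> by simp
    ultimately show ?case using elim(1) by linarith
  qed
  have "\<forall>\<^sub>F N in sequentially. ln (12 * real N + 12) + real N powr (s / 2) \<le> real N powr s"
    using s by real_asymp
  then show "\<forall>\<^sub>F N in sequentially. ln (12 * real N + 12) + real N powr (s / 2) \<le> (2 * real N) powr s"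
  proof eventually_elim
    case (elim N)
    have "real N powr s \<le> (2 * real N) powr s" using s by (intro powr_mono2) auto
    then show ?case using elim by linarith
  qed
qed

theorem theorem2p5:
  fixes r :: nat and lam z \<beta> \<beta>' :: complex and p \<omega> :: real
  assumes "r \<ge> 2"
    and "cmod lam < 1" and "lam \<noteq> 0"
    and "cmod z = 1" and "cmod \<beta> = 1" and "cmod \<beta>' = 1"
    and "p \<ge> 0"
    and "(INF q\<in>{1::int..}. (real_of_int q)\<^sup>2 * infdist (real_of_int q * \<omega>) \<int>) > 0"
  shows "\<exists>\<sigma>\<in>{0<..<1::real}. \<exists>\<tau>\<in>{0<..<1::real}. \<exists>\<gamma>>0. \<forall>\<^sub>F N in sequentially.
    {x \<in> torus r. \<not> suitable \<gamma> (real N powr \<tau>) p (skew_alpha lam \<omega> r x) \<beta> \<beta>' z N}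
      \<in> sets (torus_measure r) \<and>
    measure (torus_measure r)
      {x \<in> torus r. \<not> suitable \<gamma> (real N powr \<tau>) p (skew_alpha lam \<omega> r x) \<beta> \<beta>' z N}
      \<le> exp (- (real N powr \<sigma>))"
proof -
  note r = assms(1) and lam = assms(2,3) and z = assms(4) and b1 = assms(5) and b2 = assms(6)
  define \<kappa> where "\<kappa> = (INF q\<in>{1::int..}. (real_of_int q)\<^sup>2 * infdist (real_of_int q * \<omega>) \<int>)"
  have \<kappa>: "\<kappa> > 0" using assms(8) by (simp add: \<kappa>_def)
  have dioph: "\<kappa> \<le> (real_of_int q)\<^sup>2 * infdist (real_of_int q * \<omega>) \<int>" if "q \<ge> 1" for q :: int
    unfolding \<kappa>_def
    by (rule cINF_lower) (use that in \<open>auto intro!: bdd_belowI2[where m = 0] mult_nonneg_nonneg infdist_nonneg\<close>)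
  obtain C s where C: "0 \<le> C" and s: "0 < s" "s \<le> 1/8"
    and upper: "\<And>Y m M N z. skew_orbit \<omega> Y \<Longrightarrow> M \<le> N \<Longrightarrow> 2 \<le> N \<Longrightarrow> cmod z = 1 \<Longrightarrow>
        cmod (q0 (\<lambda>i. lam * ee (Y (m + int i) r)) z M) \<le> exp (C * real N powr (1 - s))"
    and lower: "\<And>Y m M N. skew_orbit \<omega> Y \<Longrightarrow> M \<le> N \<Longrightarrow> 2 \<le> N \<Longrightarrow>
        \<exists>u. (\<forall>i<M. cmod (u i) \<le> 1) \<and>
        (\<forall>z. cmod z = 1 \<longrightarrow> (\<forall>i<M. exp (- (real N powr s)) \<le> cmod (1 - u i * z)) \<longrightarrow>
          exp (- (C * real N powr (1 - s))) \<le> cmod (q0 (\<lambda>i. lam * ee (Y (m + int i) r)) z M))"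
    by (rule szego_uniform_bounds[OF r lam(1) \<kappa>, of \<omega>]) (erule dioph, rule that)
  define \<rho> where "\<rho> = sqrt (1 - (cmod lam)\<^sup>2)"
  have l2: "0 < (cmod lam)\<^sup>2" "(cmod lam)\<^sup>2 < 1"
    using lam by (auto simp: abs_square_less_1)
  have \<rho>: "0 < \<rho>" "\<rho> < 1" "\<rho>\<^sup>2 = 1 - (cmod lam)\<^sup>2" using l2 by (auto simp: \<rho>_def)
  define \<gamma> where "\<gamma> = - ln \<rho> / 2"
  have \<gamma>: "\<gamma> > 0" "\<rho> = exp (- 2 * \<gamma>)" using \<rho> by (auto simp: \<gamma>_def)
  define \<tau> \<sigma> where "\<tau> = 1 - s / 2" and "\<sigma> = s / 2"
  define bad where "bad N = {x \<in> torus r. \<not> suitable \<gamma> (real N powr \<tau>) p (skew_alpha lam \<omega> r x) \<beta> \<beta>' z N}" for N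
  define K where "K = (p + 1) * ln 2"
  have P1: "prob_space (torus_borel r)"
    unfolding torus_borel_def by (rule prob_space_PiM) (rule prob_space_unit_measure)
  interpret P: prob_space "torus_borel r" by (rule P1)
  have bad_sets: "bad N \<in> sets (torus_borel r)" for N
  proof -
    have "{x \<in> space (torus_borel r). suitable \<gamma> (real N powr \<tau>) p (skew_alpha lam \<omega> r x) \<beta> \<beta>' z N} \<in> sets (torus_borel r)"
      by (rule suitable_measurable) (rule skew_alpha_measurable, use r in simp)
    moreover have "bad N = space (torus_borel r) - {x \<in> space (torus_borel r). suitable \<gamma> (real N powr \<tau>) p (skew_alpha lam \<omega> r x) \<beta> \<beta>' z N}"
      by (auto simp: bad_def space_torus_borel)
    ultimately show ?thesis by simp
  qed
  have main: "measure (torus_borel r) (bad N) \<le> exp (- (real N powr \<sigma>))"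
    if N1: "1 \<le> N"
    and as1: "ln 4 + 3 * ln (2 * real N + 1) + 3 * C * (2 * real N) powr (1 - s) + 2 * (2 * real N) powr s + K \<le> real N powr (1 - s / 2)"
    and as2: "ln 4 + 3 * C * (2 * real N) powr (1 - s) + 2 * (2 * real N) powr s + K \<le> \<gamma> * real N / 2"
    and as3: "2 * C * (2 * real N) powr (1 - s) + ln (4/3) \<le> (8 * \<gamma>) * real N"
    and as4: "ln (12 * real N + 12) + real N powr (s / 2) \<le> (2 * real N) powr s" for N
  proof -
    define M where "M = 2 * N"
    define X where "X = 2 * real N"
    have X: "X = real M" "2 \<le> M" "2 \<le> X" using N1 by (auto simp: X_def M_def)
    define \<epsilon> where "\<epsilon> = exp (- (X powr s))"
    define \<mu> where "\<mu> = exp (- (C * X powr (1 - s)))"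
    have \<epsilon>: "0 < \<epsilon>" "\<epsilon> \<le> 1/2"
    proof -
      have "1 \<le> X powr s" using X s by (intro ge_one_powr_ge_zero) auto
      then have "\<epsilon> \<le> exp (- 1)" by (simp add: \<epsilon>_def)
      also have "exp (- 1) \<le> (1 / 2 :: real)"
        using exp_ge_add_one_self[of "1::real"] by (simp add: exp_minus field_simps)
      finally show "\<epsilon> \<le> 1/2" .
    qed (simp add: \<epsilon>_def)
    have \<mu>: "0 < \<mu>" by (simp add: \<mu>_def)
    define a :: "(nat \<Rightarrow> real) \<Rightarrow> nat \<Rightarrow> complex"
      where "a x i = lam * ee (skew_lift \<omega> x r (- int N + int i))" for x i
    have a_norm: "cmod (a x i) = cmod lam" for x i by (simp add: a_def norm_mult)
    define D where "D x = z * fst (szego (a x) z (1, - \<beta>) M) - cnj \<beta>' * snd (szego (a x) z (1, - \<beta>) M)" for x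
    define B1 where "B1 = {x \<in> torus r. cmod (q0 (a x) z M) < \<mu>}"
    define B2 where "B2 = {x \<in> torus r. \<mu> \<le> cmod (q0 (a x) z M) \<and> cmod (D x) < 2 * \<epsilon>\<^sup>2 * cmod (q0 (a x) z M)}"
    have a_meas: "(\<lambda>x. a x i) \<in> borel_measurable (torus_borel r)" for i
      unfolding a_def
      by (intro borel_measurable_times borel_measurable_const ee_measurable skew_lift_measurable order_refl)
    have q_meas: "(\<lambda>x. q0 (a x) z M) \<in> borel_measurable (torus_borel r)"
      unfolding q0_def by (rule szego_measurable[where a = a, OF a_meas, THEN conjunct2])
    have D_meas: "D \<in> borel_measurable (torus_borel r)"
      unfolding D_def[abs_def] using szego_measurable[where a = a, OF a_meas, of z "(1, - \<beta>)" M]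
      by (intro borel_measurable_diff borel_measurable_times borel_measurable_const) auto
    have B1_sets: "B1 \<in> sets (torus_borel r)"
      unfolding B1_def space_torus_borel[symmetric] using q_meas by measurable
    have B2_sets: "B2 \<in> sets (torus_borel r)"
      unfolding B2_def space_torus_borel[symmetric] using q_meas D_meas by measurable
    have orbit: "skew_orbit \<omega> (\<lambda>n l. skew_lift \<omega> x l n)" for x by (rule skew_lift_orbit)
    have B1_meas: "emeasure (torus_borel r) B1 \<le> ennreal (real M * (6 * \<epsilon>))"
    proof (rule emeasure_by_sections[of "r - 1", OF _ B1_sets])
      show "r - 1 \<in> {1..r}" using r by auto
      fix x assume "x \<in> torus r"
      define x' where "x' = x(r - 1 := 0)"
      obtain u where u: "\<And>i. i < M \<Longrightarrow> cmod (u i) \<le> 1"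
        and low: "\<And>z. cmod z = 1 \<Longrightarrow> (\<And>i. i < M \<Longrightarrow> \<epsilon> \<le> cmod (1 - u i * z)) \<Longrightarrow> \<mu> \<le> cmod (q0 (a x') z M)"
      proof -
        from lower[OF orbit[of x'] order_refl X(2), of "- int N", folded X(1), folded \<epsilon>_def \<mu>_def]
        obtain u where u: "\<forall>i<M. cmod (u i) \<le> 1" and low: "\<forall>z. cmod z = 1 \<longrightarrow> (\<forall>i<M. \<epsilon> \<le> cmod (1 - u i * z)) \<longrightarrow>
            \<mu> \<le> cmod (q0 (\<lambda>i. lam * ee (skew_lift \<omega> x' r (- int N + int i))) z M)"
          by (elim exE conjE)
        show thesis
        proof (rule that[of u])
          show "cmod (u i) \<le> 1" if "i < M" for i using u that by simp
          show "\<mu> \<le> cmod (q0 (a x') z M)" if "cmod z = 1" "\<And>i. i < M \<Longrightarrow> \<epsilon> \<le> cmod (1 - u i * z)" for z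
            using low[rule_format, OF that(1)] that(2) by (simp add: a_def[abs_def])
        qed
      qed
      define S where "S i = {t \<in> {0..<1}. cmod (1 - u i * (z * ee t)) < \<epsilon>}" for i
      have cov: "\<exists>A. A \<in> sets borel \<and> S i \<subseteq> A \<and> emeasure lborel A \<le> ennreal (6 * \<epsilon>)" if i: "i < M" for i
      proof (rule arc_cover)
        fix t t' assume t: "t \<in> S i" "t' \<in> S i"
        have "u i * (z * (ee t - ee t')) = (1 - u i * (z * ee t')) - (1 - u i * (z * ee t))"
          by (simp add: algebra_simps)
        then have "cmod (u i * (z * (ee t - ee t'))) \<le> cmod (1 - u i * (z * ee t')) + cmod (1 - u i * (z * ee t))"
          by (simp only: norm_triangle_ineq4)
        also have "\<dots> < 2 * \<epsilon>" using t by (simp add: S_def)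
        finally have "cmod (u i) * cmod (ee t - ee t') < 2 * \<epsilon>" using z by (simp add: norm_mult)
        moreover have "1/2 \<le> cmod (u i)"
        proof -
          have "1 - \<epsilon> \<le> cmod (u i * (z * ee t))"
            using norm_triangle_ineq2[of 1 "1 - u i * (z * ee t)"] t by (simp add: S_def)
          then show ?thesis using z \<epsilon> by (simp add: norm_mult)
        qed
        then have "1/2 * cmod (ee t - ee t') \<le> cmod (u i) * cmod (ee t - ee t')"
          by (intro mult_right_mono) auto
        ultimately show "cmod (ee t - ee t') < 4 * \<epsilon>" by linarith
      qed (use \<epsilon> in \<open>auto simp: S_def\<close>)
      have "{t \<in> {0..<1}. x(r - 1 := t) \<in> B1} \<subseteq> (\<Union>i<M. S i)"
      proof
        fix t assume "t \<in> {t \<in> {0..<1}. x(r - 1 := t) \<in> B1}"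
        then have t: "t \<in> {0..<1}" "cmod (q0 (a (x(r - 1 := t))) z M) < \<mu>" by (auto simp: B1_def)
        have "a (x(r - 1 := t)) = (\<lambda>i. a x' i * (ee (- real N * t) * ee t ^ i))"
        proof
          fix i
          have "of_int (- int N + int i) * t = - real N * t + real i * t"
            by (simp add: algebra_simps)
          then have "ee (of_int (- int N + int i) * t) = ee (- real N * t) * ee t ^ i"
            by (simp only: ee_add ee_of_nat_mult)
          then show "a (x(r - 1 := t)) i = a x' i * (ee (- real N * t) * ee t ^ i)"
            unfolding a_def x'_def skew_lift_last_but_one[OF r, of \<omega> x t] ee_add by (simp only: mult_ac)
        qed
        then have "q0 (a (x(r - 1 := t))) z M = q0 (a x') (z * ee t) M"
          using q0_gauge[of "ee (- real N * t)" "ee t" "a x'" z M] by simp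
        then have "\<not> (\<forall>i<M. \<epsilon> \<le> cmod (1 - u i * (z * ee t)))"
          using low[of "z * ee t"] t(2) z by (auto simp: norm_mult)
        then show "t \<in> (\<Union>i<M. S i)" using t(1) by (auto simp: S_def not_le)
      qed
      moreover obtain A where "A \<in> sets borel" "(\<Union>i<M. S i) \<subseteq> A" "emeasure lborel A \<le> ennreal (real M * (6 * \<epsilon>))"
        using arc_union_cover[of M S "6 * \<epsilon>"] cov \<epsilon> by auto
      ultimately show "\<exists>A. A \<in> sets borel \<and> {t \<in> {0..<1}. x(r - 1 := t) \<in> B1} \<subseteq> A \<and> emeasure lborel A \<le> ennreal (real M * (6 * \<epsilon>))"
        by blast
    qed
    \<comment> \<open>Hence \<open>q1\<close> is comparable to \<open>q0\<close> as soon as $|q0| \ge \mu$.\<close>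
    have rotation_bound: "(\<rho> ^ M)\<^sup>2 \<le> 3/4 * \<mu>\<^sup>2"
    proof -
      have "(\<rho> ^ M)\<^sup>2 = exp (- (8 * \<gamma> * real N))"
        by (simp add: \<gamma>(2) M_def exp_of_nat_mult[symmetric] exp_double[symmetric])
      also have "\<dots> \<le> exp (- (2 * C * X powr (1 - s) + ln (4/3)))"
        using as3 by (simp add: X_def)
      also have "\<dots> = exp (ln (3/4)) * (exp (- (C * X powr (1 - s))))\<^sup>2"
        by (simp add: exp_double[symmetric] exp_add[symmetric] ln_div)
      finally show ?thesis by (simp add: \<mu>_def)
    qed
    have B2_meas: "emeasure (torus_borel r) B2 \<le> ennreal (12 * \<epsilon>)"
    proof (rule emeasure_by_sections[of r, OF _ B2_sets])
      show "r \<in> {1..r}" using r by auto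
      fix x assume "x \<in> torus r"
      define c where "c = a (x(r := 0))"
      define Q0 Q1 where "Q0 = q0 c z M" and "Q1 = q1 c z M"
      have ax: "a (x(r := t)) = (\<lambda>i. c i * ee t)" for t
      proof
        show "a (x(r := t)) i = c i * ee t" for i
          unfolding a_def c_def skew_lift_last[of r \<omega> x t, OF order_trans[OF _ r, of 1], simplified] ee_add
          by (simp only: mult_ac)
      qed
      have q0x: "q0 (a (x(r := t))) z M = Q0" for t
        using q0_gauge[of "ee t" 1 c z M] by (simp add: ax Q0_def)
      show "\<exists>A. A \<in> sets borel \<and> {t \<in> {0..<1}. x(r := t) \<in> B2} \<subseteq> A \<and> emeasure lborel A \<le> ennreal (12 * \<epsilon>)"
      proof (cases "\<mu> \<le> cmod Q0")
        case False
        then have "{t \<in> {0..<1}. x(r := t) \<in> B2} = {}" by (auto simp: B2_def q0x)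
        then show ?thesis by (intro exI[of _ "{}"]) simp
      next
        case True
        have "(cmod Q0)\<^sup>2 - (cmod Q1)\<^sup>2 = (\<rho> ^ M)\<^sup>2"
          unfolding Q0_def Q1_def by (rule q0_q1_norms[OF z]) (simp add: c_def a_norm \<rho>(3))
        moreover have "\<mu>\<^sup>2 \<le> (cmod Q0)\<^sup>2" using True \<mu> by (intro power_mono) auto
        ultimately have "(cmod Q0 / 2)\<^sup>2 \<le> (cmod Q1)\<^sup>2"
          using rotation_bound by (simp add: power_divide)
        then have Q01: "cmod Q0 \<le> 2 * cmod Q1" using power2_le_imp_le[of "cmod Q0 / 2" "cmod Q1"] by simp
        then have Q1: "Q1 \<noteq> 0" using True \<mu> by auto
        define A B C' where "A = z ^ Suc M * cnj Q0 + \<beta> * cnj \<beta>' * Q0" and "B = - cnj \<beta>' * Q1"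
          and "C' = - \<beta> * z ^ Suc M * cnj Q1"
        have B: "B \<noteq> 0" "cmod B = cmod Q1" using Q1 b2 by (auto simp: B_def norm_mult)
        have Dx: "cmod (D (x(r := t))) = cmod (B * ee t ^ 2 + A * ee t + C')" for t
        proof -
          have "ee t * D (x(r := t)) = B * ee t ^ 2 + A * ee t + C'"
            unfolding D_def ax B_def A_def C'_def Q0_def Q1_def
            by (rule boundary_form_rotation[OF cmod_ee z])
          then show ?thesis using norm_mult[of "ee t" "D (x(r := t))"] by simp
        qed
        obtain S where S: "S \<in> sets borel" "{t \<in> {0..<1}. cmod (B * ee t ^ 2 + A * ee t + C') < (2 * \<epsilon>)\<^sup>2 * cmod B} \<subseteq> S"
          "emeasure lborel S \<le> ennreal (2 * (6 * \<epsilon>))"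
          using quadratic_arc_cover[of B \<epsilon> A C'] B(1) \<epsilon> by auto
        have "{t \<in> {0..<1}. x(r := t) \<in> B2} \<subseteq> {t \<in> {0..<1}. cmod (B * ee t ^ 2 + A * ee t + C') < (2 * \<epsilon>)\<^sup>2 * cmod B}"
        proof
          fix t assume "t \<in> {t \<in> {0..<1}. x(r := t) \<in> B2}"
          then have t: "t \<in> {0..<1}" "cmod (D (x(r := t))) < 2 * \<epsilon>\<^sup>2 * cmod Q0" by (auto simp: B2_def q0x)
          note t(2)
          also have "2 * \<epsilon>\<^sup>2 * cmod Q0 \<le> 2 * \<epsilon>\<^sup>2 * (2 * cmod Q1)" using Q01 by (intro mult_left_mono) auto
          also have "\<dots> = (2 * \<epsilon>)\<^sup>2 * cmod B" by (simp add: B(2) power2_eq_square)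
          finally show "t \<in> {t \<in> {0..<1}. cmod (B * ee t ^ 2 + A * ee t + C') < (2 * \<epsilon>)\<^sup>2 * cmod B}"
            using t(1) by (simp add: Dx)
        qed
        then show ?thesis using S by (intro exI[of _ S]) auto
      qed
    qed
    \<comment> \<open>Outside of the two sets $|D| \ge 2 \epsilon^2 \mu$, which is subexponentially small only.\<close>
    have sub: "bad N \<subseteq> B1 \<union> B2"
    proof
      fix x assume x: "x \<in> bad N"
      then have xt: "x \<in> torus r" by (simp add: bad_def)
      show "x \<in> B1 \<union> B2"
      proof (rule ccontr)
        assume "x \<notin> B1 \<union> B2"
        then have g1: "\<mu> \<le> cmod (q0 (a x) z M)" and g2: "2 * \<epsilon>\<^sup>2 * cmod (q0 (a x) z M) \<le> cmod (D x)"
          using xt by (auto simp: B1_def B2_def)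
        define \<alpha> where "\<alpha> = skew_alpha lam \<omega> r x"
        have \<alpha>: "\<alpha> n = lam * ee (skew_lift \<omega> x r n)" for n
          unfolding \<alpha>_def by (rule skew_alpha_lift[OF xt]) (use r in simp)
        interpret box: cmv_box \<alpha> \<beta> \<beta>' z \<rho> "- int N" "int N"
          by unfold_locales (use b1 b2 z \<rho> N1 in \<open>auto simp: \<alpha> norm_mult\<close>)
        have k: "box.k = M" by (simp add: box.k_def M_def)
        have c: "box.c = a x" by (rule ext) (simp add: box.c_def a_def \<alpha>)
        have D: "box.D = D x" by (simp add: box.D_def box.row_functional_def D_def c k)
        define Q where "Q = exp (C * X powr (1 - s))"
        have Q: "cmod (q0 (\<lambda>j. box.c (i + j)) z n) \<le> Q" if "i + n \<le> box.k" for i n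
        proof -
          have "(\<lambda>j. box.c (i + j)) = (\<lambda>j. lam * ee (skew_lift \<omega> x r ((- int N + int i) + int j)))"
            by (rule ext) (simp add: c a_def algebra_simps)
          then show ?thesis
            using upper[OF orbit[of x] _ X(2) z, of n "- int N + int i"] that k by (simp add: Q_def X(1))
        qed
        have Dlow: "2 * \<epsilon>\<^sup>2 * \<mu> \<le> cmod (D x)"
          using g2 mult_left_mono[OF g1, of "2 * \<epsilon>\<^sup>2"] by simp
        moreover have low_pos: "0 < 2 * \<epsilon>\<^sup>2 * \<mu>" using \<epsilon> \<mu> by simp
        ultimately have D_pos: "0 < cmod (D x)" by linarith
        then have D0: "box.D \<noteq> 0" unfolding D by simp
        define G where "G = 4 * exp (3 * C * X powr (1 - s) + 2 * X powr s)"
        have Gb: "8 * Q\<^sup>2 / cmod box.D \<le> G"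
        proof -
          have "8 * Q\<^sup>2 / cmod box.D \<le> 8 * Q\<^sup>2 / (2 * \<epsilon>\<^sup>2 * \<mu>)"
            unfolding D by (rule divide_left_mono[OF Dlow _ mult_pos_pos[OF D_pos low_pos]]) simp
          also have "\<dots> = 4 * (exp (2 * (C * X powr (1 - s))) * (exp (2 * X powr s) * exp (C * X powr (1 - s))))"
            by (simp add: Q_def \<epsilon>_def \<mu>_def exp_double[symmetric] exp_minus field_simps)
          also have "\<dots> = G" by (simp add: G_def exp_add[symmetric] algebra_simps)
          finally show ?thesis .
        qed
        have nn: "nat (int N - - int N + 1) = 2 * N + 1" by simp
        note bounds = box.resolvent_bounds[OF Q D0 less_imp_le[OF \<rho>(2)], unfolded nn]
        have "suitable \<gamma> (real N powr \<tau>) p \<alpha> \<beta> \<beta>' z N"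
          unfolding suitable_def
        proof (intro conjI ballI impI)
          show "invertible_mat (cmv_E_box_minus \<alpha> \<beta> \<beta>' (- int N) (int N) z)" using bounds(1) by simp
          have "l2_op_norm (mat_inv (cmv_E_box_minus \<alpha> \<beta> \<beta>' (- int N) (int N) z))
            \<le> (real (2 * N + 1))\<^sup>2 * (real (2 * N + 1) * G)"
            using bounds(2) Gb by (meson mult_left_mono of_nat_0_le_iff order_trans zero_le_power2)
          also have "\<dots> = exp (ln 4 + 3 * ln (2 * real N + 1) + 3 * C * X powr (1 - s) + 2 * X powr s)"
          proof -
            have "exp (3 * ln (2 * real N + 1)) = (2 * real N + 1) ^ 3"
              using exp_of_nat_mult[of 3 "ln (2 * real N + 1)"] by simp
            then show ?thesis by (simp add: exp_add G_def power2_eq_square power3_eq_cube add.commute)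
          qed
          also have "\<dots> \<le> exp (real N powr \<tau> - K)" using as1 by (simp add: X_def \<tau>_def)
          also have "\<dots> \<le> exp (real N powr \<tau> - p * ln 2)" by (simp add: K_def distrib_right)
          also have "\<dots> = 2 powr (- p) * exp (real N powr \<tau>)"
            by (simp add: powr_def exp_diff exp_minus field_simps)
          finally show "l2_op_norm (mat_inv (cmv_E_box_minus \<alpha> \<beta> \<beta>' (- int N) (int N) z))
            \<le> 2 powr (- p) * exp (real N powr \<tau>)" .
        next
          fix l m assume lm: "l \<in> {- int N..int N}" "m \<in> {- int N..int N}" "real N / 2 \<le> real_of_int \<bar>l - m\<bar>"
          define d where "d = real_of_int \<bar>l - m\<bar>"
          have "cmod (green \<alpha> \<beta> \<beta>' (- int N) (int N) z l m) \<le> 8 * Q\<^sup>2 / cmod box.D * \<rho> ^ nat \<bar>l - m\<bar>"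
            by (rule bounds(3)[OF _ lm(1,2)])
          also have "\<dots> \<le> G * \<rho> ^ nat \<bar>l - m\<bar>"
            using Gb \<rho> by (intro mult_right_mono) auto
          also have "\<rho> ^ nat \<bar>l - m\<bar> = exp (- 2 * \<gamma> * d)"
            by (simp add: \<gamma>(2) d_def exp_of_nat_mult[symmetric] mult_ac)
          also have "G * exp (- 2 * \<gamma> * d) = exp (ln 4 + 3 * C * X powr (1 - s) + 2 * X powr s - 2 * \<gamma> * d)"
            by (simp add: G_def exp_add exp_diff exp_minus field_simps)
          also have "\<dots> \<le> exp (- K - \<gamma> * d)"
          proof -
            have "\<gamma> * (real N / 2) \<le> \<gamma> * d" using \<gamma> lm(3) by (intro mult_left_mono) (auto simp: d_def)
            then show ?thesis using as2 by (simp add: X_def)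
          qed
          also have "\<dots> = 2 powr (- (p + 1)) * exp (- \<gamma> * d)"
            by (simp add: powr_def K_def exp_add[symmetric] algebra_simps)
          finally show "cmod (green \<alpha> \<beta> \<beta>' (- int N) (int N) z l m)
            \<le> 2 powr (- (p + 1)) * exp (- \<gamma> * real_of_int \<bar>l - m\<bar>)" by (simp add: d_def)
        qed
        then show False using x by (simp add: bad_def \<alpha>_def)
      qed
    qed
    have "emeasure (torus_borel r) (bad N) \<le> emeasure (torus_borel r) (B1 \<union> B2)"
      using sub B1_sets B2_sets by (intro emeasure_mono) auto
    also have "\<dots> \<le> emeasure (torus_borel r) B1 + emeasure (torus_borel r) B2"
      using B1_sets B2_sets by (intro emeasure_subadditive)
    also have "\<dots> \<le> ennreal (real M * (6 * \<epsilon>)) + ennreal (12 * \<epsilon>)"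
      by (intro add_mono B1_meas B2_meas)
    also have "\<dots> = ennreal ((12 * real N + 12) * \<epsilon>)"
      using \<epsilon> by (simp add: M_def algebra_simps flip: ennreal_plus)
    finally have "measure (torus_borel r) (bad N) \<le> (12 * real N + 12) * \<epsilon>"
      using \<epsilon> by (simp add: P.emeasure_eq_measure)
    also have "\<dots> = exp (ln (12 * real N + 12) - X powr s)"
      by (simp add: \<epsilon>_def exp_diff exp_minus field_simps)
    also have "\<dots> \<le> exp (- (real N powr \<sigma>))" using as4 by (simp add: X_def \<sigma>_def)
    finally show ?thesis .
  qed
  have "0 < 8 * \<gamma>" using \<gamma>(1) by simp
  note exponents = eventually_exponents(1,2,4)[OF s C \<gamma>(1)] eventually_exponents(3)[OF s C \<open>0 < 8 * \<gamma>\<close>]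
  have ev: "\<forall>\<^sub>F N in sequentially. measure (torus_borel r) (bad N) \<le> exp (- (real N powr \<sigma>))"
    using eventually_ge_at_top[of 1] exponents(1)[of K] exponents(2)[of K] exponents(4)[of "ln (4/3)"] exponents(3)
    by eventually_elim (rule main)
  have "\<forall>\<^sub>F N in sequentially. bad N \<in> sets (torus_measure r) \<and> measure (torus_measure r) (bad N) \<le> exp (- (real N powr \<sigma>))"
    using ev
  proof eventually_elim
    case (elim N)
    then show ?case unfolding torus_measure_eq
      using bad_sets[of N] by (simp add: sets_completionI_sets measure_completion)
  qed
  then show ?thesis
    unfolding bad_def using s \<gamma>(1)
    by (intro bexI[of _ \<sigma>] bexI[of _ \<tau>] exI[of _ \<gamma>]) (auto simp: \<sigma>_def \<tau>_def)
qed

end
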